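(* The following decision problem, \textsc{One-Sided $k$-Planarity}, is \textsf{NP}-complete. Input: a 2-layer network $G=(X,Y,E)$, an integer $k\ge 0$, and a linear order $<_X$ of $X$. Question: does $Y$ admit a linear order $<_Y$ such that the 2-layer drawing $(<_X,<_Y)$ of $G$ is $k$-planar?
   Context: A 2-layer network $(X,Y,E)$ is a bipartite graph with vertex set $X\cup Y$, $X\cap Y=\emptyset$, whose edges are written $(x,y)$ with $x\in X$, $y\in Y$. A 2-layer drawing of $G$ is a pair $(<_X,<_Y)$ of linear orders of $X$ and $Y$. Two edges $(x_1,y_1)$ and $(x_2,y_2)$ cross in this drawing iff $(x_1<_X x_2 \wedge y_2<_Y y_1)$ or $(x_2<_X x_1\wedge y_1<_Y y_2)$. The drawing is $k$-planar if every edge crosses at most $k$ edges. *)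

theory Defs
  imports "HOL-Computational_Algebra.Polynomial"
begin

section \<open>Deterministic multi-tape Turing machines\<close>

datatype move = Move_Left | Stay | Move_Right

text \<open>
  States and tape symbols are initial segments of the naturals, so that one can quantify over
  all machines.  The transition function is total on the type, but \<open>wf_tm\<close> makes the finite set
  of states and symbols closed under it, so only a finite table of it is ever used.
\<close>

record tm =
  num_tapes :: nat
  num_symbols :: nat
  num_states :: nat
  start_state :: nat
  accept_state :: nat
  reject_state :: nat
  delta :: "nat \<Rightarrow> nat list \<Rightarrow> nat \<times> (nat \<times> move) list"

text \<open>Tape symbols: blank, the two input bits, and a separator; further symbols are work symbols.\<close>

definition blank :: nat where "blank = 0"

definition bit_symbol :: "bool \<Rightarrow> nat" where
  "bit_symbol b = (if b then 2 else 1)"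

definition separator :: nat where "separator = 3"

definition wf_tm :: "tm \<Rightarrow> bool" where
  "wf_tm M \<longleftrightarrow>
     1 \<le> num_tapes M \<and> 4 \<le> num_symbols M \<and>
     start_state M < num_states M \<and> accept_state M < num_states M \<and>
     reject_state M < num_states M \<and> accept_state M \<noteq> reject_state M \<and>
     (\<forall>q rs. q < num_states M \<and> length rs = num_tapes M \<and> (\<forall>a\<in>set rs. a < num_symbols M) \<longrightarrow>
        (case delta M q rs of (q', acts) \<Rightarrow>
           q' < num_states M \<and> length acts = num_tapes M \<and>
           (\<forall>(a, m)\<in>set acts. a < num_symbols M)))"

text \<open>A tape is a two-way infinite sequence of cells together with the head position.\<close>

type_synonym tape = "(int \<Rightarrow> nat) \<times> int"
type_synonym config = "nat \<times> tape list"

fun move_offset :: "move \<Rightarrow> int" where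
  "move_offset Move_Left = - 1"
| "move_offset Stay = 0"
| "move_offset Move_Right = 1"

fun tape_read :: "tape \<Rightarrow> nat" where
  "tape_read (t, h) = t h"

fun tape_act :: "nat \<times> move \<Rightarrow> tape \<Rightarrow> tape" where
  "tape_act (a, m) (t, h) = (t(h := a), h + move_offset m)"

definition halting_state :: "tm \<Rightarrow> nat \<Rightarrow> bool" where
  "halting_state M q \<longleftrightarrow> q = accept_state M \<or> q = reject_state M"

fun tm_step :: "tm \<Rightarrow> config \<Rightarrow> config" where
  "tm_step M (q, ts) =
     (if halting_state M q then (q, ts)
      else case delta M q (map tape_read ts) of
        (q', acts) \<Rightarrow> (q', map2 tape_act acts ts))"

definition input_tape :: "nat list \<Rightarrow> tape" where
  "input_tape w = ((\<lambda>i. if 0 \<le> i \<and> i < int (length w) then w ! nat i else blank), 0)"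

definition initial_config :: "tm \<Rightarrow> nat list \<Rightarrow> config" where
  "initial_config M w =
     (start_state M, input_tape w # replicate (num_tapes M - 1) (input_tape []))"

definition config_after :: "tm \<Rightarrow> nat list \<Rightarrow> nat \<Rightarrow> config" where
  "config_after M w t = (tm_step M ^^ t) (initial_config M w)"

definition halts_within :: "tm \<Rightarrow> nat list \<Rightarrow> nat \<Rightarrow> bool" where
  "halts_within M w n \<longleftrightarrow> (\<exists>t\<le>n. halting_state M (fst (config_after M w t)))"

definition accepts :: "tm \<Rightarrow> nat list \<Rightarrow> bool" where
  "accepts M w \<longleftrightarrow> (\<exists>t. fst (config_after M w t) = accept_state M)"

text \<open>The output is the word on the first tape that runs from the head to the first blank.\<close>

definition has_output :: "config \<Rightarrow> nat list \<Rightarrow> bool" where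
  "has_output c v \<longleftrightarrow>
     (case hd (snd c) of (t, h) \<Rightarrow>
        (\<forall>i<length v. t (h + int i) = v ! i) \<and> t (h + int (length v)) = blank)"


section \<open>NP-completeness\<close>

type_synonym language = "bool list set"

definition poly_time_computable :: "(bool list \<Rightarrow> bool list) \<Rightarrow> bool" where
  "poly_time_computable f \<longleftrightarrow>
     (\<exists>M (p :: nat poly). wf_tm M \<and>
        (\<forall>w. \<exists>t\<le>poly p (length w).
           halting_state M (fst (config_after M (map bit_symbol w) t)) \<and>
           has_output (config_after M (map bit_symbol w) t) (map bit_symbol (f w))))"

definition poly_reducible :: "language \<Rightarrow> language \<Rightarrow> bool" where
  "poly_reducible A B \<longleftrightarrow> (\<exists>f. poly_time_computable f \<and> (\<forall>w. w \<in> A \<longleftrightarrow> f w \<in> B))"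

definition with_certificate :: "bool list \<Rightarrow> bool list \<Rightarrow> nat list" where
  "with_certificate w u = map bit_symbol w @ [separator] @ map bit_symbol u"

definition NP :: "language set" where
  "NP = {L. \<exists>V (p :: nat poly) (q :: nat poly). wf_tm V \<and>
     (\<forall>w u. halts_within V (with_certificate w u) (poly p (length (with_certificate w u)))) \<and>
     (\<forall>w. w \<in> L \<longleftrightarrow>
        (\<exists>u. length u \<le> poly q (length w) \<and> accepts V (with_certificate w u)))}"

definition NP_hard :: "language \<Rightarrow> bool" where
  "NP_hard L \<longleftrightarrow> (\<forall>A\<in>NP. poly_reducible A L)"

definition NP_complete :: "language \<Rightarrow> bool" where
  "NP_complete L \<longleftrightarrow> L \<in> NP \<and> NP_hard L"


section \<open>Two-layer networks and drawings\<close>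

definition two_layer_network :: "'a set \<Rightarrow> 'a set \<Rightarrow> ('a \<times> 'a) set \<Rightarrow> bool" where
  "two_layer_network X Y E \<longleftrightarrow> finite X \<and> finite Y \<and> X \<inter> Y = {} \<and> E \<subseteq> X \<times> Y"

text \<open>Linear orders are reflexive relations in the library; the strict order is its irreflexive part.\<close>

definition strictly_below :: "'a rel \<Rightarrow> 'a \<Rightarrow> 'a \<Rightarrow> bool" where
  "strictly_below r a b \<longleftrightarrow> (a, b) \<in> r \<and> a \<noteq> b"

definition two_layer_drawing :: "'a set \<Rightarrow> 'a set \<Rightarrow> 'a rel \<Rightarrow> 'a rel \<Rightarrow> bool" where
  "two_layer_drawing X Y rX rY \<longleftrightarrow> linear_order_on X rX \<and> linear_order_on Y rY"

fun edges_cross :: "'a rel \<Rightarrow> 'a rel \<Rightarrow> 'a \<times> 'a \<Rightarrow> 'a \<times> 'a \<Rightarrow> bool" where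
  "edges_cross rX rY (x1, y1) (x2, y2) \<longleftrightarrow>
     (strictly_below rX x1 x2 \<and> strictly_below rY y2 y1) \<or>
     (strictly_below rX x2 x1 \<and> strictly_below rY y1 y2)"

definition k_planar :: "nat \<Rightarrow> ('a \<times> 'a) set \<Rightarrow> 'a rel \<Rightarrow> 'a rel \<Rightarrow> bool" where
  "k_planar k E rX rY \<longleftrightarrow> (\<forall>e\<in>E. card {e' \<in> E. edges_cross rX rY e e'} \<le> k)"


section \<open>The decision problem\<close>

type_synonym planarity_input = "nat set \<times> nat set \<times> (nat \<times> nat) set \<times> nat \<times> nat rel"

fun valid_instance :: "planarity_input \<Rightarrow> bool" where
  "valid_instance (X, Y, E, k, rX) \<longleftrightarrow> two_layer_network X Y E \<and> linear_order_on X rX"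

fun yes_instance :: "planarity_input \<Rightarrow> bool" where
  "yes_instance (X, Y, E, k, rX) \<longleftrightarrow>
     (\<exists>rY. two_layer_drawing X Y rX rY \<and> k_planar k E rX rY)"

text \<open>
  Vertex names and \<open>k\<close> are written in binary, least significant bit first.  Numbers and lists are
  made self-delimiting by preceding every digit or entry with \<open>True\<close> and ending with \<open>False\<close>.
\<close>

fun binary :: "nat \<Rightarrow> bool list" where
  "binary n = (if n = 0 then [] else odd n # binary (n div 2))"

declare binary.simps [simp del]

definition encode_list :: "('a \<Rightarrow> bool list) \<Rightarrow> 'a list \<Rightarrow> bool list" where
  "encode_list f xs = concat (map (\<lambda>x. True # f x) xs) @ [False]"

definition encode_nat :: "nat \<Rightarrow> bool list" where
  "encode_nat n = encode_list (\<lambda>b. [b]) (binary n)"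

fun encode_edge :: "nat \<times> nat \<Rightarrow> bool list" where
  "encode_edge (x, y) = encode_nat x @ encode_nat y"

definition encode_lists :: "nat list \<Rightarrow> nat list \<Rightarrow> (nat \<times> nat) list \<Rightarrow> nat \<Rightarrow> bool list" where
  "encode_lists xs ys es k =
     encode_list encode_nat xs @ encode_list encode_nat ys @ encode_list encode_edge es @
     encode_nat k"

text \<open>
  The vertices of \<open>X\<close> are listed in increasing order, which is how the order is
  part of the input; those of \<open>Y\<close> and the edges are listed in any order.
\<close>

fun encodes :: "bool list \<Rightarrow> planarity_input \<Rightarrow> bool" where
  "encodes w (X, Y, E, k, rX) \<longleftrightarrow>
     (\<exists>xs ys es. distinct xs \<and> set xs = X \<and> sorted_wrt (strictly_below rX) xs \<and>
        distinct ys \<and> set ys = Y \<and> distinct es \<and> set es = E \<and>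
        w = encode_lists xs ys es k)"

definition One_Sided_k_Planarity :: language where
  "One_Sided_k_Planarity = {w. \<exists>I. valid_instance I \<and> encodes w I \<and> yes_instance I}"


subsection \<open>Every instance has an encoding, and an encoding determines its instance\<close>

lemma encode_list_prefix:
  assumes "\<And>x y u v. f x @ u = f y @ v \<Longrightarrow> x = y \<and> u = v"
  shows "encode_list f xs @ u = encode_list f ys @ v \<Longrightarrow> xs = ys \<and> u = v"
proof (induction xs arbitrary: ys)
  case Nil
  then show ?case by (cases ys) (auto simp: encode_list_def)
next
  case (Cons x xs)
  then obtain y ys' where ys: "ys = y # ys'"
    by (cases ys) (auto simp: encode_list_def)
  with Cons.prems have "f x @ (encode_list f xs @ u) = f y @ (encode_list f ys' @ v)"
    by (simp add: encode_list_def)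
  with assms have "x = y" "encode_list f xs @ u = encode_list f ys' @ v" by blast+
  with Cons.IH ys show ?case by blast
qed

lemma binary_inj: "binary m = binary n \<Longrightarrow> m = n"
proof (induction m arbitrary: n rule: less_induct)
  case (less m)
  show ?case
  proof (cases "m = 0 \<or> n = 0")
    case True
    with less.prems show ?thesis
      by (auto simp: binary.simps[of m] binary.simps[of n] split: if_splits)
  next
    case False
    with less.prems have "odd m = odd n" "binary (m div 2) = binary (n div 2)"
      by (simp_all add: binary.simps[of m] binary.simps[of n])
    moreover from this False less.IH have "m div 2 = n div 2" by simp
    ultimately show ?thesis
      by (metis bit_eq_rec)
  qed
qed

lemma encode_nat_prefix: "encode_nat m @ u = encode_nat n @ v \<Longrightarrow> m = n \<and> u = v"
  using encode_list_prefix[of "\<lambda>b. [b]"] binary_inj unfolding encode_nat_def by (metis append_Cons append_Nil list.inject)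

lemma encode_edge_prefix: "encode_edge e @ u = encode_edge e' @ v \<Longrightarrow> e = e' \<and> u = v"
  by (cases e; cases e') (auto dest!: encode_nat_prefix)

lemma encode_lists_inj:
  assumes "encode_lists xs ys es k = encode_lists xs' ys' es' k'"
  shows "xs = xs' \<and> ys = ys' \<and> es = es' \<and> k = k'"
  using assms unfolding encode_lists_def
  by (metis encode_list_prefix[of encode_nat, OF encode_nat_prefix]
      encode_list_prefix[of encode_edge, OF encode_edge_prefix] encode_nat_prefix append_Nil2)

lemma linear_order_on_list:
  assumes "linear_order_on X r" "distinct xs" "set xs = X" "sorted_wrt (strictly_below r) xs"
  shows "r = {(xs ! i, xs ! j) | i j. i \<le> j \<and> j < length xs}"
proof (intro set_eqI iffI)
  fix z assume z: "z \<in> r"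
  obtain a b where ab: "z = (a, b)" by fastforce
  have "a \<in> X" "b \<in> X" using z ab assms(1) by (auto simp: order_on_defs)
  then obtain i j where ij: "i < length xs" "j < length xs" "a = xs ! i" "b = xs ! j"
    using assms(3) by (metis in_set_conv_nth)
  have "i \<le> j"
  proof (rule ccontr)
    assume "\<not> i \<le> j"
    then have "strictly_below r (xs ! j) (xs ! i)"
      using assms(4) ij by (simp add: sorted_wrt_nth_less)
    then show False
      using z ab ij assms(1) by (auto simp: strictly_below_def order_on_defs dest: antisymD)
  qed
  with ij ab show "z \<in> {(xs ! i, xs ! j) | i j. i \<le> j \<and> j < length xs}" by blast
next
  fix z assume "z \<in> {(xs ! i, xs ! j) | i j. i \<le> j \<and> j < length xs}"
  then obtain i j where ij: "z = (xs ! i, xs ! j)" "i \<le> j" "j < length xs" by blast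
  show "z \<in> r"
  proof (cases "i = j")
    case True
    with ij assms(1,3) show ?thesis by (auto simp: order_on_defs refl_on_def)
  next
    case False
    with ij assms(4) show ?thesis
      using sorted_wrt_nth_less[of "strictly_below r" xs i j] by (simp add: strictly_below_def)
  qed
qed

lemma encodes_unique:
  assumes "valid_instance I" "valid_instance J" "encodes w I" "encodes w J"
  shows "I = J"
proof -
  obtain X Y E k r where I: "I = (X, Y, E, k, r)" by (metis prod_cases5)
  obtain X' Y' E' k' r' where J: "J = (X', Y', E', k', r')" by (metis prod_cases5)
  from assms(3) I obtain xs ys es where
    1: "distinct xs" "set xs = X" "sorted_wrt (strictly_below r) xs" "set ys = Y" "set es = E"
       "w = encode_lists xs ys es k" by auto
  from assms(4) J obtain xs' ys' es' where
    2: "distinct xs'" "set xs' = X'" "sorted_wrt (strictly_below r') xs'" "set ys' = Y'"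
       "set es' = E'" "w = encode_lists xs' ys' es' k'" by auto
  from 1(6) 2(6) have eq: "xs' = xs" "ys' = ys" "es' = es" "k' = k"
    using encode_lists_inj by metis+
  have "r = {(xs ! i, xs ! j) | i j. i \<le> j \<and> j < length xs}"
    using linear_order_on_list[OF _ 1(1-3)] assms(1) I by simp
  moreover have "r' = {(xs' ! i, xs' ! j) | i j. i \<le> j \<and> j < length xs'}"
    using linear_order_on_list[OF _ 2(1-3)] assms(2) J by simp
  ultimately show ?thesis using 1 2 eq I J by simp
qed

lemma linear_order_on_sorted_list:
  assumes lin: "linear_order_on X r" and "finite A" "A \<subseteq> X"
  shows "\<exists>xs. distinct xs \<and> set xs = A \<and> sorted_wrt (strictly_below r) xs"
  using assms(2,3)
proof (induction A rule: finite_psubset_induct)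
  case (psubset A)
  show ?case
  proof (cases "A = {}")
    case False
    have "\<exists>m\<in>A. \<forall>a\<in>A. (m, a) \<in> r"
      using psubset.hyps(1) False psubset.prems
    proof (induction A rule: finite_ne_induct)
      case (singleton x)
      with lin show ?case by (auto simp: order_on_defs refl_on_def)
    next
      case (insert x F)
      then obtain m where m: "m \<in> F" "\<forall>a\<in>F. (m, a) \<in> r" by auto
      have X: "x \<in> X" "m \<in> X" using insert.prems m by auto
      have rx: "(x, x) \<in> r" using lin X by (auto simp: order_on_defs refl_on_def)
      have "(x, m) \<in> r \<or> (m, x) \<in> r"
        using lin X rx by (cases "x = m") (auto simp: order_on_defs total_on_def)
      then show ?case
      proof
        assume "(x, m) \<in> r"
        then have "\<forall>a\<in>insert x F. (x, a) \<in> r"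
          using m rx lin by (auto simp: order_on_defs dest: transD)
        then show ?thesis by blast
      next
        assume "(m, x) \<in> r"
        with m show ?thesis by blast
      qed
    qed
    then obtain m where m: "m \<in> A" "\<forall>a\<in>A. (m, a) \<in> r" by blast
    from m(1) psubset.IH[of "A - {m}"] psubset.prems obtain xs where
      "distinct xs" "set xs = A - {m}" "sorted_wrt (strictly_below r) xs" by blast
    with m have "distinct (m # xs) \<and> set (m # xs) = A \<and> sorted_wrt (strictly_below r) (m # xs)"
      by (auto simp: strictly_below_def)
    then show ?thesis by blast
  qed simp
qed

lemma encodes_exists:
  assumes "valid_instance I"
  shows "\<exists>w. encodes w I"
proof -
  obtain X Y E k r where I: "I = (X, Y, E, k, r)" by (metis prod_cases5)
  have fin: "finite X" "finite Y" "finite E" and lin: "linear_order_on X r"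
    using assms I by (auto simp: two_layer_network_def intro: finite_subset)
  obtain xs where "distinct xs" "set xs = X" "sorted_wrt (strictly_below r) xs"
    using linear_order_on_sorted_list[OF lin fin(1)] by blast
  moreover obtain ys where "distinct ys" "set ys = Y" using finite_distinct_list[OF fin(2)] by blast
  moreover obtain es where "distinct es" "set es = E" using finite_distinct_list[OF fin(3)] by blast
  ultimately show ?thesis using I by auto
qed

end

theory Submission
  imports Defs
begin

text \<open>
  Polynomial-time functions are built from unary counters of polynomial size and a read-only head on
  the input, using recursion with polynomially bounded values. A multi-tape machine simulates such a
  program step by step, with one tape per counter. Both the verifier, whose certificate is the matrix
  of an order of \<open>Y\<close>, and the reduction are functions of this kind.

  For hardness, a run of a verifier is described by clauses. As the machine is deterministic once the
  certificate is fixed, implications between facts about the run suffice. A satisfying assignment is a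
  set of half of all literals that hits every clause and every pair of complementary literals. Such a
  hitting set becomes a drawing as follows. One vertex of \<open>Y\<close>, the pivot, is forced between two guard
  vertices that contribute a large fixed number of crossings to its edges, but less to all
  other edges. Hence only the edges of the pivot are critical, and they only see which of the
  remaining vertices (the literals) precede the pivot. If \<open>a\<close> literals precede it, the edge from the
  pivot to the \<open>j\<close>-th block of \<open>X\<close> gets a number of crossings that depends on \<open>a\<close> and \<open>j\<close>, corrected by
  one for every occurrence of a literal in the \<open>j\<close>-th clause, with a sign that depends on the side of
  the literal. The first and the last block force \<open>a\<close> to be half of the literals, and then block \<open>j\<close>
  says that some literal of the \<open>j\<close>-th clause precedes the pivot.
\<close>

section \<open>Counter programs and their Turing machines\<close>

text \<open>Half of all literals is the size at which the blocks balance. Every literal has equally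
  many edges into every block, so from one block to the next an edge of the pivot gains a fixed
  number of crossings with each literal behind the pivot and loses as many with each literal before
  it. With equally many literals on both sides the count is, up to the corrections, the same at
  every block, and a single \<open>k\<close> can test all clauses. The size is no restriction on
  assignments, since each complementary pair must be hit and so contributes exactly one literal.

  Polynomial time on the given machines has to be proved. Unary counters turn this into closure
  rules: the formulas that define the clauses, the adjacency in the graph and the verifier are shown
  to be polynomial by following their syntax. The price is that every number on the way must be
  polynomially bounded. Hence recursion asks for a bound on intermediate values, and the verifier
  compares vertex names digit by digit and caps \<open>k\<close>, as both may be exponential in the
  input length.\<close>

datatype com =
  Skip | Inc nat | Out nat | Seq com com | IfSym nat com com | Loop nat com

text \<open>The body receives the counter after its decrement, so the rounds see
  \<open>n - 1\<close> down to 0.\<close>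

primrec down :: "nat \<Rightarrow> (nat \<Rightarrow> 'a \<Rightarrow> 'a) \<Rightarrow> 'a \<Rightarrow> 'a" where
  "down 0 f x = x"
| "down (Suc n) f x = down n f (f n x)"

definition symbol_at :: "nat list \<Rightarrow> nat \<Rightarrow> nat" where
  "symbol_at w i = (if i = 0 then 4 else if i \<le> length w then w ! (i - 1) else blank)"

type_synonym state = "(nat \<Rightarrow> nat) \<times> nat list \<times> nat"

text \<open>
  The last component of a state is an upper bound for the elapsed time. \<open>Loop r c\<close> counts register
  \<open>r\<close> down to 0; register 0 is the position of a read-only head on the input, which occupies the
  cells from 1 on.
\<close>

primrec exec :: "nat list \<Rightarrow> com \<Rightarrow> state \<Rightarrow> state" where
  "exec w Skip x = x"
| "exec w (Inc r) x = (case x of (s, out, t) \<Rightarrow> (s(r := Suc (s r)), out, Suc t))"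
| "exec w (Out a) x = (case x of (s, out, t) \<Rightarrow> (s, a # out, Suc t))"
| "exec w (Seq c d) x = exec w d (exec w c x)"
| "exec w (IfSym a c d) x = (case x of (s, out, t) \<Rightarrow>
     if symbol_at w (s 0) = a then exec w c (s, out, t + 2) else exec w d (s, out, t + 2))"
| "exec w (Loop r c) x = (case x of (s, out, t) \<Rightarrow>
     down (s r) (\<lambda>n (s, out, t). exec w c (s(r := n), out, t + 3)) (s, out, t + 1))"

declare exec.simps(6) [simp del]

primrec writes :: "com \<Rightarrow> nat set" where
  "writes Skip = {}"
| "writes (Inc r) = {r}"
| "writes (Out a) = {}"
| "writes (Seq c d) = writes c \<union> writes d"
| "writes (IfSym a c d) = writes c \<union> writes d"
| "writes (Loop r c) = insert r (writes c)"

text \<open>A loop body must not write its own counter: then the number of rounds is fixed on entry,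
  and \<open>down\<close> describes what the compiled loop does.\<close>

primrec wf_com :: "com \<Rightarrow> bool" where
  "wf_com Skip \<longleftrightarrow> True"
| "wf_com (Inc r) \<longleftrightarrow> True"
| "wf_com (Out a) \<longleftrightarrow> a < 4"
| "wf_com (Seq c d) \<longleftrightarrow> wf_com c \<and> wf_com d"
| "wf_com (IfSym a c d) \<longleftrightarrow> wf_com c \<and> wf_com d"
| "wf_com (Loop r c) \<longleftrightarrow> r \<notin> writes c \<and> wf_com c"

lemma finite_writes: "finite (writes c)"
  by (induction c) auto

lemma down_invariant:
  assumes "\<And>n x. n < N \<Longrightarrow> P (Suc n) x \<Longrightarrow> P n (f n x)" "P N x"
  shows "P 0 (down N f x)"
  using assms by (induction N arbitrary: x) auto

lemma exec_not_writes:
  "r \<notin> writes c \<Longrightarrow> fst (exec w c x) r = fst x r"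
proof (induction c arbitrary: x)
  case (Loop q c)
  have "fst (down n (\<lambda>n (s, out, t). exec w c (s(q := n), out, t + 3)) y) r = fst y r" for n y
    using Loop by (induction n arbitrary: y) (auto split: prod.splits)
  then show ?case by (auto split: prod.splits simp: exec.simps(6))
qed (auto split: prod.splits)

section \<open>Compilation to a language with jumps\<close>

datatype instr =
  IInc nat | IDec nat | IOut nat | IJumpZero nat nat | IJumpNot nat nat | IJump nat

primrec code_size :: "com \<Rightarrow> nat" where
  "code_size Skip = 0"
| "code_size (Inc r) = 1"
| "code_size (Out a) = 1"
| "code_size (Seq c d) = code_size c + code_size d"
| "code_size (IfSym a c d) = code_size c + code_size d + 2"
| "code_size (Loop r c) = code_size c + 3"

text \<open>Jump targets are absolute, and \<open>a\<close> is the address of the first instruction.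
  A loop spends three instructions per round outside its body and one final zero test, which are the
  charges made by \<open>exec\<close>.\<close>

primrec compile :: "nat \<Rightarrow> com \<Rightarrow> instr list" where
  "compile a Skip = []"
| "compile a (Inc r) = [IInc r]"
| "compile a (Out b) = [IOut b]"
| "compile a (Seq c d) = compile a c @ compile (a + code_size c) d"
| "compile a (IfSym b c d) =
     IJumpNot b (a + code_size c + 2) # compile (a + 1) c @
     IJump (a + code_size c + code_size d + 2) # compile (a + code_size c + 2) d"
| "compile a (Loop r c) =
     IJumpZero r (a + code_size c + 3) # IDec r # compile (a + 2) c @ [IJump a]"

lemma length_compile [simp]: "length (compile a c) = code_size c"
  by (induction c arbitrary: a) auto

primrec wf_instr :: "nat \<Rightarrow> nat \<Rightarrow> instr \<Rightarrow> bool" where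
  "wf_instr R n (IInc r) \<longleftrightarrow> r < R"
| "wf_instr R n (IDec r) \<longleftrightarrow> r < R"
| "wf_instr R n (IOut a) \<longleftrightarrow> a < 4"
| "wf_instr R n (IJumpZero r l) \<longleftrightarrow> r < R \<and> l \<le> n"
| "wf_instr R n (IJumpNot a l) \<longleftrightarrow> l \<le> n"
| "wf_instr R n (IJump l) \<longleftrightarrow> l \<le> n"

lemma wf_compile:
  "\<lbrakk>wf_com c; \<forall>r\<in>writes c. r < R; a + code_size c \<le> n; i \<in> set (compile a c)\<rbrakk> \<Longrightarrow> wf_instr R n i"
proof (induction c arbitrary: a)
  case (Seq c1 c2)
  then show ?case using Seq.IH(1)[of a] Seq.IH(2)[of "a + code_size c1"] by auto
next
  case (IfSym b c1 c2)
  then show ?case using IfSym.IH(1)[of "a + 1"] IfSym.IH(2)[of "a + code_size c1 + 2"]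
    by (auto simp: add.assoc)
next
  case (Loop r c)
  then show ?case using Loop.IH[of "a + 2"] by auto
qed auto

fun instr_step :: "instr list \<Rightarrow> nat list \<Rightarrow> nat \<times> (nat \<Rightarrow> nat) \<times> nat list \<Rightarrow> nat \<times> (nat \<Rightarrow> nat) \<times> nat list" where
  "instr_step P w (pc, s, out) = (case P ! pc of
     IInc r \<Rightarrow> (pc + 1, s(r := s r + 1), out)
   | IDec r \<Rightarrow> (pc + 1, s(r := s r - 1), out)
   | IOut a \<Rightarrow> (pc + 1, s, a # out)
   | IJumpZero r l \<Rightarrow> (if s r = 0 then l else pc + 1, s, out)
   | IJumpNot a l \<Rightarrow> (if symbol_at w (s 0) \<noteq> a then l else pc + 1, s, out)
   | IJump l \<Rightarrow> (l, s, out))"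

text \<open>
  \<open>n + t \<le> t'\<close> instead of an equality lets \<open>exec\<close> charge the overhead of a
  construct before running its body.
\<close>

lemma compile_correct:
  assumes "wf_com c" "P = pre @ compile (length pre) c @ post"
    and "exec w c (s, out, t) = (s', out', t')"
  shows "\<exists>n. n + t \<le> t' \<and> (instr_step P w ^^ n) (length pre, s, out) =
           (length pre + code_size c, s', out') \<and>
           (\<forall>m<n. fst ((instr_step P w ^^ m) (length pre, s, out)) < length pre + code_size c)"
  using assms
proof (induction c arbitrary: pre post s out t s' out' t')
  case Skip
  then show ?case by (intro exI[of _ 0]) simp
next
  case (Inc r)
  then show ?case by (intro exI[of _ 1]) (auto simp: nth_append)
next
  case (Out r)
  then show ?case by (intro exI[of _ 1]) (auto simp: nth_append)
next
  case (Seq c d)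
  obtain s1 out1 t1 where 1: "exec w c (s, out, t) = (s1, out1, t1)" by (metis prod_cases3)
  obtain n1 where n1: "n1 + t \<le> t1"
    "(instr_step P w ^^ n1) (length pre, s, out) = (length pre + code_size c, s1, out1)"
    "\<forall>m<n1. fst ((instr_step P w ^^ m) (length pre, s, out)) < length pre + code_size c"
    using Seq.IH(1)[OF _ _ 1, of pre "compile (length pre + code_size c) d @ post"] Seq.prems
    by auto
  obtain n2 where n2: "n2 + t1 \<le> t'"
    "(instr_step P w ^^ n2) (length pre + code_size c, s1, out1) =
      (length pre + code_size c + code_size d, s', out')"
    "\<forall>m<n2. fst ((instr_step P w ^^ m) (length pre + code_size c, s1, out1)) < length pre + code_size c + code_size d"
    using Seq.IH(2)[of "pre @ compile (length pre) c" post s1 out1 t1 s' out' t'] Seq.prems 1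
    by auto
  have m: "fst ((instr_step P w ^^ m) (length pre, s, out)) < length pre + code_size c + code_size d"
    if "m < n1 + n2" for m
  proof (cases "m < n1")
    case True
    then show ?thesis using n1(3) by (simp add: trans_less_add1)
  next
    case False
    then obtain k where k: "m = k + n1" by (metis add.commute le_Suc_ex not_less)
    then show ?thesis using n1(2) n2(3) that by (simp add: funpow_add)
  qed
  have "(instr_step P w ^^ (n2 + n1)) (length pre, s, out) =
      (length pre + code_size c + code_size d, s', out')"
    using n1(2) n2(2) by (simp add: funpow_add)
  then show ?case using n1(1) n2(1) m by (intro exI[of _ "n2 + n1"]) (auto simp: ac_simps)
next
  case (IfSym b c d)
  let ?a = "length pre"
  show ?case
  proof (cases "symbol_at w (s 0) = b")
    case True
    let ?pre = "pre @ [IJumpNot b (?a + code_size c + 2)]"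
    have P0: "P ! ?a = IJumpNot b (?a + code_size c + 2)" using IfSym.prems by (simp add: nth_append)
    have P1: "P ! (?a + 1 + code_size c) = IJump (?a + code_size c + code_size d + 2)"
      using IfSym.prems by (simp add: nth_append)
    obtain n where n: "n + (t + 2) \<le> t'"
      "(instr_step P w ^^ n) (?a + 1, s, out) = (?a + 1 + code_size c, s', out')"
      "\<forall>m<n. fst ((instr_step P w ^^ m) (?a + 1, s, out)) < ?a + 1 + code_size c"
      using IfSym.IH(1)[of ?pre "IJump (?a + code_size c + code_size d + 2) #
          compile (?a + code_size c + 2) d @ post" s out "t + 2" s' out' t'] IfSym.prems True by auto
    have 0: "instr_step P w (?a, s, out) = (?a + 1, s, out)" using P0 True by simp
    have "(instr_step P w ^^ Suc (Suc n)) (?a, s, out) = instr_step P w ((instr_step P w ^^ n) (instr_step P w (?a, s, out)))"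
      by (simp only: funpow.simps(2) o_apply funpow_swap1)
    also have "\<dots> = (?a + code_size (IfSym b c d), s', out')"
      unfolding 0 n(2) using P1 by simp
    finally have r: "(instr_step P w ^^ Suc (Suc n)) (?a, s, out) = (?a + code_size (IfSym b c d), s', out')" .
    have "fst ((instr_step P w ^^ m) (?a, s, out)) < ?a + code_size (IfSym b c d)" if "m < Suc (Suc n)" for m
    proof (cases m)
      case (Suc k)
      have "(instr_step P w ^^ m) (?a, s, out) = (instr_step P w ^^ k) (?a + 1, s, out)"
        unfolding Suc funpow_Suc_right o_apply 0 ..
      then show ?thesis using n(2) n(3)[rule_format, of k] that Suc
        by (cases "k = n") (auto simp del: instr_step.simps)
    qed simp
    then show ?thesis using r n(1) by (intro exI[of _ "Suc (Suc n)"]) auto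
  next
    case False
    let ?pre = "pre @ IJumpNot b (?a + code_size c + 2) # compile (?a + 1) c @
        [IJump (?a + code_size c + code_size d + 2)]"
    have P0: "P ! ?a = IJumpNot b (?a + code_size c + 2)" using IfSym.prems by (simp add: nth_append)
    obtain n where n: "n + (t + 2) \<le> t'"
      "(instr_step P w ^^ n) (?a + code_size c + 2, s, out) = (?a + code_size c + code_size d + 2, s', out')"
      "\<forall>m<n. fst ((instr_step P w ^^ m) (?a + code_size c + 2, s, out)) < ?a + code_size c + code_size d + 2"
      using IfSym.IH(2)[of ?pre post s out "t + 2" s' out' t'] IfSym.prems False
      by (auto simp: algebra_simps)
    have 0: "instr_step P w (?a, s, out) = (?a + code_size c + 2, s, out)" using P0 False by simp
    have r: "(instr_step P w ^^ Suc n) (?a, s, out) = (?a + code_size (IfSym b c d), s', out')"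
      unfolding funpow_Suc_right o_apply 0 n(2) by simp
    have "fst ((instr_step P w ^^ m) (?a, s, out)) < ?a + code_size (IfSym b c d)" if "m < Suc n" for m
    proof (cases m)
      case (Suc k)
      have "(instr_step P w ^^ m) (?a, s, out) = (instr_step P w ^^ k) (?a + code_size c + 2, s, out)"
        unfolding Suc funpow_Suc_right o_apply 0 ..
      then show ?thesis using n(3) that Suc by auto
    qed simp
    then show ?thesis using r n(1) by (intro exI[of _ "Suc n"]) auto
  qed
next
  case (Loop r c)
  let ?a = "length pre"
  let ?pre = "pre @ [IJumpZero r (?a + code_size c + 3), IDec r]"
  let ?f = "\<lambda>n (s, out, t). exec w c (s(r := n), out, t + 3)"
  let ?end = "?a + code_size c + 3"
  have P0: "P ! ?a = IJumpZero r ?end" using Loop.prems by (simp add: nth_append)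
  have P1: "P ! (?a + 1) = IDec r" using Loop.prems by (simp add: nth_append)
  have P2: "P ! (?a + 2 + code_size c) = IJump ?a" using Loop.prems by (simp add: nth_append)
  \<comment> \<open>The surplus 1 is the final zero test: \<open>exec\<close> charges it on entry to
    the loop, outside \<open>down\<close>.\<close>
  have *: "\<exists>n. n + t \<le> t' + 1 \<and> (instr_step P w ^^ n) (?a, s, out) = (?end, s', out') \<and>
      (\<forall>m<n. fst ((instr_step P w ^^ m) (?a, s, out)) < ?end)"
    if "down (s r) ?f (s, out, t) = (s', out', t')" for s out t s' out' t'
    using that
  proof (induction "s r" arbitrary: s out t)
    case 0
    have r: "(instr_step P w ^^ 1) (?a, s, out) = (?end, s, out)" using P0 0 by simp
    have "s' = s \<and> out' = out \<and> t' = t" using 0(2) unfolding 0(1)[symmetric] by simp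
    then show ?case using r by (intro exI[of _ 1]) auto
  next
    case (Suc N)
    obtain s1 out1 t1 where 1: "exec w c (s(r := N), out, t + 3) = (s1, out1, t1)"
      by (metis prod_cases3)
    have s1: "s1 r = N"
      using exec_not_writes[of r c w "(s(r := N), out, t + 3)"] 1 Loop.prems by simp
    have rest: "down (s1 r) ?f (s1, out1, t1) = (s', out', t')"
      using Suc.prems unfolding Suc(2)[symmetric] s1 using 1 by simp
    obtain n2 where n2: "n2 + t1 \<le> t' + 1" "(instr_step P w ^^ n2) (?a, s1, out1) = (?end, s', out')"
      "\<forall>m<n2. fst ((instr_step P w ^^ m) (?a, s1, out1)) < ?end"
      using Suc.hyps(1)[OF s1[symmetric] rest] by blast
    obtain n where n: "n + (t + 3) \<le> t1"
      "(instr_step P w ^^ n) (?a + 2, s(r := N), out) = (?a + 2 + code_size c, s1, out1)"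
      "\<forall>m<n. fst ((instr_step P w ^^ m) (?a + 2, s(r := N), out)) < ?a + 2 + code_size c"
      using Loop.IH[OF _ _ 1, of ?pre "IJump ?a # post"] Loop.prems by (auto simp del: instr_step.simps fun_upd_apply)
    have 0: "instr_step P w (?a, s, out) = (?a + 1, s, out)" using P0 Suc(2) by auto
    have 00: "instr_step P w (?a + 1, s, out) = (?a + 2, s(r := N), out)"
      using P1 unfolding instr_step.simps P1 by (simp add: Suc(2)[symmetric])
    have ini: "(instr_step P w ^^ (Suc (Suc k))) (?a, s, out) = (instr_step P w ^^ k) (?a + 2, s(r := N), out)" for k
      unfolding funpow_Suc_right o_apply 0 00 ..
    have A: "(instr_step P w ^^ (Suc (Suc (Suc n)))) (?a, s, out) = (?a, s1, out1)"
      unfolding ini[of "Suc n"] using P2 by (simp only: funpow.simps(2) o_apply n(2)) simp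
    have "(instr_step P w ^^ (n2 + Suc (Suc (Suc n)))) (?a, s, out) = (?end, s', out')"
      unfolding funpow_add o_apply A n2(2) ..
    moreover have "fst ((instr_step P w ^^ m) (?a, s, out)) < ?end" if m: "m < n2 + Suc (Suc (Suc n))" for m
    proof -
      consider "m = 0" | "m = 1" | k where "m = Suc (Suc k)" "k \<le> n" | k where "m = k + Suc (Suc (Suc n))" "k < n2"
      proof -
        assume a: "m = 0 \<Longrightarrow> thesis" "m = 1 \<Longrightarrow> thesis" "\<And>k. m = Suc (Suc k) \<Longrightarrow> k \<le> n \<Longrightarrow> thesis"
          "\<And>k. m = k + Suc (Suc (Suc n)) \<Longrightarrow> k < n2 \<Longrightarrow> thesis"
        show thesis
          using a(1,2) a(3)[of "m - 2"] a(4)[of "m - Suc (Suc (Suc n))"] m by linarith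
      qed
      then show ?thesis
      proof cases
        case 3
        then show ?thesis using ini n(2) n(3)[rule_format, of k]
          by (cases "k = n") (auto simp del: instr_step.simps funpow.simps)
      next
        case 4
        then show ?thesis using n2(3) unfolding 4(1) funpow_add o_apply A by blast
      next
        case 2
        then have "(instr_step P w ^^ m) (?a, s, out) = (?a + 1, s, out)" unfolding 2 using 0 by simp
        then show ?thesis by simp
      qed simp
    qed
    ultimately show ?case using n(1) n2(1) by (intro exI[of _ "n2 + Suc (Suc (Suc n))"]) auto
  qed
  have "down (s r) ?f (s, out, t + 1) = (s', out', t')" using Loop.prems(3) by (simp add: exec.simps(6))
  from *[OF this] show ?case by (auto simp: add.assoc)
qed

section \<open>Simulation by a Turing machine\<close>

definition next_state :: "instr list \<Rightarrow> nat \<Rightarrow> nat list \<Rightarrow> nat" where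
  "next_state P q rs =
    (if q < length P then
       (case P ! q of
          IJumpZero r l \<Rightarrow> if rs ! Suc r = 4 then l else q + 1
        | IJumpNot a l \<Rightarrow> if rs ! 1 \<noteq> a then l else q + 1
        | IJump l \<Rightarrow> l
        | _ \<Rightarrow> q + 1)
     else if q = length P then (if rs ! 3 = 4 then length P + 4 else length P + 3)
     else if q = length P + 1 then length P + 2
     else if rs ! 0 = blank then 0 else length P + 2)"

definition action :: "instr list \<Rightarrow> nat \<Rightarrow> nat list \<Rightarrow> nat \<Rightarrow> nat \<times> move" where
  "action P q rs i =
    (if q < length P then
       (case P ! q of
          IInc r \<Rightarrow> (rs ! i, if i = Suc r then Move_Right else Stay)
        | IDec r \<Rightarrow> (rs ! i, if i = Suc r \<and> rs ! i \<noteq> 4 then Move_Left else Stay)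
        | IOut a \<Rightarrow> if i = 0 then (a, Move_Left) else (rs ! i, Stay)
        | _ \<Rightarrow> (rs ! i, Stay))
     else if q = length P then (rs ! i, if i = 0 then Move_Right else Stay)
     else if q = length P + 1 then
       (if i = 0 then (rs ! i, Stay) else (4, if i = 1 then Move_Right else Stay))
     else if rs ! 0 = blank then (rs ! i, if i = 1 then Move_Left else Stay)
     else if i = 0 then (blank, Move_Right)
     else if i = 1 then (rs ! 0, Move_Right)
     else (rs ! i, Stay))"

text \<open>
  Tape \<open>r + 1\<close> holds register \<open>r\<close> in unary, as the position of its head; symbol 4 marks cell 0.
  Two extra states move the input from tape 0 to tape 1, and tape 0 then collects the output from
  right to left. The final state (number \<open>length P\<close>) moves the head onto the first output symbol and
  accepts iff register 2 is nonzero.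
\<close>

definition machine :: "nat \<Rightarrow> instr list \<Rightarrow> tm" where
  "machine R P =
    \<lparr>num_tapes = R + 1, num_symbols = 5, num_states = length P + 5, start_state = length P + 1,
     accept_state = length P + 3, reject_state = length P + 4,
     delta = (\<lambda>q rs. (next_state P q rs, map (action P q rs) [0..<R + 1]))\<rparr>"

lemma wf_machine:
  assumes "\<forall>i\<in>set P. wf_instr R (length P) i" "3 \<le> R"
  shows "wf_tm (machine R P)"
proof -
  have 1: "next_state P q rs < length P + 5" for q rs
  proof (cases "q < length P")
    case True
    then have "wf_instr R (length P) (P ! q)" using assms by simp
    then show ?thesis using True by (cases "P ! q") (auto simp: next_state_def)
  qed (auto simp: next_state_def)
  have 2: "fst (action P q rs i) < 5"
    if "length rs = R + 1" "\<forall>a\<in>set rs. a < 5" "i < R + 1" for q rs i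
  proof -
    have r: "rs ! i < 5" "rs ! 0 < 5" using that by (metis nth_mem, metis nth_mem zero_less_Suc Suc_eq_plus1)
    show ?thesis
    proof (cases "q < length P")
      case True
      then have "wf_instr R (length P) (P ! q)" using assms by simp
      then show ?thesis using True r by (cases "P ! q") (auto simp: action_def)
    qed (use r in \<open>auto simp: action_def blank_def\<close>)
  qed
  have 3: "a < 5" if rs: "length rs = Suc R" "\<forall>a\<in>set rs. a < 5"
    "(a, m) \<in> set (map (action P q rs) [0..<Suc R])" for q rs a m
  proof -
    obtain i where "i < R + 1" "(a, m) = action P q rs i" using rs(3) by (auto simp del: upt_Suc)
    with 2[of rs i q] rs show "a < 5" by (metis Suc_eq_plus1 fst_conv)
  qed
  show ?thesis
    unfolding wf_tm_def machine_def using 1 assms(2) 3 by (auto simp del: upt_Suc map_map set_map)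
qed

definition cells :: "nat list \<Rightarrow> nat \<Rightarrow> int \<Rightarrow> nat" where
  "cells w r i = (if i = 0 then 4 else if r = 0 \<and> 0 < i \<and> i \<le> int (length w) then w ! nat (i - 1) else blank)"

text \<open>The output grows to the left, so its newest symbol comes first and the head of tape 0
  waits one cell to its left. The blank behind the output is what ends it for
  \<open>has_output\<close>.\<close>

definition represents :: "nat \<Rightarrow> nat list \<Rightarrow> (nat \<Rightarrow> nat) \<Rightarrow> nat list \<Rightarrow> tape list \<Rightarrow> bool" where
  "represents R w s out ts \<longleftrightarrow> length ts = R + 1 \<and>
     (\<forall>i<length out. fst (ts ! 0) (snd (ts ! 0) + 1 + int i) = out ! i) \<and>
     fst (ts ! 0) (snd (ts ! 0) + 1 + int (length out)) = blank \<and>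
     (\<forall>r<R. ts ! Suc r = (cells w r, int (s r)))"

lemma machine_step:
  assumes "length ts = R + 1" "q < length P + 3"
  shows "tm_step (machine R P) (q, ts) =
    (next_state P q (map tape_read ts),
     map (\<lambda>i. tape_act (action P q (map tape_read ts) i) (ts ! i)) [0..<R + 1])"
  using assms
  by (auto simp: machine_def halting_state_def simp del: upt_Suc intro!: nth_equalityI)

lemma cells_eq_marker:
  assumes "\<forall>a\<in>set w. a < 4"
  shows "cells w r (int n) = 4 \<longleftrightarrow> n = 0"
proof -
  have "w ! nat (int n - 1) \<noteq> 4" if "0 < n" "n \<le> length w"
    using that assms nth_mem[of "nat (int n - 1)" w] by force
  then show ?thesis by (auto simp: cells_def blank_def)
qed

lemma cells_zero: "cells w 0 (int n) = symbol_at w n"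
  by (auto simp: cells_def symbol_at_def nat_diff_distrib)

lemma tape_act_same [simp]:
  "tape_act (tape_read x, m) x = (fst x, snd x + move_offset m)"
  by (cases x) auto

lemma machine_simulates:
  assumes rep: "represents R w s out ts" and w: "\<forall>a\<in>set w. a < 4" and R: "3 \<le> R"
    and pc: "pc < length P" "wf_instr R (length P) (P ! pc)"
    and st: "instr_step P w (pc, s, out) = (pc', s', out')"
  shows "\<exists>ts'. tm_step (machine R P) (pc, ts) = (pc', ts') \<and> represents R w s' out' ts'"
proof -
  let ?rs = "map tape_read ts"
  have len: "length ts = R + 1" and reg: "\<And>r. r < R \<Longrightarrow> ts ! Suc r = (cells w r, int (s r))"
    using rep by (auto simp: represents_def)
  have rd: "?rs ! Suc r = cells w r (int (s r))" if "r < R" for r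
    using that len reg[OF that] by simp
  have rd4: "?rs ! Suc r = 4 \<longleftrightarrow> s r = 0" if "r < R" for r
    using rd[OF that] cells_eq_marker[OF w] by simp
  have rdi: "?rs ! i = tape_read (ts ! i)" if "i < R + 1" for i using that len by simp
  have rd1: "?rs ! 1 = symbol_at w (s 0)" using rd[of 0] R cells_zero by simp
  have step: "tm_step (machine R P) (pc, ts) = (next_state P pc ?rs,
     map (\<lambda>i. tape_act (action P pc ?rs i) (ts ! i)) [0..<R + 1])"
    using machine_step[OF len] pc by simp
  have nx: "next_state P pc ?rs = pc'"
    using st pc rd4 rd1 by (cases "P ! pc") (auto simp: next_state_def)
  define ts' where "ts' = map (\<lambda>i. tape_act (action P pc ?rs i) (ts ! i)) [0..<R + 1]"
  have ts'_nth: "ts' ! i = tape_act (action P pc ?rs i) (ts ! i)" if "i < R + 1" for i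
    using that by (simp add: ts'_def del: upt_Suc)
  have "represents R w s' out' ts'"
    unfolding represents_def
  proof (intro conjI allI impI)
    show "length ts' = R + 1" by (simp add: ts'_def)
  next
    fix r assume r: "r < R"
    have s: "ts' ! Suc r = tape_act (action P pc ?rs (Suc r)) (ts ! Suc r)" using ts'_nth r by simp
    show "ts' ! Suc r = (cells w r, int (s' r))"
      using st pc rd4[OF r] rdi[of "Suc r"] r s
      by (cases "P ! pc") (auto simp: action_def reg)
  next
    fix i assume i: "i < length out'"
    show "fst (ts' ! 0) (snd (ts' ! 0) + 1 + int i) = out' ! i"
      using st pc i rep ts'_nth[of 0] rdi[of 0]
      by (cases "P ! pc"; cases "ts ! 0"; cases i) (auto simp: action_def represents_def algebra_simps)
  next
    show "fst (ts' ! 0) (snd (ts' ! 0) + 1 + int (length out')) = blank"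
      using st pc rep ts'_nth[of 0] rdi[of 0]
      by (cases "P ! pc"; cases "ts ! 0") (auto simp: action_def represents_def algebra_simps)
  qed
  then show ?thesis using step nx ts'_def by blast
qed

text \<open>The program counter has to stay below \<open>length P\<close> until the last step,
  because the states from there on belong to copying and halting. The last conjunct of
  \<open>compile_correct\<close> provides this.\<close>

lemma machine_simulates_steps:
  assumes "represents R w s out ts" "\<forall>a\<in>set w. a < 4" "3 \<le> R"
    and "\<forall>i\<in>set P. wf_instr R (length P) i"
    and "(instr_step P w ^^ n) (pc, s, out) = (pc', s', out')"
    and "\<forall>m<n. fst ((instr_step P w ^^ m) (pc, s, out)) < length P"
  shows "\<exists>ts'. (tm_step (machine R P) ^^ n) (pc, ts) = (pc', ts') \<and> represents R w s' out' ts'"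
  using assms(5,6)
proof (induction n arbitrary: pc' s' out')
  case 0
  then show ?case using assms by auto
next
  case (Suc n)
  obtain pc1 s1 out1 where 1: "(instr_step P w ^^ n) (pc, s, out) = (pc1, s1, out1)"
    by (metis prod_cases3)
  then obtain ts1 where ts1: "(tm_step (machine R P) ^^ n) (pc, ts) = (pc1, ts1)" "represents R w s1 out1 ts1"
    using Suc by (metis less_Suc_eq)
  have pc1: "pc1 < length P" using Suc.prems(2) 1 by (metis fst_conv lessI)
  have "instr_step P w (pc1, s1, out1) = (pc', s', out')" using Suc.prems(1) 1 by simp
  then obtain ts' where "tm_step (machine R P) (pc1, ts1) = (pc', ts')" "represents R w s' out' ts'"
    using machine_simulates[OF ts1(2) assms(2,3) pc1] assms(4) pc1 by (metis nth_mem)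
  then show ?case using ts1(1) by simp
qed

text \<open>One step writes the markers, \<open>length w\<close> steps move one symbol each, and the
  step that meets a blank moves the head of tape 1 back onto the last cell filled. Register 0
  therefore starts with the value \<open>length w\<close>. A blank inside \<open>w\<close> would
  stop the copying too early.\<close>

lemma machine_copies_input:
  assumes w: "\<forall>a\<in>set w. a \<noteq> blank" and R: "3 \<le> R"
  shows "\<exists>ts. config_after (machine R P) w (length w + 2) = (0, ts) \<and>
    represents R w (\<lambda>r. if r = 0 then length w else 0) [] ts"
proof -
  let ?M = "machine R P" and ?n = "length P"
  \<comment> \<open>The tapes after \<open>m\<close> symbols have been moved.\<close>
  define cfg where "cfg m =
    (\<lambda>i. if int m \<le> i \<and> i < int (length w) then w ! nat i else blank, int m) #
    (\<lambda>i. if i = 0 then 4 else if 0 < i \<and> i \<le> int m then w ! nat (i - 1) else blank, int m + 1) #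
    replicate (R - 1) (\<lambda>i. if i = 0 then 4 else blank, 0)" for m
  have len: "length (cfg m) = R + 1" for m using R by (simp add: cfg_def)
  have cfg_nth: "cfg m ! Suc (Suc i) = (\<lambda>i. if i = 0 then 4 else blank, 0)" if "Suc i < R" for m i
    using that by (simp add: cfg_def)
  have cfg0: "cfg m ! 0 = (\<lambda>i. if int m \<le> i \<and> i < int (length w) then w ! nat i else blank, int m)" for m
    by (simp add: cfg_def)
  have cfg1: "cfg m ! Suc 0 = (\<lambda>i. if i = 0 then 4 else if 0 < i \<and> i \<le> int m then w ! nat (i - 1) else blank, int m + 1)" for m
    by (simp add: cfg_def)
  have ic: "initial_config ?M w = (?n + 1, input_tape w # replicate R (input_tape []))"
    by (simp add: initial_config_def machine_def)
  have s1: "config_after ?M w 1 = (?n + 2, cfg 0)"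
  proof -
    let ?ts = "input_tape w # replicate R (input_tape [])"
    have "map (\<lambda>i. tape_act (action P (?n + 1) (map tape_read ?ts) i) (?ts ! i)) [0..<R + 1] = cfg 0"
    proof (rule nth_equalityI)
      fix i assume "i < length (map (\<lambda>i. tape_act (action P (?n + 1) (map tape_read ?ts) i) (?ts ! i)) [0..<R + 1])"
      then have i: "i < R + 1" by simp
      then have "map (\<lambda>i. tape_act (action P (?n + 1) (map tape_read ?ts) i) (?ts ! i)) [0..<R + 1] ! i
        = tape_act (action P (?n + 1) (map tape_read ?ts) i) (?ts ! i)" by (simp del: upt_Suc)
      also have "\<dots> = cfg 0 ! i"
      proof -
        consider "i = 0" | "i = 1" | k where "i = Suc (Suc k)" "Suc k < R"
          using i by (metis One_nat_def Suc_eq_plus1 Suc_less_eq not0_implies_Suc)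
        then show ?thesis
        proof cases
          case 1
          then show ?thesis by (auto simp: action_def input_tape_def cfg0)
        next
          case 2
          then show ?thesis using R by (auto simp: action_def input_tape_def cfg1 fun_eq_iff)
        next
          case 3
          then show ?thesis using R by (auto simp: action_def input_tape_def cfg_nth fun_eq_iff)
        qed
      qed
      finally show "map (\<lambda>i. tape_act (action P (?n + 1) (map tape_read ?ts) i) (?ts ! i)) [0..<R + 1] ! i = cfg 0 ! i" .
    qed (simp add: len)
    moreover have "next_state P (?n + 1) (map tape_read ?ts) = ?n + 2" by (simp add: next_state_def)
    ultimately show ?thesis
      using machine_step[of ?ts R "?n + 1" P] by (simp add: config_after_def ic)
  qed
  have sm: "config_after ?M w (Suc m) = (?n + 2, cfg m)" if "m \<le> length w" for m
    using that
  proof (induction m)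
    case 0
    then show ?case using s1 by simp
  next
    case (Suc m)
    have rd0: "map tape_read (cfg m) ! 0 = w ! m" using Suc.prems by (simp add: cfg_def)
    have nb: "w ! m \<noteq> blank" using Suc.prems w by simp
    have "map (\<lambda>i. tape_act (action P (?n + 2) (map tape_read (cfg m)) i) (cfg m ! i)) [0..<R + 1] = cfg (Suc m)" (is "?L = _")
    proof (rule nth_equalityI)
      fix i assume "i < length ?L"
      then have i: "i < R + 1" by simp
      then have "?L ! i = tape_act (action P (?n + 2) (map tape_read (cfg m)) i) (cfg m ! i)" by (simp del: upt_Suc)
      also have "\<dots> = cfg (Suc m) ! i"
      proof -
        consider "i = 0" | "i = 1" | k where "i = Suc (Suc k)" "Suc k < R"
          using i by (metis One_nat_def Suc_eq_plus1 Suc_less_eq not0_implies_Suc)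
        then show ?thesis
        proof cases
          case 1
          then show ?thesis using rd0 nb by (auto simp: action_def cfg0 fun_eq_iff)
        next
          case 2
          then show ?thesis using rd0 nb by (auto simp: action_def cfg1 fun_eq_iff)
        next
          case 3
          then have "map tape_read (cfg m) ! i = tape_read (cfg m ! i)" using i len by simp
          then show ?thesis using 3 rd0 nb by (auto simp: action_def cfg_nth fun_eq_iff)
        qed
      qed
      finally show "?L ! i = cfg (Suc m) ! i" .
    qed (simp add: len)
    moreover have "next_state P (?n + 2) (map tape_read (cfg m)) = ?n + 2"
      using rd0 nb by (simp add: next_state_def)
    ultimately have "tm_step ?M (?n + 2, cfg m) = (?n + 2, cfg (Suc m))"
      using machine_step[OF len, of "?n + 2" P m] by simp
    then show ?case using Suc by (simp add: config_after_def)
  qed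
  let ?m = "length w"
  have rd0: "map tape_read (cfg ?m) ! 0 = blank" by (simp add: cfg_def)
  define ts where "ts = map (\<lambda>i. tape_act (action P (?n + 2) (map tape_read (cfg ?m)) i) (cfg ?m ! i)) [0..<R + 1]"
  have ts_nth: "ts ! i = (fst (cfg ?m ! i), snd (cfg ?m ! i) + (if i = 1 then -1 else 0))" if "i < R + 1" for i
  proof -
    have "ts ! i = tape_act (action P (?n + 2) (map tape_read (cfg ?m)) i) (cfg ?m ! i)"
      using that by (simp add: ts_def del: upt_Suc)
    moreover have "map tape_read (cfg ?m) ! i = tape_read (cfg ?m ! i)" using that len by simp
    ultimately show ?thesis using rd0 by (auto simp: action_def)
  qed
  have "next_state P (?n + 2) (map tape_read (cfg ?m)) = 0" using rd0 by (simp add: next_state_def)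
  then have "tm_step ?M (?n + 2, cfg ?m) = (0, ts)"
    using machine_step[OF len, of "?n + 2" P ?m] by (simp add: ts_def)
  then have "config_after ?M w (length w + 2) = (0, ts)"
    using sm[of ?m] by (simp add: config_after_def)
  moreover have "represents R w (\<lambda>r. if r = 0 then length w else 0) [] ts"
    unfolding represents_def
  proof (intro conjI allI impI)
    fix r assume r: "r < R"
    show "ts ! Suc r = (cells w r, int (if r = 0 then length w else 0))"
      using r ts_nth[of "Suc r"] by (cases r) (auto simp: cfg1 cfg_nth cells_def fun_eq_iff)
  qed (use ts_nth[of 0] in \<open>auto simp: ts_def cfg0\<close>)
  ultimately show ?thesis by blast
qed

theorem program_machine:
  assumes c: "wf_com c"
    and ex: "\<And>w t. \<exists>s out t'. exec w c (\<lambda>r. if r = 1 then length w else 0, [], t) = (s, out, t') \<and>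
      t' \<le> t + poly p (length w) \<and> s 2 = f w \<and> out = g w"
  obtains M q where "wf_tm M" "\<And>w. \<forall>a\<in>set w. a \<noteq> blank \<and> a < 4 \<Longrightarrow>
    \<exists>t\<le>poly (q :: nat poly) (length w).
      fst (config_after M w t) = (if f w = 0 then reject_state M else accept_state M) \<and>
      has_output (config_after M w t) (g w)"
proof -
  \<comment> \<open>The input head starts at the end of the input; counting register 0 down rewinds
    it and puts the input length into register 1.\<close>
  define c' where "c' = Seq (Loop 0 (Inc 1)) c"
  define P where "P = compile 0 c'"
  obtain R where R: "\<forall>r\<in>writes c'. r < R" "3 \<le> R"
    using finite_writes[of c'] by (metis finite_nat_set_iff_bounded linorder_linear order_less_le_trans)
  let ?M = "machine R P"
  have wfc': "wf_com c'" using c by (simp add: c'_def)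
  have wfP: "\<forall>i\<in>set P. wf_instr R (length P) i"
    using wf_compile[OF wfc' R(1), of 0] by (simp add: P_def)
  have lenP: "length P = code_size c'" by (simp add: P_def)
  \<comment> \<open>The summand \<open>4 + 5 * length w\<close> is made up of
    \<open>length w + 2\<close> steps of copying, \<open>1 + 4 * length w\<close> of rewinding and
    the final step.\<close>
  have main: "\<exists>t\<le>poly (p + [:4, 5:]) (length w).
      fst (config_after ?M w t) = (if f w = 0 then reject_state ?M else accept_state ?M) \<and>
      has_output (config_after ?M w t) (g w)" if w: "\<forall>a\<in>set w. a \<noteq> blank \<and> a < 4" for w
  proof -
    let ?s0 = "\<lambda>r. if r = 0 then length w else 0 :: nat"
    have loop: "exec w (Loop 0 (Inc 1)) (s, out, t) = (s(0 := 0, 1 := s 1 + s 0), out, t + 1 + 4 * s 0)" for s out t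
    proof -
      have "s 0 = n \<Longrightarrow> down n (\<lambda>n (s, out, t). exec w (Inc 1) (s(0 := n), out, t + 3)) (s, out, t) =
        (s(0 := 0, 1 := s 1 + s 0), out, t + 4 * s 0)" for n s out t
        by (induction n arbitrary: s t) (auto simp: fun_eq_iff)
      then show ?thesis by (simp add: exec.simps(6))
    qed
    have init: "exec w (Loop 0 (Inc 1)) (?s0, [], 0) =
        (\<lambda>r. if r = 1 then length w else 0, [], 1 + 4 * length w)"
      by (simp only: loop) (auto simp: fun_eq_iff)
    obtain s out t where ex': "exec w c' (?s0, [], 0) = (s, out, t)"
      "t \<le> 1 + 4 * length w + poly p (length w)" "s 2 = f w" "out = g w"
      using ex[of w "1 + 4 * length w"] unfolding c'_def exec.simps(4) init by auto
    obtain n where n: "n \<le> t" "(instr_step P w ^^ n) (0, ?s0, []) = (length P, s, out)"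
      "\<forall>m<n. fst ((instr_step P w ^^ m) (0, ?s0, [])) < length P"
      using compile_correct[OF wfc', of P "[]" "[]" w ?s0 "[]" 0 s out t] ex'(1) by (auto simp: P_def lenP)
    obtain ts where ts: "config_after ?M w (length w + 2) = (0, ts)" "represents R w ?s0 [] ts"
      using machine_copies_input[of w R P] w R(2) by blast
    obtain ts' where ts': "(tm_step ?M ^^ n) (0, ts) = (length P, ts')" "represents R w s out ts'"
      using machine_simulates_steps[OF ts(2) _ R(2) wfP n(2,3)] w by blast
    let ?t = "Suc (n + (length w + 2))"
    let ?rs = "map tape_read ts'"
    define ts'' where "ts'' = map (\<lambda>i. tape_act (action P (length P) ?rs i) (ts' ! i)) [0..<R + 1]"
    have len: "length ts' = R + 1" using ts'(2) by (simp add: represents_def)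
    have "config_after ?M w ?t = tm_step ?M (length P, ts')"
      unfolding config_after_def funpow.simps(2) o_apply funpow_add[of n]
        ts(1)[unfolded config_after_def] ts'(1) ..
    also have "\<dots> = (next_state P (length P) ?rs, ts'')"
      using machine_step[OF len, of "length P" P] by (simp add: ts''_def)
    finally have fin: "config_after ?M w ?t = (next_state P (length P) ?rs, ts'')" .
    have "2 < R" using R(2) by simp
    then have "ts' ! Suc 2 = (cells w 2, int (s 2))" using ts'(2) unfolding represents_def by blast
    then have "?rs ! 3 = cells w 2 (int (s 2))" using len R(2) by (simp add: numeral_3_eq_3 numeral_2_eq_2)
    then have "?rs ! 3 = 4 \<longleftrightarrow> f w = 0" using cells_eq_marker[of w 2 "s 2"] w ex'(3) by simp
    then have a: "fst (config_after ?M w ?t) = (if f w = 0 then reject_state ?M else accept_state ?M)"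
      unfolding fin by (simp add: next_state_def) (simp add: machine_def)
    have "?rs ! 0 = tape_read (ts' ! 0)" using len by simp
    then have "ts'' ! 0 = (fst (ts' ! 0), snd (ts' ! 0) + 1)"
      by (simp add: ts''_def action_def del: upt_Suc)
    moreover have "hd ts'' = ts'' ! 0" by (simp add: ts''_def hd_conv_nth)
    ultimately have b: "has_output (config_after ?M w ?t) (g w)"
      using ts'(2) ex'(4) unfolding fin by (auto simp: has_output_def represents_def)
    have "?t \<le> poly (p + [:4, 5:]) (length w)" using n(1) ex'(2) by simp
    then show ?thesis using a b by blast
  qed
  show ?thesis using that[OF wf_machine[OF wfP R(2)] main] .
qed

section \<open>Polynomial-time functions on unary numbers\<close>

lemma poly_mono_nat: "x \<le> y \<Longrightarrow> poly p x \<le> poly (p :: nat poly) y"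
  by (induction p) (auto intro: add_mono mult_mono)

lemma exec_clear: "exec w (Loop r Skip) (s, out, t) = (s(r := 0), out, t + 1 + 3 * s r)"
proof -
  have "s r = n \<Longrightarrow> down n (\<lambda>n (s, out, t). exec w Skip (s(r := n), out, t + 3)) (s, out, t) =
    (s(r := 0), out, t + 3 * s r)" for n s out t
    by (induction n arbitrary: s t) (auto simp: fun_eq_iff)
  then show ?thesis by (simp add: exec.simps(6))
qed

lemma exec_move:
  assumes "r \<noteq> r'"
  shows "exec w (Loop r (Inc r')) (s, out, t) = (s(r := 0, r' := s r' + s r), out, t + 1 + 4 * s r)"
proof -
  have "s r = n \<Longrightarrow> down n (\<lambda>n (s, out, t). exec w (Inc r') (s(r := n), out, t + 3)) (s, out, t) =
    (s(r := 0, r' := s r' + s r), out, t + 4 * s r)" for n s out t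
    using assms by (induction n arbitrary: s t) (auto simp: fun_eq_iff)
  then show ?thesis by (simp add: exec.simps(6))
qed

lemma exec_move2:
  assumes "r \<noteq> a" "r \<noteq> b" "a \<noteq> b"
  shows "exec w (Loop r (Seq (Inc a) (Inc b))) (s, out, t) =
    (s(r := 0, a := s a + s r, b := s b + s r), out, t + 1 + 5 * s r)"
proof -
  have "s r = n \<Longrightarrow> down n (\<lambda>n (s, out, t). exec w (Seq (Inc a) (Inc b)) (s(r := n), out, t + 3)) (s, out, t) =
    (s(r := 0, a := s a + s r, b := s b + s r), out, t + 5 * s r)" for n s out t
    using assms by (induction n arbitrary: s t) (auto simp: fun_eq_iff)
  then show ?thesis by (simp add: exec.simps(6))
qed

text \<open>Registers 0 and 1 and those of the variables may be written, since copying a register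
  destroys and restores it. All other registers below \<open>d\<close> stay untouched, so they can
  count a loop around \<open>c\<close>.\<close>

definition local_com :: "(nat \<Rightarrow> nat) \<Rightarrow> nat \<Rightarrow> com \<Rightarrow> bool" where
  "local_com \<rho> d c \<longleftrightarrow> wf_com c \<and> writes c \<subseteq> {0, 1} \<union> range \<rho> \<union> {d..}"

definition ready :: "nat list \<Rightarrow> nat \<Rightarrow> (nat \<Rightarrow> nat) \<Rightarrow> bool" where
  "ready w d s \<longleftrightarrow> s 0 = 0 \<and> s 1 = length w \<and> (\<forall>r\<ge>d. s r = 0)"

definition bounded_by :: "nat poly \<Rightarrow> (nat list \<Rightarrow> (nat \<Rightarrow> nat) \<Rightarrow> nat) \<Rightarrow> bool" where
  "bounded_by p f \<longleftrightarrow> (\<forall>w e B. (\<forall>i. e i \<le> B) \<longrightarrow> f w e \<le> poly p (length w + B))"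

text \<open>
  \<open>f w e\<close> depends on the input word \<open>w\<close> and on the values \<open>e\<close> of numbered variables. Variable \<open>i\<close> is
  kept in register \<open>\<rho> i\<close>; registers from \<open>d\<close> on are free, and the result appears in register \<open>d\<close>.
\<close>

definition computes :: "((nat \<Rightarrow> nat) \<Rightarrow> nat \<Rightarrow> com) \<Rightarrow> nat poly \<Rightarrow> (nat list \<Rightarrow> (nat \<Rightarrow> nat) \<Rightarrow> nat) \<Rightarrow> bool" where
  "computes C p f \<longleftrightarrow> bounded_by p f \<and> (\<forall>\<rho> d. 2 \<le> d \<longrightarrow> (\<forall>i. \<rho> i < d) \<longrightarrow> local_com \<rho> d (C \<rho> d) \<and>
     (\<forall>w s out t B. ready w d s \<longrightarrow> (\<forall>i. s (\<rho> i) \<le> B) \<longrightarrow>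
       (\<exists>t'. exec w (C \<rho> d) (s, out, t) = (s(d := f w (\<lambda>i. s (\<rho> i))), out, t') \<and>
          t' \<le> t + poly p (length w + B))))"

definition polytime :: "(nat list \<Rightarrow> (nat \<Rightarrow> nat) \<Rightarrow> nat) \<Rightarrow> bool" where
  "polytime f \<longleftrightarrow> (\<exists>C p. computes C p f)"

lemma boundedD: "bounded_by p f \<Longrightarrow> (\<And>i. e i \<le> B) \<Longrightarrow> f w e \<le> poly p (length w + B)"
  by (simp add: bounded_by_def)

lemma computesD:
  assumes "computes C p f" "2 \<le> d" "\<And>i. \<rho> i < d"
  shows "local_com \<rho> d (C \<rho> d)"
    and "ready w d s \<Longrightarrow> (\<And>i. s (\<rho> i) \<le> B) \<Longrightarrow>
      \<exists>t'. exec w (C \<rho> d) (s, out, t) = (s(d := f w (\<lambda>i. s (\<rho> i))), out, t') \<and>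
          t' \<le> t + poly p (length w + B)"
  using assms by (simp_all add: computes_def)

lemma polytime_bounded: "polytime f \<Longrightarrow> \<exists>p. bounded_by p f"
  by (auto simp: polytime_def computes_def)

section \<open>Closure properties of polynomial time\<close>

named_theorems polytime_intros

lemma polytime_reindex: "polytime f \<Longrightarrow> polytime (\<lambda>w e. f w (\<lambda>i. e (\<pi> i)))"
proof -
  assume "polytime f"
  then obtain C p where C: "computes C p f" by (auto simp: polytime_def)
  have "computes (\<lambda>\<rho>. C (\<lambda>i. \<rho> (\<pi> i))) p (\<lambda>w e. f w (\<lambda>i. e (\<pi> i)))"
    unfolding computes_def
  proof (intro conjI allI impI)
    show "bounded_by p (\<lambda>w e. f w (\<lambda>i. e (\<pi> i)))"
      using C by (auto simp: computes_def bounded_by_def)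
    fix \<rho> :: "nat \<Rightarrow> nat" and d :: nat assume a: "2 \<le> d" "\<forall>i. \<rho> i < d"
    show "local_com \<rho> d (C (\<lambda>i. \<rho> (\<pi> i)) d)"
      using computesD(1)[OF C, of d "\<lambda>i. \<rho> (\<pi> i)"] a by (fastforce simp: local_com_def)
    fix w s out t B assume b: "ready w d s" "\<forall>i. s (\<rho> i) \<le> B"
    show "\<exists>t'. exec w (C (\<lambda>i. \<rho> (\<pi> i)) d) (s, out, t) = (s(d := f w (\<lambda>i. s (\<rho> (\<pi> i)))), out, t') \<and>
          t' \<le> t + poly p (length w + B)"
      using computesD(2)[OF C, of d "\<lambda>i. \<rho> (\<pi> i)" w s B out t] a b by auto
  qed
  then show ?thesis by (auto simp: polytime_def)
qed

lemma polytime_zero: "polytime (\<lambda>w e. 0)"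
proof -
  have "s(d := 0) = s" if "ready w d s" for w d s using that by (auto simp: ready_def)
  then have "computes (\<lambda>\<rho> d. Skip) 0 (\<lambda>w e. 0)"
    by (simp add: computes_def bounded_by_def local_com_def)
  then show ?thesis by (auto simp: polytime_def)
qed

lemma polytime_Suc [polytime_intros]: "polytime f \<Longrightarrow> polytime (\<lambda>w e. Suc (f w e))"
proof -
  assume "polytime f"
  then obtain C p where C: "computes C p f" by (auto simp: polytime_def)
  have "computes (\<lambda>\<rho> d. Seq (C \<rho> d) (Inc d)) (p + 1) (\<lambda>w e. Suc (f w e))"
    unfolding computes_def
  proof (intro conjI allI impI)
    show "bounded_by (p + 1) (\<lambda>w e. Suc (f w e))"
      using C by (auto simp: computes_def bounded_by_def)
    fix \<rho> :: "nat \<Rightarrow> nat" and d :: nat assume a: "2 \<le> d" "\<forall>i. \<rho> i < d"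
    show "local_com \<rho> d (Seq (C \<rho> d) (Inc d))"
      using computesD(1)[OF C, of d \<rho>] a by (auto simp: local_com_def)
    fix w s out t B assume b: "ready w d s" "\<forall>i. s (\<rho> i) \<le> B"
    obtain t' where "exec w (C \<rho> d) (s, out, t) = (s(d := f w (\<lambda>i. s (\<rho> i))), out, t')"
      "t' \<le> t + poly p (length w + B)"
      using computesD(2)[OF C, of d \<rho> w s B out t] a b by auto
    then show "\<exists>t'. exec w (Seq (C \<rho> d) (Inc d)) (s, out, t) =
      (s(d := Suc (f w (\<lambda>i. s (\<rho> i)))), out, t') \<and> t' \<le> t + poly (p + 1) (length w + B)"
      by simp
  qed
  then show ?thesis by (auto simp: polytime_def)
qed

lemma polytime_const [polytime_intros]: "polytime (\<lambda>w e. n)"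
  by (induction n) (auto intro: polytime_zero polytime_Suc)

text \<open>Copying a register needs a second counter, since a loop destroys the register it runs on.\<close>

lemma exec_copy:
  assumes "ready w d s" "r < d"
  shows "\<exists>t'. exec w (Seq (Loop r (Seq (Inc d) (Inc (d + 1)))) (Loop (d + 1) (Inc r))) (s, out, t) =
    (s(d := s r), out, t') \<and> t' = t + 2 + 9 * s r"
proof -
  have "s d = 0" "s (Suc d) = 0" using assms by (auto simp: ready_def)
  then show ?thesis using assms(2)
    by (auto simp: exec_move2 exec_move fun_eq_iff)
qed

lemma polytime_var [polytime_intros]: "polytime (\<lambda>w e. e i)"
proof -
  let ?C = "\<lambda>\<rho> d. Seq (Loop (\<rho> i) (Seq (Inc d) (Inc (d + 1)))) (Loop (d + 1) (Inc (\<rho> i)))"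
  have "computes ?C [:2, 9:] (\<lambda>w e. e i)"
    unfolding computes_def
  proof (intro conjI allI impI)
    show "bounded_by [:2, 9:] (\<lambda>w e. e i)"
      unfolding bounded_by_def by (auto intro: order_trans trans_le_add2 trans_le_add1)
    fix \<rho> :: "nat \<Rightarrow> nat" and d :: nat assume a: "2 \<le> d" "\<forall>i. \<rho> i < d"
    then have "\<rho> i < d" by simp
    then show "local_com \<rho> d (?C \<rho> d)" by (auto simp: local_com_def)
    fix w s out t B assume b: "ready w d s" "\<forall>i. s (\<rho> i) \<le> B"
    have "s (\<rho> i) \<le> B" using b by simp
    then show "\<exists>t'. exec w (?C \<rho> d) (s, out, t) = (s(d := s (\<rho> i)), out, t') \<and>
      t' \<le> t + poly [:2, 9:] (length w + B)"
      using exec_copy[OF b(1) \<open>\<rho> i < d\<close>, of out t] by auto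
  qed
  then show ?thesis by (auto simp: polytime_def)
qed

lemma polytime_length [polytime_intros]: "polytime (\<lambda>w e. length w)"
proof -
  let ?C = "\<lambda>\<rho> d. Seq (Loop 1 (Seq (Inc d) (Inc (d + 1)))) (Loop (d + 1) (Inc 1))"
  have "computes ?C [:2, 9:] (\<lambda>w e. length w)"
    unfolding computes_def
  proof (intro conjI allI impI)
    show "bounded_by [:2, 9:] (\<lambda>w e. length w)" by (auto simp: bounded_by_def)
    fix \<rho> :: "nat \<Rightarrow> nat" and d :: nat assume a: "2 \<le> d" "\<forall>i. \<rho> i < d"
    then have d: "1 < d" by simp
    then show "local_com \<rho> d (?C \<rho> d)" by (auto simp: local_com_def)
    fix w s out t B assume b: "ready w d s" "\<forall>i. s (\<rho> i) \<le> B"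
    have "s 1 = length w" using b by (simp add: ready_def)
    then show "\<exists>t'. exec w (?C \<rho> d) (s, out, t) = (s(d := length w), out, t') \<and>
      t' \<le> t + poly [:2, 9:] (length w + B)"
      using exec_copy[OF b(1) d, of out t] by auto
  qed
  then show ?thesis by (auto simp: polytime_def)
qed

definition letter :: "nat list \<Rightarrow> nat \<Rightarrow> nat" where
  "letter w i = (if i < length w \<and> w ! i < 4 then w ! i else 0)"

lemma polytime_letter [polytime_intros]:
  assumes "polytime f"
  shows "polytime (\<lambda>w e. letter w (f w e))"
proof -
  obtain C p where C: "computes C p f" using assms by (auto simp: polytime_def)
  define R where "R d = IfSym 1 (Inc d) (IfSym 2 (Seq (Inc d) (Inc d))
    (IfSym 3 (Seq (Inc d) (Seq (Inc d) (Inc d))) Skip))" for d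
  have R: "\<exists>t'. exec w (R d) (s, out, t) = (s(d := letter w i), out, t') \<and> t' \<le> t + 9"
    if "s 0 = Suc i" "s d = 0" for w d s i out t
  proof -
    have "s(d := 0) = s" using that(2) by auto
    then show ?thesis using that
      by (auto simp: R_def symbol_at_def letter_def blank_def numeral_2_eq_2 numeral_3_eq_3)
  qed
  \<comment> \<open>The argument is moved into register 0, plus one because the input starts at cell
    1; the symbol is read by case distinction and the head is rewound.\<close>
  let ?C = "\<lambda>\<rho> d. Seq (C \<rho> d) (Seq (Loop d (Inc 0)) (Seq (Inc 0) (Seq (R d) (Loop 0 Skip))))"
  have "computes ?C (p + 7 * p + [:15:]) (\<lambda>w e. letter w (f w e))"
    unfolding computes_def
  proof (intro conjI allI impI)
    have "letter w i < 4" for w i by (auto simp: letter_def)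
    then have "letter w i \<le> poly (p + 7 * p + [:15:]) x" for w i x
      by (rule order_trans[OF less_imp_le, of _ 4]) simp
    then show "bounded_by (p + 7 * p + [:15:]) (\<lambda>w e. letter w (f w e))" by (auto simp: bounded_by_def)
    fix \<rho> :: "nat \<Rightarrow> nat" and d :: nat assume a: "2 \<le> d" "\<forall>i. \<rho> i < d"
    show "local_com \<rho> d (?C \<rho> d)"
      using computesD(1)[OF C, of d \<rho>] a by (auto simp: local_com_def R_def)
    fix w s out t B assume b: "ready w d s" "\<forall>i. s (\<rho> i) \<le> B"
    let ?v = "f w (\<lambda>i. s (\<rho> i))"
    obtain t1 where t1: "exec w (C \<rho> d) (s, out, t) = (s(d := ?v), out, t1)"
      "t1 \<le> t + poly p (length w + B)"
      using computesD(2)[OF C, of d \<rho> w s B out t] a b by auto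
    have v: "?v \<le> poly p (length w + B)" using C b boundedD[of p f "\<lambda>i. s (\<rho> i)"] by (auto simp: computes_def)
    have s0: "s 0 = 0" "s d = 0" "d \<noteq> 0" using b a by (auto simp: ready_def)
    have t2: "exec w (Loop d (Inc 0)) (s(d := ?v), out, t1) = (s(0 := ?v), out, t1 + 1 + 4 * ?v)"
      using s0 by (subst exec_move) (auto simp: fun_eq_iff)
    obtain t3 where t3: "exec w (R d) (s(0 := Suc ?v), out, Suc (t1 + 1 + 4 * ?v)) =
        (s(0 := Suc ?v, d := letter w ?v), out, t3)" "t3 \<le> Suc (t1 + 1 + 4 * ?v) + 9"
      using R[of "s(0 := Suc ?v)" ?v d w out "Suc (t1 + 1 + 4 * ?v)"] s0 by auto
    have "exec w (?C \<rho> d) (s, out, t) = (s(0 := 0, d := letter w ?v), out, t3 + 1 + 3 * Suc ?v)"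
      using s0 t3(1) by (simp add: t1(1) t2 exec_clear fun_upd_twist)
    moreover have "s(0 := 0) = s" using s0 by auto
    ultimately show "\<exists>t'. exec w (?C \<rho> d) (s, out, t) = (s(d := letter w ?v), out, t') \<and>
      t' \<le> t + poly (p + 7 * p + [:15:]) (length w + B)"
      using t1(2) t3(2) v by (auto simp: numeral_poly)
  qed
  then show ?thesis by (auto simp: polytime_def)
qed

text \<open>Iterating a polynomial-time step can produce exponential values, as repeated doubling
  does. Hence the bound \<open>q\<close> on all intermediate values; with it every round costs at
  most one and the same polynomial.\<close>

theorem polytime_rec:
  assumes f: "polytime n" "polytime a" "polytime (\<lambda>w e. g w (e 0) (e 1) (\<lambda>i. e (Suc (Suc i))))"
    and bound: "\<And>w e B i. (\<And>j. e j \<le> B) \<Longrightarrow> i \<le> n w e \<Longrightarrow>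
      rec_nat (a w e) (\<lambda>i x. g w i x e) i \<le> poly q (length w + B)"
  shows "polytime (\<lambda>w e. rec_nat (a w e) (\<lambda>i x. g w i x e) (n w e))"
proof -
  obtain Cn pn where Cn: "computes Cn pn n" using f by (auto simp: polytime_def)
  obtain Ca pa where Ca: "computes Ca pa a" using f by (auto simp: polytime_def)
  obtain Cg pg where Cg: "computes Cg pg (\<lambda>w e. g w (e 0) (e 1) (\<lambda>i. e (Suc (Suc i))))"
    using f by (auto simp: polytime_def)
  \<comment> \<open>The loop register \<open>d\<close> counts down, so the index handed to
    \<open>g\<close> is counted up separately in \<open>d + 2\<close>; the value reached so far is
    in \<open>d + 1\<close>.\<close>
  define ext where "ext \<rho> d = case_nat (d + 2) (case_nat (d + 1) \<rho>)" for \<rho> :: "nat \<Rightarrow> nat" and d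
  define body where "body \<rho> d = Seq (Cg (ext \<rho> d) (d + 3)) (Seq (Loop (d + 1) Skip)
      (Seq (Loop (d + 3) (Inc (d + 1))) (Inc (d + 2))))" for \<rho> d
  define C where "C \<rho> d = Seq (Cn \<rho> d) (Seq (Ca \<rho> (d + 1)) (Seq (Loop d (body \<rho> d))
      (Seq (Loop (d + 2) Skip) (Loop (d + 1) (Inc d)))))" for \<rho> d
  define pb where "pb = pcompose pg ([:0, 1:] + pn + q) + 7 * q + [:10:]"
  define p where "p = pn + pa + pn * pb + 3 * pn + 4 * q + q + [:10:]"
  let ?f = "\<lambda>w e. rec_nat (a w e) (\<lambda>i x. g w i x e) (n w e)"
  have num: "poly (numeral k * r) x = numeral k * poly r x" for k x and r :: "nat poly"
    by (simp add: numeral_poly)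
  have "computes C p ?f"
    unfolding computes_def
  proof (intro conjI allI impI)
    show "bounded_by p ?f"
      unfolding bounded_by_def
    proof (intro allI impI)
      fix w B and e :: "nat \<Rightarrow> nat" assume "\<forall>i. e i \<le> B"
      then have "?f w e \<le> poly q (length w + B)" using bound[of e B "n w e" w] by simp
      then show "?f w e \<le> poly p (length w + B)" by (simp add: p_def)
    qed
    fix \<rho> :: "nat \<Rightarrow> nat" and d :: nat assume d: "2 \<le> d" and \<rho>: "\<forall>i. \<rho> i < d"
    have ext: "ext \<rho> d i < d + 3" for i
      using \<rho> by (auto simp: ext_def less_Suc_eq trans_less_add1 split: nat.split)
    have rext: "range (ext \<rho> d) = {d + 1, d + 2} \<union> range \<rho>"
      by (auto simp: ext_def image_iff split: nat.splits)
    have \<rho>d: "\<rho> i \<noteq> d" "\<rho> i \<noteq> Suc d" "\<rho> i \<noteq> Suc (Suc d)" for i using \<rho>[rule_format, of i] by auto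
    show "local_com \<rho> d (C \<rho> d)"
      using computesD(1)[OF Cn d, of \<rho>] computesD(1)[OF Ca, of "d + 1" \<rho>]
        computesD(1)[OF Cg, of "d + 3" "ext \<rho> d"] d \<rho> ext \<rho>d
      unfolding local_com_def C_def body_def rext by (auto simp: less_Suc_eq)
    fix w s out t B assume s: "ready w d s" and B: "\<forall>i. s (\<rho> i) \<le> B"
    let ?e = "\<lambda>i. s (\<rho> i)"
    let ?X = "length w + B"
    define N where "N = n w ?e"
    define R where "R i = rec_nat (a w ?e) (\<lambda>i x. g w i x ?e) i" for i
    have N: "N \<le> poly pn ?X" using boundedD[of pn n ?e B w] Cn B by (auto simp: computes_def N_def)
    have R: "R i \<le> poly q ?X" if "i \<le> N" for i using bound[of ?e B i w] B that by (auto simp: R_def N_def)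
    obtain t1 where t1: "exec w (Cn \<rho> d) (s, out, t) = (s(d := N), out, t1)" "t1 \<le> t + poly pn ?X"
      using computesD(2)[OF Cn d, of \<rho> w s B out t] \<rho> B s unfolding N_def by blast
    have r2: "ready w (d + 1) (s(d := N))" using s d by (auto simp: ready_def)
    have e2: "(\<lambda>i. (s(d := N)) (\<rho> i)) = ?e" using \<rho>d by auto
    have \<rho>2: "\<rho> i < d + 1" for i using \<rho> by (simp add: less_SucI)
    obtain t2 where t2: "exec w (Ca \<rho> (d + 1)) (s(d := N), out, t1) = (s(d := N, d + 1 := R 0), out, t2)"
      "t2 \<le> t1 + poly pa ?X"
      using computesD(2)[OF Ca, of "d + 1" \<rho> w "s(d := N)" B out t1] d B \<rho>2 r2 unfolding e2
      by (auto simp: R_def \<rho>d)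
    \<comment> \<open>The registers when \<open>k\<close> rounds are still to go.\<close>
    let ?S = "\<lambda>k. s(d := k, d + 1 := R (N - k), d + 2 := N - k)"
    have body: "\<exists>t''. exec w (body \<rho> d) ((?S (Suc k))(d := k), out, t') = (?S k, out, t'') \<and> t'' + 3 \<le> t' + poly pb ?X"
      if k: "Suc k \<le> N" for k t'
    proof -
      let ?i = "N - Suc k"
      let ?s = "s(d := k, d + 1 := R ?i, d + 2 := ?i)"
      have i: "N - k = Suc ?i" using k by simp
      have s1: "(?S (Suc k))(d := k) = ?s" by (simp add: fun_upd_twist)
      have env: "(\<lambda>i. ?s (ext \<rho> d i)) = case_nat ?i (case_nat (R ?i) ?e)"
        using \<rho>d by (auto simp: ext_def fun_eq_iff split: nat.split)
      have rd: "ready w (d + 3) ?s" using s d by (auto simp: ready_def)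
      have Bi: "?s (ext \<rho> d j) \<le> B + poly pn ?X + poly q ?X" for j
      proof -
        have "?s (ext \<rho> d j) = case_nat ?i (case_nat (R ?i) ?e) j" using env by metis
        also have "\<dots> \<le> B + poly pn ?X + poly q ?X"
          using B N R[of ?i] by (auto split: nat.split intro: trans_le_add1)
        finally show ?thesis .
      qed
      have val: "g w (?s (ext \<rho> d 0)) (?s (ext \<rho> d 1)) (\<lambda>i. ?s (ext \<rho> d (Suc (Suc i)))) = R (Suc ?i)"
        using \<rho>d by (simp add: ext_def R_def)
      have d3: "2 \<le> d + 3" by simp
      obtain u where u: "exec w (Cg (ext \<rho> d) (d + 3)) (?s, out, t') = (?s(d + 3 := R (Suc ?i)), out, u)"
        "u \<le> t' + poly pg (length w + (B + poly pn ?X + poly q ?X))"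
        using computesD(2)[of Cg pg _ "d + 3" "ext \<rho> d", OF Cg d3 ext rd Bi, of out t'] unfolding val by blast
      have s4: "s (d + 1) = 0" "s (d + 2) = 0" "s (d + 3) = 0" using s by (auto simp: ready_def)
      have "exec w (body \<rho> d) (?s, out, t') =
        (?S k, out, u + 1 + 3 * R ?i + 1 + 4 * R (Suc ?i) + 1)"
        unfolding body_def i exec.simps(4) u(1) using s4 by (auto simp: exec_clear exec_move fun_eq_iff)
      moreover have "R ?i \<le> poly q ?X" "R (Suc ?i) \<le> poly q ?X" using R k by auto
      ultimately show ?thesis using u(2) unfolding s1
        by (auto simp: pb_def num poly_pcompose add.assoc)
    qed
    have s2: "s(d := N, d + 1 := R 0) = ?S N" using s by (auto simp: fun_eq_iff ready_def)
    define F where "F = (\<lambda>k (s, out, t). exec w (body \<rho> d) (s(d := k), out, t + 3))"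
    have "\<exists>u. down N F (?S N, out, t2 + 1) = (?S 0, out, u) \<and> u \<le> t2 + 1 + (N - 0) * poly pb ?X"
    proof (rule down_invariant)
      fix k x assume k: "k < N" "\<exists>u. x = (?S (Suc k), out, u) \<and> u \<le> t2 + 1 + (N - Suc k) * poly pb ?X"
      then obtain u where u: "x = (?S (Suc k), out, u)" "u \<le> t2 + 1 + (N - Suc k) * poly pb ?X" by blast
      obtain u' where u': "exec w (body \<rho> d) ((?S (Suc k))(d := k), out, u + 3) = (?S k, out, u')"
        "u' + 3 \<le> u + 3 + poly pb ?X"
        using body[of k "u + 3"] k by auto
      have "N - k = Suc (N - Suc k)" using k by simp
      then have "u' \<le> t2 + 1 + (N - k) * poly pb ?X" using u(2) u'(2) by simp
      then show "\<exists>u. F k x = (?S k, out, u) \<and> u \<le> t2 + 1 + (N - k) * poly pb ?X"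
        using u' u(1) unfolding F_def by auto
    qed auto
    moreover have "(?S N) d = N" by simp
    ultimately obtain t3 where t3: "exec w (Loop d (body \<rho> d)) (?S N, out, t2) = (?S 0, out, t3)"
      "t3 \<le> t2 + 1 + N * poly pb ?X"
      unfolding exec.simps(6) prod.case F_def[symmetric] by (metis diff_zero)
    have s4: "s d = 0" "s (d + 1) = 0" "s (d + 2) = 0" using s by (auto simp: ready_def)
    have "exec w (C \<rho> d) (s, out, t) = (s(d := R N), out, t3 + 1 + 3 * N + 1 + 4 * R N)"
      unfolding C_def exec.simps(4) t1(1) t2(1) s2 t3(1)
      using s4 by (auto simp: exec_clear exec_move fun_eq_iff)
    moreover have "t3 + 1 + 3 * N + 1 + 4 * R N \<le> t + poly p ?X"
    proof -
      have "N * poly pb ?X \<le> poly pn ?X * poly pb ?X" using N by simp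
      moreover have "poly p ?X = poly pn ?X + poly pa ?X + poly pn ?X * poly pb ?X + 3 * poly pn ?X +
        4 * poly q ?X + poly q ?X + 10" by (simp add: p_def num)
      moreover have "R N \<le> poly q ?X" using R by simp
      ultimately show ?thesis using t1(2) t2(2) t3(2) N by linarith
    qed
    ultimately show "\<exists>t'. exec w (C \<rho> d) (s, out, t) = (s(d := ?f w ?e), out, t') \<and>
        t' \<le> t + poly p ?X"
      unfolding R_def N_def by blast
  qed
  then show ?thesis by (auto simp: polytime_def)
qed

text \<open>Variables act as de Bruijn indices: \<open>case_nat v e\<close> binds \<open>v\<close>
  as variable 0 and shifts the others. A recursion of length one does the binding, its step being
  \<open>G\<close> applied to the start value.\<close>

lemma polytime_let:
  assumes G: "polytime G" and f: "polytime f"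
  shows "polytime (\<lambda>w e. G w (case_nat (f w e) e))"
proof -
  obtain pf where pf: "bounded_by pf f" using f polytime_bounded by blast
  obtain pG where pG: "bounded_by pG G" using G polytime_bounded by blast
  have "(\<lambda>i. e (case_nat 1 (\<lambda>i. Suc (Suc i)) i)) = case_nat (e 1) (\<lambda>i. e (Suc (Suc i)))" for e :: "nat \<Rightarrow> nat"
    by (auto simp: fun_eq_iff split: nat.split)
  then have 1: "polytime (\<lambda>w e. G w (case_nat (e 1) (\<lambda>i. e (Suc (Suc i)))))"
    using polytime_reindex[OF G, of "case_nat 1 (\<lambda>i. Suc (Suc i))"] by simp
  have "polytime (\<lambda>w e. rec_nat (f w e) (\<lambda>i x. G w (case_nat x e)) 1)"
  proof (rule polytime_rec[where q = "pf + pcompose pG ([:0, 1:] + pf)"])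
    fix w :: "nat list" and e :: "nat \<Rightarrow> nat" and B i :: nat
    assume e: "\<And>j. e j \<le> B" and i: "i \<le> 1"
    let ?X = "length w + B"
    have fb: "f w e \<le> poly pf ?X" using boundedD[OF pf] e by blast
    have "case_nat (f w e) e j \<le> B + poly pf ?X" for j
      using fb e by (auto split: nat.split intro: trans_le_add1)
    from boundedD[OF pG, OF this] have "G w (case_nat (f w e) e) \<le> poly (pcompose pG ([:0, 1:] + pf)) ?X"
      by (simp add: poly_pcompose add.assoc)
    then show "rec_nat (f w e) (\<lambda>i x. G w (case_nat x e)) i \<le> poly (pf + pcompose pG ([:0, 1:] + pf)) ?X"
      using fb i by (cases i) auto
  qed (use f 1 in \<open>auto intro: polytime_const\<close>)
  then show ?thesis by simp
qed

text \<open>A formula with bounded quantifiers can first be treated with plain variables as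
  arguments; substituting afterwards avoids pushing the arguments under its binders.\<close>

lemma polytime_subst1:
  assumes "polytime (\<lambda>w e. F w (e 0))" "polytime f"
  shows "polytime (\<lambda>w e. F w (f w e))"
  using polytime_let[OF assms] by simp

lemma polytime_subst2:
  assumes "polytime (\<lambda>w e. F w (e 0) (e (Suc 0)))" "polytime f" "polytime g"
  shows "polytime (\<lambda>w e. F w (f w e) (g w e))"
  using polytime_let[OF polytime_let[OF assms(1) polytime_reindex[OF assms(2), of Suc]] assms(3)] by simp

lemma polytime_if [polytime_intros]:
  assumes "polytime (\<lambda>w e. of_bool (P w e))" "polytime f" "polytime g"
  shows "polytime (\<lambda>w e. if P w e then f w e else g w e)"
proof -
  obtain pf pg where p: "bounded_by pf f" "bounded_by pg g" using assms polytime_bounded by metis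
  \<comment> \<open>A recursion of length 0 or 1 is a conditional.\<close>
  have "polytime (\<lambda>w e. rec_nat (g w e) (\<lambda>i x. f w e) (of_bool (P w e)))"
  proof (rule polytime_rec[where q = "pf + pg"])
    show "polytime (\<lambda>w e. f w (\<lambda>i. e (Suc (Suc i))))" by (rule polytime_reindex) fact
    fix w :: "nat list" and e :: "nat \<Rightarrow> nat" and B i :: nat
    assume "\<And>j. e j \<le> B"
    then have "f w e \<le> poly pf (length w + B)" "g w e \<le> poly pg (length w + B)"
      using boundedD[OF p(1)] boundedD[OF p(2)] by blast+
    then show "rec_nat (g w e) (\<lambda>i x. f w e) i \<le> poly (pf + pg) (length w + B)" by (cases i) auto
  qed (use assms in auto)
  moreover have "rec_nat (g w e) (\<lambda>i x. f w e) (of_bool (P w e)) = (if P w e then f w e else g w e)" for w e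
    by simp
  ultimately show ?thesis by simp
qed

lemma polytime_add [polytime_intros]:
  assumes "polytime f" "polytime g"
  shows "polytime (\<lambda>w e. f w e + g w e)"
proof -
  obtain pf pg where p: "bounded_by pf f" "bounded_by pg g" using assms polytime_bounded by metis
  have r: "rec_nat a (\<lambda>i x. Suc x) n = a + n" for a n by (induction n) auto
  have "polytime (\<lambda>w e. rec_nat (f w e) (\<lambda>i x. Suc x) (g w e))"
  proof (rule polytime_rec[where q = "pf + pg"])
    fix w :: "nat list" and e :: "nat \<Rightarrow> nat" and B i :: nat
    assume "\<And>j. e j \<le> B" and i: "i \<le> g w e"
    then have "f w e \<le> poly pf (length w + B)" "g w e \<le> poly pg (length w + B)"
      using boundedD[OF p(1)] boundedD[OF p(2)] by blast+
    then show "rec_nat (f w e) (\<lambda>i x. Suc x) i \<le> poly (pf + pg) (length w + B)" using i by (simp add: r)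
  qed (intro assms polytime_const polytime_Suc polytime_var)+
  then show ?thesis unfolding r .
qed

lemma polytime_pred:
  assumes "polytime f"
  shows "polytime (\<lambda>w e. f w e - 1)"
proof -
  obtain pf where p: "bounded_by pf f" using assms polytime_bounded by metis
  have r: "rec_nat 0 (\<lambda>i x. i) n = n - 1" for n by (cases n) auto
  have "polytime (\<lambda>w e. rec_nat 0 (\<lambda>i x. i) (f w e))"
  proof (rule polytime_rec[where q = pf])
    fix w :: "nat list" and e :: "nat \<Rightarrow> nat" and B i :: nat
    assume "\<And>j. e j \<le> B" and i: "i \<le> f w e"
    then have "f w e \<le> poly pf (length w + B)" using boundedD[OF p(1)] by blast
    then show "rec_nat 0 (\<lambda>i x. i) i \<le> poly pf (length w + B)" using i unfolding r by linarith
  qed (intro assms polytime_const polytime_Suc polytime_var)+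
  then show ?thesis unfolding r .
qed

lemma polytime_diff [polytime_intros]:
  assumes "polytime f" "polytime g"
  shows "polytime (\<lambda>w e. f w e - g w e)"
proof -
  obtain pf where p: "bounded_by pf f" using assms polytime_bounded by metis
  have r: "rec_nat a (\<lambda>i x. x - 1) n = a - n" for a n by (induction n) auto
  have "polytime (\<lambda>w e. rec_nat (f w e) (\<lambda>i x. x - 1) (g w e))"
  proof (rule polytime_rec[where q = pf])
    fix w :: "nat list" and e :: "nat \<Rightarrow> nat" and B i :: nat
    assume "\<And>j. e j \<le> B" and i: "i \<le> g w e"
    then have "f w e \<le> poly pf (length w + B)" using boundedD[OF p(1)] by blast
    then show "rec_nat (f w e) (\<lambda>i x. x - 1) i \<le> poly pf (length w + B)" unfolding r by linarith
  qed (intro assms polytime_pred polytime_var)+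
  then show ?thesis unfolding r .
qed

lemma polytime_sum [polytime_intros]:
  assumes n: "polytime n" and G: "polytime (\<lambda>w e. G w (e 0) (\<lambda>i. e (Suc i)))"
  shows "polytime (\<lambda>w e. \<Sum>i<n w e. G w i e)"
proof -
  obtain pn where pn: "bounded_by pn n" using polytime_bounded[OF n] by blast
  obtain pG where pG: "bounded_by pG (\<lambda>w e. G w (e 0) (\<lambda>i. e (Suc i)))" using polytime_bounded[OF G] by blast
  have r: "rec_nat 0 (\<lambda>i x. x + g i) m = (\<Sum>i<m. g i)" for g :: "nat \<Rightarrow> nat" and m by (induction m) auto
  have G': "polytime (\<lambda>w e. G w (e 0) (\<lambda>i. e (Suc (Suc i))))"
    using polytime_reindex[OF G, of "case_nat 0 (\<lambda>i. Suc (Suc i))"] by simp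
  have "polytime (\<lambda>w e. rec_nat 0 (\<lambda>i x. x + G w i e) (n w e))"
  proof (rule polytime_rec[where q = "pn * pcompose pG ([:0, 1:] + pn)"])
    fix w :: "nat list" and e :: "nat \<Rightarrow> nat" and B i :: nat
    assume e: "\<And>j. e j \<le> B" and i: "i \<le> n w e"
    let ?X = "length w + B"
    have nb: "n w e \<le> poly pn ?X" using boundedD[OF pn] e by blast
    have "G w j e \<le> poly (pcompose pG ([:0, 1:] + pn)) ?X" if "j < i" for j
    proof -
      have "case_nat j e k \<le> B + poly pn ?X" for k
        using that i nb e by (auto split: nat.split intro: trans_le_add1)
      from boundedD[OF pG, of "case_nat j e", OF this, of w] show ?thesis by (simp add: poly_pcompose add.assoc)
    qed
    then have "(\<Sum>j<i. G w j e) \<le> i * poly (pcompose pG ([:0, 1:] + pn)) ?X"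
      using sum_bounded_above[of "{..<i}" "\<lambda>j. G w j e" "poly (pcompose pG ([:0, 1:] + pn)) ?X"] by simp
    also have "\<dots> \<le> poly pn ?X * poly (pcompose pG ([:0, 1:] + pn)) ?X"
      using i nb by (intro mult_right_mono) auto
    finally show "rec_nat 0 (\<lambda>i x. x + G w i e) i \<le> poly (pn * pcompose pG ([:0, 1:] + pn)) ?X"
      by (simp add: r)
  qed (intro n G' polytime_const polytime_add polytime_var)+
  then show ?thesis unfolding r .
qed

lemma polytime_mult [polytime_intros]:
  assumes "polytime f" "polytime g"
  shows "polytime (\<lambda>w e. f w e * g w e)"
  using polytime_sum[OF assms(1) polytime_reindex[OF assms(2), of Suc]] by simp

lemma polytime_le [polytime_intros]:
  assumes "polytime f" "polytime g"
  shows "polytime (\<lambda>w e. of_bool (f w e \<le> g w e))"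
proof -
  have "polytime (\<lambda>w e. 1 - (f w e - g w e))" by (intro polytime_intros assms)
  moreover have "1 - (f w e - g w e) = of_bool (f w e \<le> g w e)" for w e by auto
  ultimately show ?thesis by simp
qed

lemma polytime_less [polytime_intros]:
  assumes "polytime f" "polytime g"
  shows "polytime (\<lambda>w e. of_bool (f w e < g w e))"
  using polytime_le[OF polytime_Suc[OF assms(1)] assms(2)] by (simp add: Suc_le_eq)

lemma polytime_conj [polytime_intros]:
  assumes "polytime (\<lambda>w e. of_bool (P w e))" "polytime (\<lambda>w e. of_bool (Q w e))"
  shows "polytime (\<lambda>w e. of_bool (P w e \<and> Q w e))"
  using polytime_mult[OF assms] by (simp only: of_bool_conj)

lemma polytime_not [polytime_intros]:
  assumes "polytime (\<lambda>w e. of_bool (P w e))"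
  shows "polytime (\<lambda>w e. of_bool (\<not> P w e))"
proof -
  have "1 - of_bool (P w e) = (of_bool (\<not> P w e) :: nat)" for w e by simp
  then show ?thesis using polytime_diff[OF polytime_const[of 1] assms] by simp
qed

lemma polytime_disj [polytime_intros]:
  assumes "polytime (\<lambda>w e. of_bool (P w e))" "polytime (\<lambda>w e. of_bool (Q w e))"
  shows "polytime (\<lambda>w e. of_bool (P w e \<or> Q w e))"
  using polytime_not[OF polytime_conj[OF polytime_not[OF assms(1)] polytime_not[OF assms(2)]]] by simp

lemma polytime_imp [polytime_intros]:
  assumes "polytime (\<lambda>w e. of_bool (P w e))" "polytime (\<lambda>w e. of_bool (Q w e))"
  shows "polytime (\<lambda>w e. of_bool (P w e \<longrightarrow> Q w e))"
  using polytime_disj[OF polytime_not[OF assms(1)] assms(2)] unfolding imp_conv_disj[symmetric] .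

lemma polytime_eq [polytime_intros]:
  assumes "polytime f" "polytime g"
  shows "polytime (\<lambda>w e. of_bool (f w e = g w e))"
  using polytime_conj[OF polytime_le[OF assms] polytime_le[OF assms(2,1)]] unfolding eq_iff[symmetric] .

lemma polytime_ex [polytime_intros]:
  assumes "polytime n" "polytime (\<lambda>w e. of_bool (P w (e 0) (\<lambda>i. e (Suc i))))"
  shows "polytime (\<lambda>w e. of_bool (\<exists>i<n w e. P w i e))"
proof -
  have "polytime (\<lambda>w e. of_bool (0 < (\<Sum>i<n w e. of_bool (P w i e) :: nat)))"
    by (intro polytime_less polytime_const polytime_sum assms)
  moreover have "0 < (\<Sum>i<m. of_bool (Q i) :: nat) \<longleftrightarrow> (\<exists>i<m. Q i)" for m and Q :: "nat \<Rightarrow> bool"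
    by (induction m) (auto simp: less_Suc_eq)
  ultimately show ?thesis by simp
qed

lemma polytime_all [polytime_intros]:
  assumes "polytime n" "polytime (\<lambda>w e. of_bool (P w (e 0) (\<lambda>i. e (Suc i))))"
  shows "polytime (\<lambda>w e. of_bool (\<forall>i<n w e. P w i e))"
  using polytime_not[OF polytime_ex[OF assms(1) polytime_not[OF assms(2)]]] by simp

lemma polytime_of_bool [polytime_intros]: "polytime (\<lambda>w e. of_bool b)"
  by (rule polytime_const)

text \<open>Division becomes a bounded count of multiples, to which the closure rules apply.\<close>

lemma div_eq_sum: "(a :: nat) div b = (if b = 0 then 0 else \<Sum>i<a. of_bool (Suc i * b \<le> a))"
proof (cases "b = 0")
  case False
  have "{i. i < a \<and> Suc i * b \<le> a} = {..<a div b}"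
  proof (intro set_eqI iffI)
    fix i assume "i \<in> {..<a div b}"
    then have "Suc i * b \<le> a" using False by (simp add: less_eq_div_iff_mult_less_eq[symmetric] Suc_le_eq del: mult_Suc)
    moreover from this have "i < a" using False by (metis Suc_le_lessD le_trans mult_le_mono2 nat_mult_1_right not_gr_zero Suc_leI One_nat_def)
    ultimately show "i \<in> {i. i < a \<and> Suc i * b \<le> a}" by blast
  next
    fix i assume "i \<in> {i. i < a \<and> Suc i * b \<le> a}"
    then show "i \<in> {..<a div b}" using False
      by (simp add: less_eq_div_iff_mult_less_eq[symmetric] Suc_le_eq del: mult_Suc)
  qed
  then have "card {i. i < a \<and> Suc i * b \<le> a} = a div b" by simp
  moreover have "(\<Sum>i<a. of_bool (Suc i * b \<le> a)) = card {i. i < a \<and> Suc i * b \<le> a}"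
    by (subst sum_of_bool_eq) (auto simp: Int_def lessThan_def conj_commute)
  ultimately show ?thesis using False by simp
qed simp

lemma polytime_div [polytime_intros]:
  assumes "polytime f" "polytime g"
  shows "polytime (\<lambda>w e. f w e div g w e)"
  using assms
proof (rule polytime_subst2[rotated])
  show "polytime (\<lambda>w e. e 0 div e (Suc 0))"
    unfolding div_eq_sum by (intro polytime_intros)
qed

lemma polytime_mod [polytime_intros]:
  assumes "polytime f" "polytime g"
  shows "polytime (\<lambda>w e. f w e mod g w e)"
  unfolding modulo_nat_def by (intro polytime_intros assms)

lemma polytime_odd [polytime_intros]:
  assumes "polytime f"
  shows "polytime (\<lambda>w e. of_bool (odd (f w e)))"
  unfolding odd_iff_mod_2_eq_one by (intro polytime_intros assms)

lemma polytime_min [polytime_intros]: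
  assumes "polytime f" "polytime g"
  shows "polytime (\<lambda>w e. min (f w e) (g w e))"
  unfolding min_def by (intro polytime_intros assms)

lemma polytime_poly [polytime_intros]:
  assumes "polytime f"
  shows "polytime (\<lambda>w e. poly p (f w e))"
  by (induction p) (auto intro!: polytime_intros assms)

text \<open>A finite table is polynomial whatever \<open>h\<close> is, by one case distinction per
  entry. In this way the transition function of an arbitrary verifier enters the reduction.\<close>

lemma polytime_table:
  assumes "polytime f"
  shows "polytime (\<lambda>w e. if f w e < n then h (f w e) else 0)"
proof (induction n)
  case (Suc n)
  have "polytime (\<lambda>w e. if f w e = n then h n else if f w e < n then h (f w e) else 0)"
    by (intro polytime_if polytime_eq polytime_const assms Suc)
  moreover have "(if f w e = n then h n else if f w e < n then h (f w e) else 0) =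
    (if f w e < Suc n then h (f w e) else 0)" for w e by auto
  ultimately show ?case by simp
qed (simp add: polytime_const)

section \<open>Polynomial-time output of bit strings\<close>

definition emits_by :: "((nat \<Rightarrow> nat) \<Rightarrow> nat \<Rightarrow> com) \<Rightarrow> nat poly \<Rightarrow> (nat list \<Rightarrow> (nat \<Rightarrow> nat) \<Rightarrow> bool list) \<Rightarrow> bool" where
  "emits_by C p F \<longleftrightarrow> (\<forall>\<rho> d. 2 \<le> d \<longrightarrow> (\<forall>i. \<rho> i < d) \<longrightarrow> local_com \<rho> d (C \<rho> d) \<and>
     (\<forall>w s out t B. ready w d s \<longrightarrow> (\<forall>i. s (\<rho> i) \<le> B) \<longrightarrow>
       (\<exists>t'. exec w (C \<rho> d) (s, out, t) = (s, map bit_symbol (F w (\<lambda>i. s (\<rho> i))) @ out, t') \<and>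
          t' \<le> t + poly p (length w + B))))"

definition emits :: "(nat list \<Rightarrow> (nat \<Rightarrow> nat) \<Rightarrow> bool list) \<Rightarrow> bool" where
  "emits F \<longleftrightarrow> (\<exists>C p. emits_by C p F)"

lemma emits_byD:
  assumes "emits_by C p F" "2 \<le> d" "\<And>i. \<rho> i < d"
  shows "local_com \<rho> d (C \<rho> d)"
    and "ready w d s \<Longrightarrow> (\<And>i. s (\<rho> i) \<le> B) \<Longrightarrow>
      \<exists>t'. exec w (C \<rho> d) (s, out, t) = (s, map bit_symbol (F w (\<lambda>i. s (\<rho> i))) @ out, t') \<and>
          t' \<le> t + poly p (length w + B)"
  using assms by (simp_all add: emits_by_def)

named_theorems emits_intros

lemma emits_Nil [emits_intros]: "emits (\<lambda>w e. [])"
proof -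
  have "emits_by (\<lambda>\<rho> d. Skip) 0 (\<lambda>w e. [])" by (simp add: emits_by_def local_com_def)
  then show ?thesis by (auto simp: emits_def)
qed

lemma emits_reindex:
  assumes "emits F"
  shows "emits (\<lambda>w e. F w (\<lambda>i. e (\<pi> i)))"
proof -
  obtain C p where C: "emits_by C p F" using assms by (auto simp: emits_def)
  have "emits_by (\<lambda>\<rho>. C (\<lambda>i. \<rho> (\<pi> i))) p (\<lambda>w e. F w (\<lambda>i. e (\<pi> i)))"
    unfolding emits_by_def
  proof (intro conjI allI impI)
    fix \<rho> :: "nat \<Rightarrow> nat" and d :: nat assume a: "2 \<le> d" "\<forall>i. \<rho> i < d"
    show "local_com \<rho> d (C (\<lambda>i. \<rho> (\<pi> i)) d)"
      using emits_byD(1)[OF C, of d "\<lambda>i. \<rho> (\<pi> i)"] a by (fastforce simp: local_com_def)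
    fix w s out t B assume b: "ready w d s" "\<forall>i. s (\<rho> i) \<le> B"
    show "\<exists>t'. exec w (C (\<lambda>i. \<rho> (\<pi> i)) d) (s, out, t) = (s, map bit_symbol (F w (\<lambda>i. s (\<rho> (\<pi> i)))) @ out, t') \<and>
          t' \<le> t + poly p (length w + B)"
      using emits_byD(2)[OF C, of d "\<lambda>i. \<rho> (\<pi> i)" w s B out t] a b by auto
  qed
  then show ?thesis by (auto simp: emits_def)
qed

lemma emits_append [emits_intros]:
  assumes "emits F" "emits G"
  shows "emits (\<lambda>w e. F w e @ G w e)"
proof -
  obtain C p where C: "emits_by C p F" using assms by (auto simp: emits_def)
  obtain D q where D: "emits_by D q G" using assms by (auto simp: emits_def)
  \<comment> \<open>Output grows to the left, so the right-hand part is emitted first.\<close>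
  have "emits_by (\<lambda>\<rho> d. Seq (D \<rho> d) (C \<rho> d)) (p + q) (\<lambda>w e. F w e @ G w e)"
    unfolding emits_by_def
  proof (intro conjI allI impI)
    fix \<rho> :: "nat \<Rightarrow> nat" and d :: nat assume a: "2 \<le> d" "\<forall>i. \<rho> i < d"
    show "local_com \<rho> d (Seq (D \<rho> d) (C \<rho> d))"
      using emits_byD(1)[OF C, of d \<rho>] emits_byD(1)[OF D, of d \<rho>] a by (auto simp: local_com_def)
    fix w s out t B assume b: "ready w d s" "\<forall>i. s (\<rho> i) \<le> B"
    let ?e = "\<lambda>i. s (\<rho> i)"
    obtain t1 where t1: "exec w (D \<rho> d) (s, out, t) = (s, map bit_symbol (G w ?e) @ out, t1)"
      "t1 \<le> t + poly q (length w + B)"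
      using emits_byD(2)[OF D, of d \<rho> w s B out t] a b by auto
    obtain t2 where t2: "exec w (C \<rho> d) (s, map bit_symbol (G w ?e) @ out, t1) =
        (s, map bit_symbol (F w ?e) @ map bit_symbol (G w ?e) @ out, t2)"
      "t2 \<le> t1 + poly p (length w + B)"
      using emits_byD(2)[OF C, of d \<rho> w s B "map bit_symbol (G w ?e) @ out" t1] a b by auto
    show "\<exists>t'. exec w (Seq (D \<rho> d) (C \<rho> d)) (s, out, t) =
        (s, map bit_symbol (F w ?e @ G w ?e) @ out, t') \<and> t' \<le> t + poly (p + q) (length w + B)"
      using t1 t2 by auto
  qed
  then show ?thesis by (auto simp: emits_def)
qed

lemma emits_bit: "emits (\<lambda>w e. [b])"
proof -
  have "emits_by (\<lambda>\<rho> d. Out (bit_symbol b)) 1 (\<lambda>w e. [b])"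
    by (simp add: emits_by_def local_com_def bit_symbol_def)
  then show ?thesis by (auto simp: emits_def)
qed

lemma emits_let:
  assumes G: "emits G" and f: "polytime f"
  shows "emits (\<lambda>w e. G w (case_nat (f w e) e))"
proof -
  obtain C p where C: "computes C p f" using f by (auto simp: polytime_def)
  obtain D q where D: "emits_by D q G" using G by (auto simp: emits_def)
  let ?C = "\<lambda>\<rho> d. Seq (C \<rho> d) (Seq (D (case_nat d \<rho>) (d + 1)) (Loop d Skip))"
  let ?p = "p + pcompose q ([:0, 1:] + p) + p + p + p + [:1:]"
  have "emits_by ?C ?p (\<lambda>w e. G w (case_nat (f w e) e))"
    unfolding emits_by_def
  proof (intro conjI allI impI)
    fix \<rho> :: "nat \<Rightarrow> nat" and d :: nat assume a: "2 \<le> d" "\<forall>i. \<rho> i < d"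
    have ext: "case_nat d \<rho> i < d + 1" for i using a by (auto simp: less_SucI split: nat.split)
    have d1: "2 \<le> d + 1" using a by simp
    have rext: "range (case_nat d \<rho>) = insert d (range \<rho>)"
      by (auto simp: image_iff split: nat.splits)
    show "local_com \<rho> d (?C \<rho> d)"
      using emits_byD(1)[of D q G "d + 1" "case_nat d \<rho>", OF D d1 ext] computesD(1)[OF C, of d \<rho>] a
      unfolding local_com_def rext by auto
    fix w s out t B assume b: "ready w d s" "\<forall>i. s (\<rho> i) \<le> B"
    let ?e = "\<lambda>i. s (\<rho> i)" and ?X = "length w + B"
    let ?v = "f w ?e"
    have v: "?v \<le> poly p ?X" using C b boundedD[of p f ?e] by (auto simp: computes_def)
    obtain t1 where t1: "exec w (C \<rho> d) (s, out, t) = (s(d := ?v), out, t1)" "t1 \<le> t + poly p ?X"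
      using computesD(2)[OF C, of d \<rho> w s B out t] a b by auto
    have \<rho>d: "\<rho> i \<noteq> d" for i using a(2)[rule_format, of i] by simp
    have env: "(\<lambda>i. (s(d := ?v)) (case_nat d \<rho> i)) = case_nat ?v ?e"
      using \<rho>d by (auto simp: fun_eq_iff split: nat.split)
    have rd: "ready w (d + 1) (s(d := ?v))" using b a by (auto simp: ready_def)
    have B': "(s(d := ?v)) (case_nat d \<rho> i) \<le> B + poly p ?X" for i
      using v b \<rho>d by (auto split: nat.split intro: trans_le_add1)
    obtain t2 where t2: "exec w (D (case_nat d \<rho>) (d + 1)) (s(d := ?v), out, t1) =
        (s(d := ?v), map bit_symbol (G w (case_nat ?v ?e)) @ out, t2)"
      "t2 \<le> t1 + poly q (length w + (B + poly p ?X))"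
      using emits_byD(2)[of D q G "d + 1" "case_nat d \<rho>", OF D d1 ext rd B', of out t1] unfolding env by blast
    have "s d = 0" using b by (simp add: ready_def)
    then have "exec w (?C \<rho> d) (s, out, t) = (s, map bit_symbol (G w (case_nat ?v ?e)) @ out, t2 + 1 + 3 * ?v)"
      unfolding exec.simps(4) t1(1) t2(1) by (auto simp: exec_clear fun_eq_iff)
    then show "\<exists>t'. exec w (?C \<rho> d) (s, out, t) =
        (s, map bit_symbol (G w (case_nat ?v ?e)) @ out, t') \<and> t' \<le> t + poly ?p ?X"
      using v t1(2) t2(2) by (auto simp: poly_pcompose add.assoc)
  qed
  then show ?thesis by (auto simp: emits_def)
qed

text \<open>The piece emitted in the last round ends up leftmost, hence the reversed range.
  Reflecting the index restores the natural order in \<open>emits_concat_map\<close>.\<close>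

lemma emits_loop:
  assumes n: "polytime n" and F: "emits (\<lambda>w e. F w (e 0) (\<lambda>i. e (Suc i)))"
  shows "emits (\<lambda>w e. concat (map (\<lambda>i. F w i e) (rev [0..<n w e])))"
proof -
  obtain C p where C: "computes C p n" using n by (auto simp: polytime_def)
  obtain D q where D: "emits_by D q (\<lambda>w e. F w (e 0) (\<lambda>i. e (Suc i)))" using F by (auto simp: emits_def)
  let ?body = "\<lambda>\<rho> d. Seq (D (case_nat (d + 1) \<rho>) (d + 2)) (Inc (d + 1))"
  let ?C = "\<lambda>\<rho> d. Seq (C \<rho> d) (Seq (Loop d (?body \<rho> d)) (Loop (d + 1) Skip))"
  define pb where "pb = pcompose q ([:0, 1:] + p) + [:4:]"
  let ?p = "p + p * pb + p + p + p + [:3:]"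
  have "emits_by ?C ?p (\<lambda>w e. concat (map (\<lambda>i. F w i e) (rev [0..<n w e])))"
    unfolding emits_by_def
  proof (intro conjI allI impI)
    fix \<rho> :: "nat \<Rightarrow> nat" and d :: nat assume a: "2 \<le> d" "\<forall>i. \<rho> i < d"
    have ext: "case_nat (d + 1) \<rho> i < d + 2" for i
      using a(2)[rule_format, of "i - 1"] by (auto split: nat.split)
    have d1: "2 \<le> d + 2" using a by simp
    have rext: "range (case_nat (d + 1) \<rho>) = insert (d + 1) (range \<rho>)"
      by (auto simp: image_iff split: nat.splits)
    have \<rho>d: "\<rho> i \<noteq> d" "\<rho> i \<noteq> Suc d" for i using a(2)[rule_format, of i] by auto
    show "local_com \<rho> d (?C \<rho> d)"
      using emits_byD(1)[of D q _ "d + 2" "case_nat (d + 1) \<rho>", OF D d1 ext] computesD(1)[OF C, of d \<rho>] a \<rho>d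
      unfolding local_com_def rext by (auto simp: less_Suc_eq)
    fix w s out t B assume b: "ready w d s" "\<forall>i. s (\<rho> i) \<le> B"
    let ?e = "\<lambda>i. s (\<rho> i)" and ?X = "length w + B"
    define N where "N = n w ?e"
    have N: "N \<le> poly p ?X" using C b boundedD[of p n ?e] by (auto simp: computes_def N_def)
    obtain t1 where t1: "exec w (C \<rho> d) (s, out, t) = (s(d := N), out, t1)" "t1 \<le> t + poly p ?X"
      using computesD(2)[OF C, of d \<rho> w s B out t] a b unfolding N_def by auto
    let ?S = "\<lambda>k. s(d := k, d + 1 := N - k)"
    let ?O = "\<lambda>k. map bit_symbol (concat (map (\<lambda>i. F w i ?e) (rev [0..<N - k]))) @ out"
    have body: "\<exists>t''. exec w (?body \<rho> d) ((?S (Suc k))(d := k), ?O (Suc k), t') = (?S k, ?O k, t'') \<and>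
        t'' + 3 \<le> t' + poly pb ?X" if k: "k < N" for k t'
    proof -
      let ?i = "N - Suc k"
      let ?s = "s(d := k, d + 1 := ?i)"
      have i: "N - k = Suc ?i" using k by simp
      have s1: "(?S (Suc k))(d := k) = ?s" by (simp add: fun_upd_twist)
      have rd: "ready w (d + 2) ?s" using b a by (auto simp: ready_def)
      have val: "F w (?s (case_nat (d + 1) \<rho> 0)) (\<lambda>j. ?s (case_nat (d + 1) \<rho> (Suc j))) = F w ?i ?e"
        using \<rho>d by simp
      have B': "?s (case_nat (d + 1) \<rho> j) \<le> B + poly p ?X" for j
        using N b \<rho>d by (auto split: nat.split intro: trans_le_add1)
      obtain u where u: "exec w (D (case_nat (d + 1) \<rho>) (d + 2)) (?s, ?O (Suc k), t') =
          (?s, map bit_symbol (F w ?i ?e) @ ?O (Suc k), u)" "u \<le> t' + poly q (length w + (B + poly p ?X))"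
        using emits_byD(2)[of D q _ "d + 2" "case_nat (d + 1) \<rho>", OF D d1 ext rd B', of "?O (Suc k)" t']
        unfolding val by blast
      have O: "map bit_symbol (F w ?i ?e) @ ?O (Suc k) = ?O k" unfolding i by simp
      have "exec w (?body \<rho> d) (?s, ?O (Suc k), t') = (?S k, ?O k, Suc u)"
        unfolding exec.simps(4) u(1) O unfolding i by (auto simp: fun_eq_iff)
      then show ?thesis using u(2) unfolding s1 by (auto simp: pb_def poly_pcompose add.assoc)
    qed
    have s2: "s(d := N) = ?S N" using b by (auto simp: fun_eq_iff ready_def)
    have t1': "exec w (C \<rho> d) (s, out, t) = (?S N, ?O N, t1)"
      unfolding t1(1) prod.inject by (intro conjI refl s2) simp
    define L where "L = (\<lambda>k (s, out, t). exec w (?body \<rho> d) (s(d := k), out, t + 3))"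
    have "\<exists>u. down N L (?S N, ?O N, t1 + 1) = (?S 0, ?O 0, u) \<and> u \<le> t1 + 1 + (N - 0) * poly pb ?X"
    proof (rule down_invariant[where P = "\<lambda>k x. \<exists>u. x = (?S k, ?O k, u) \<and> u \<le> t1 + 1 + (N - k) * poly pb ?X"])
      fix k x assume k: "k < N" "\<exists>u. x = (?S (Suc k), ?O (Suc k), u) \<and> u \<le> t1 + 1 + (N - Suc k) * poly pb ?X"
      then obtain u where u: "x = (?S (Suc k), ?O (Suc k), u)" "u \<le> t1 + 1 + (N - Suc k) * poly pb ?X" by blast
      obtain u' where u': "exec w (?body \<rho> d) ((?S (Suc k))(d := k), ?O (Suc k), u + 3) = (?S k, ?O k, u')"
        "u' + 3 \<le> u + 3 + poly pb ?X"
        using body[of k "u + 3"] k by blast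
      have "N - k = Suc (N - Suc k)" using k by simp
      then have "u' \<le> t1 + 1 + (N - k) * poly pb ?X" using u(2) u'(2) by simp
      then show "\<exists>u. L k x = (?S k, ?O k, u) \<and> u \<le> t1 + 1 + (N - k) * poly pb ?X"
        by (intro exI[of _ u']) (simp only: u(1) L_def prod.case u' simp_thms)
    qed auto
    moreover have "(?S N) d = N" by simp
    ultimately obtain t3 where t3: "exec w (Loop d (?body \<rho> d)) (?S N, ?O N, t1) = (?S 0, ?O 0, t3)"
      "t3 \<le> t1 + 1 + N * poly pb ?X"
      unfolding exec.simps(6) prod.case L_def[symmetric] by (metis diff_zero)
    have s4: "s d = 0" "s (d + 1) = 0" using b by (auto simp: ready_def)
    have "exec w (?C \<rho> d) (s, out, t) = (s, ?O 0, t3 + 1 + 3 * N)"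
      unfolding exec.simps(4) t1' t3(1) exec_clear using s4 by (auto simp: fun_eq_iff)
    moreover have "t3 + 1 + 3 * N \<le> t + poly ?p ?X"
    proof -
      have "N * poly pb ?X \<le> poly p ?X * poly pb ?X" using N by simp
      moreover have "poly ?p ?X = poly p ?X + poly p ?X * poly pb ?X + poly p ?X + poly p ?X + poly p ?X + 3" by simp
      ultimately show ?thesis using t1(2) t3(2) N by linarith
    qed
    ultimately show "\<exists>t'. exec w (?C \<rho> d) (s, out, t) =
        (s, map bit_symbol (concat (map (\<lambda>i. F w i ?e) (rev [0..<n w ?e]))) @ out, t') \<and>
        t' \<le> t + poly ?p ?X"
      unfolding N_def by (metis diff_zero)
  qed
  then show ?thesis by (auto simp: emits_def)
qed

lemma emits_concat_map [emits_intros]: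
  assumes n: "polytime n" and F: "emits (\<lambda>w e. F w (e 0) (\<lambda>i. e (Suc i)))"
  shows "emits (\<lambda>w e. concat (map (\<lambda>i. F w i e) [0..<n w e]))"
proof -
  have "polytime (\<lambda>w e. n w (\<lambda>i. e (Suc i)) - Suc (e 0))"
    by (intro polytime_diff polytime_Suc polytime_var polytime_reindex[OF n])
  from emits_let[OF emits_reindex[OF F, of "case_nat 0 (\<lambda>i. Suc (Suc i))"] this]
  have G: "emits (\<lambda>w e. F w (n w (\<lambda>i. e (Suc i)) - Suc (e 0)) (\<lambda>i. e (Suc i)))"
    by (simp only: nat.case)
  have *: "emits (\<lambda>w e. concat (map (\<lambda>i. F w (n w e - Suc i) e) (rev [0..<n w e])))"
    by (rule emits_loop[OF n, of "\<lambda>w i e. F w (n w e - Suc i) e"]) (rule G)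
  have "map (\<lambda>i. F w (n w e - Suc i) e) (rev [0..<n w e]) = map (\<lambda>i. F w i e) [0..<n w e]" for w e
    by (rule nth_equalityI) (auto simp: rev_nth)
  with * show ?thesis by (simp only:)
qed

lemma emits_guard:
  assumes "polytime (\<lambda>w e. of_bool (P w e))" "emits F"
  shows "emits (\<lambda>w e. if P w e then F w e else [])"
proof -
  \<comment> \<open>A range of length 0 or 1 turns the loop into a conditional.\<close>
  have *: "emits (\<lambda>w e. concat (map (\<lambda>i. F w e) [0..<of_bool (P w e)]))"
    by (rule emits_concat_map[OF assms(1)]) (rule emits_reindex[OF assms(2)])
  have **: "concat (map (\<lambda>i. x) [0..<of_bool Q]) = (if Q then x else [])" for x :: "bool list" and Q
    by simp
  show ?thesis using * unfolding ** .
qed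

lemma emits_if [emits_intros]:
  assumes "polytime (\<lambda>w e. of_bool (P w e))" "emits F" "emits G"
  shows "emits (\<lambda>w e. if P w e then F w e else G w e)"
proof -
  have *: "emits (\<lambda>w e. (if P w e then F w e else []) @ (if \<not> P w e then G w e else []))"
    by (intro emits_append emits_guard polytime_not assms)
  have **: "(if P w e then F w e else []) @ (if \<not> P w e then G w e else []) =
    (if P w e then F w e else G w e)" for w e by simp
  show ?thesis using * unfolding ** .
qed

lemma emits_Cons [emits_intros]:
  assumes "polytime (\<lambda>w e. of_bool (P w e))" "emits F"
  shows "emits (\<lambda>w e. P w e # F w e)"
proof -
  have *: "emits (\<lambda>w e. (if P w e then [True] else [False]) @ F w e)"
    by (intro emits_append emits_if assms emits_bit)
  have **: "(if P w e then [True] else [False]) @ F w e = P w e # F w e" for w e by simp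
  show ?thesis using * unfolding ** .
qed

lemma binary_digits:
  shows "binary n = map (\<lambda>i. odd (n div 2 ^ i)) [0..<length (binary n)]"
    and "0 < n div 2 ^ i \<longleftrightarrow> i < length (binary n)" and "length (binary n) \<le> n"
proof -
  have "binary n = map (\<lambda>i. odd (n div 2 ^ i)) [0..<length (binary n)] \<and>
    (\<forall>i. 0 < n div 2 ^ i \<longleftrightarrow> i < length (binary n)) \<and> length (binary n) \<le> n"
  proof (induction n rule: less_induct)
    case (less n)
    show ?case
    proof (cases "n = 0")
      case False
      let ?b = "binary (n div 2)"
      have b: "binary n = odd n # ?b" using False by (simp add: binary.simps[of n])
      have IH: "?b = map (\<lambda>i. odd (n div 2 div 2 ^ i)) [0..<length ?b]"
        "\<forall>i. 0 < n div 2 div 2 ^ i \<longleftrightarrow> i < length ?b" "length ?b \<le> n div 2"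
        using less[of "n div 2"] False by auto
      have "binary n = map (\<lambda>i. odd (n div 2 ^ i)) [0..<length (binary n)]"
      proof (rule nth_equalityI)
        fix i assume "i < length (binary n)"
        then show "binary n ! i = map (\<lambda>i. odd (n div 2 ^ i)) [0..<length (binary n)] ! i"
          using IH(1) unfolding b
          by (cases i) (auto simp: div_mult2_eq simp del: upt_Suc, (metis (no_types, lifting) length_map length_upt minus_nat.diff_0 nth_map_upt add_0)+)
      qed simp
      moreover have "0 < n div 2 ^ i \<longleftrightarrow> i < length (binary n)" for i
      proof (cases i)
        case (Suc j)
        then show ?thesis using IH(2) by (simp add: b div_mult2_eq)
      qed (use False b in simp)
      moreover have "length (binary n) \<le> n" using IH(3) False by (simp add: b)
      ultimately show ?thesis by blast
    qed (simp add: binary.simps)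
  qed
  then show "binary n = map (\<lambda>i. odd (n div 2 ^ i)) [0..<length (binary n)]"
    "0 < n div 2 ^ i \<longleftrightarrow> i < length (binary n)" "length (binary n) \<le> n" by blast+
qed

text \<open>Powers of 2 are too large for unary registers; repeated halving stays at or below
  \<open>n\<close>, and the number of digits is a bounded count.\<close>

lemma binary_conv:
  "binary n = map (\<lambda>i. odd (rec_nat n (\<lambda>_ x. x div 2) i))
     [0..<\<Sum>i<n. of_bool (0 < rec_nat n (\<lambda>_ x. x div 2) i)]"
proof -
  have H: "rec_nat n (\<lambda>_ x. x div 2) i = n div 2 ^ i" for n i :: nat
    by (induction i) (auto simp: div_mult2_eq[symmetric] mult.commute)
  note 1 = binary_digits[of n]
  have "(\<Sum>i<n. of_bool (0 < n div 2 ^ i)) = (\<Sum>i<n. of_bool (i < length (binary n)) :: nat)"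
    by (intro sum.cong refl arg_cong[of _ _ of_bool] 1(2))
  also have "\<dots> = card ({..<n} \<inter> {i. i < length (binary n)})"
    by (subst sum_of_bool_eq) auto
  also have "{..<n} \<inter> {i. i < length (binary n)} = {..<length (binary n)}" using 1(3) by auto
  finally show ?thesis unfolding H using 1(1) by simp
qed

lemma emits_encode_nat [emits_intros]:
  assumes "polytime f"
  shows "emits (\<lambda>w e. encode_nat (f w e))"
proof -
  have H: "polytime (\<lambda>w e. rec_nat (e 0) (\<lambda>_ x. x div 2) (e (Suc 0)))"
  proof (rule polytime_rec[where q = "[:0, 1:]"])
    fix w :: "nat list" and e :: "nat \<Rightarrow> nat" and B i :: nat
    assume e: "\<And>j. e j \<le> B"
    have "rec_nat (e 0) (\<lambda>_ x. x div 2) i \<le> e 0" by (induction i) auto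
    then show "rec_nat (e 0) (\<lambda>_ x. x div 2) i \<le> poly [:0, 1:] (length w + B)"
      using e[of 0] by simp
  qed (intro polytime_intros)+
  note H' = polytime_subst2[OF H]
  have "emits (\<lambda>w e. concat (map (\<lambda>i. [True, odd (rec_nat (e 0) (\<lambda>_ x. x div 2) i)])
     [0..<\<Sum>i<e 0. of_bool (0 < rec_nat (e 0) (\<lambda>_ x. x div 2) i)]) @ [False])"
    by (intro emits_intros polytime_intros H')
  moreover have "concat (map (\<lambda>i. [True, odd (rec_nat n (\<lambda>_ x. x div 2) i)])
     [0..<\<Sum>i<n. of_bool (0 < rec_nat n (\<lambda>_ x. x div 2) i)]) @ [False] = encode_nat n" for n
    unfolding encode_nat_def encode_list_def by (simp add: binary_conv[of n] comp_def)
  ultimately have "emits (\<lambda>w e. encode_nat (e 0))" by simp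
  from emits_let[OF this assms] show ?thesis by simp
qed

theorem emits_imp_computable:
  assumes "emits F"
  shows "poly_time_computable (\<lambda>w. F (map bit_symbol w) (\<lambda>_. 0))"
proof -
  obtain C p where C: "emits_by C p F" using assms by (auto simp: emits_def)
  \<comment> \<open>At the top level no variable is bound: all of them are read from register 0,
    which holds 0.\<close>
  have ex: "\<exists>s out t'. exec w (C (\<lambda>_. 0) 2) (\<lambda>r. if r = 1 then length w else 0, [], t) = (s, out, t') \<and>
      t' \<le> t + poly p (length w) \<and> s 2 = 0 \<and> out = map bit_symbol (F w (\<lambda>_. 0))" for w t
    using emits_byD(2)[OF C, of 2 "\<lambda>_. 0" w "\<lambda>r. if r = 1 then length w else 0" 0 "[]" t]
    by (auto simp: ready_def)
  have wf: "wf_com (C (\<lambda>_. 0) 2)" using emits_byD(1)[OF C, of 2 "\<lambda>_. 0"] by (simp add: local_com_def)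
  obtain M q where M: "wf_tm M" "\<And>w. \<forall>a\<in>set w. a \<noteq> blank \<and> a < 4 \<Longrightarrow>
    \<exists>t\<le>poly (q :: nat poly) (length w).
      fst (config_after M w t) = (if (0 :: nat) = 0 then reject_state M else accept_state M) \<and>
      has_output (config_after M w t) (map bit_symbol (F w (\<lambda>_. 0)))"
    using program_machine[OF wf, where p = p and f = "\<lambda>_. 0" and g = "\<lambda>w. map bit_symbol (F w (\<lambda>_. 0))", OF ex]
    by blast
  have "\<exists>t\<le>poly q (length w). halting_state M (fst (config_after M (map bit_symbol w) t)) \<and>
     has_output (config_after M (map bit_symbol w) t) (map bit_symbol (F (map bit_symbol w) (\<lambda>_. 0)))" for w
  proof -
    have "\<forall>a\<in>set (map bit_symbol w). a \<noteq> blank \<and> a < 4"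
      by (auto simp: bit_symbol_def blank_def)
    from M(2)[OF this] show ?thesis by (auto simp: halting_state_def)
  qed
  then show ?thesis unfolding poly_time_computable_def using M(1) by blast
qed

theorem polytime_decidable:
  assumes "polytime f"
  shows "\<exists>M p. wf_tm M \<and> (\<forall>w. (\<forall>a\<in>set w. a \<noteq> blank \<and> a < 4) \<longrightarrow>
    (\<exists>t\<le>poly (p :: nat poly) (length w).
      fst (config_after M w t) = (if f w (\<lambda>_. 0) = 0 then reject_state M else accept_state M)))"
proof -
  obtain C p where C: "computes C p f" using assms by (auto simp: polytime_def)
  have ex: "\<exists>s out t'. exec w (C (\<lambda>_. 0) 2) (\<lambda>r. if r = 1 then length w else 0, [], t) = (s, out, t') \<and>
      t' \<le> t + poly p (length w) \<and> s 2 = f w (\<lambda>_. 0) \<and> out = []" for w t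
    using computesD(2)[OF C, of 2 "\<lambda>_. 0" w "\<lambda>r. if r = 1 then length w else 0" 0 "[]" t]
    by (auto simp: ready_def)
  have wf: "wf_com (C (\<lambda>_. 0) 2)" using computesD(1)[OF C, of 2 "\<lambda>_. 0"] by (simp add: local_com_def)
  show ?thesis
    by (rule program_machine[OF wf, where p = p and f = "\<lambda>w. f w (\<lambda>_. 0)" and g = "\<lambda>_. []", OF ex]) blast
qed

section \<open>Hitting sets of half the universe and one-sided planarity\<close>

subsection \<open>Counting crossings\<close>

lemma strict_order_nat:
  "strictly_below {(a, b). a \<le> b \<and> b < n} x y \<longleftrightarrow> x < y \<and> y < (n :: nat)"
  by (auto simp: strictly_below_def)

lemma linear_order_nat: "linear_order_on {..<n :: nat} {(a, b). a \<le> b \<and> b < n}"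
  by (auto simp: order_on_defs refl_on_def trans_def antisym_def total_on_def)

text \<open>Group the crossing edges by their end \<open>v\<close> in \<open>Y\<close>: if
  \<open>v\<close> precedes \<open>u\<close>, exactly the edges of \<open>v\<close> to the right of
  \<open>x\<close> cross, otherwise exactly those to the left. So only the side of \<open>v\<close>
  relative to \<open>u\<close> matters, and each \<open>v\<close> contributes a one-sided
  degree.\<close>

lemma crossing_count:
  fixes nx ny :: nat
  assumes nbr: "\<And>v. v < ny \<Longrightarrow> A v \<subseteq> {..<nx}"
    and E: "E = {(x, nx + v) | x v. v < ny \<and> x \<in> A v}"
    and r: "linear_order_on {nx..<nx + ny} r" and u: "u < ny" and x: "x < nx"
  shows "card {e' \<in> E. edges_cross {(a, b). a \<le> b \<and> b < nx} r (x, nx + u) e'} =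
    (\<Sum>v \<in> {..<ny} - {u}. if strictly_below r (nx + v) (nx + u)
       then card {x' \<in> A v. x < x'} else card {x' \<in> A v. x' < x})"
proof -
  let ?B = "\<lambda>v. if v = u then {} else if strictly_below r (nx + v) (nx + u)
       then {x' \<in> A v. x < x'} else {x' \<in> A v. x' < x}"
  have tot: "strictly_below r (nx + u) (nx + v) \<longleftrightarrow> \<not> strictly_below r (nx + v) (nx + u)"
    if "v < ny" "v \<noteq> u" for v
  proof -
    have "total_on {nx..<nx + ny} r" "antisym r" using r by (auto simp: order_on_defs)
    moreover have "nx + u \<in> {nx..<nx + ny}" "nx + v \<in> {nx..<nx + ny}" "nx + u \<noteq> nx + v"
      using u that by auto
    ultimately have "(nx + u, nx + v) \<in> r \<or> (nx + v, nx + u) \<in> r"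
      "\<not> ((nx + u, nx + v) \<in> r \<and> (nx + v, nx + u) \<in> r)"
      unfolding total_on_def antisym_def by blast+
    then show ?thesis using that by (auto simp: strictly_below_def)
  qed
  have irr: "\<not> strictly_below r a a" for a by (simp add: strictly_below_def)
  have fin: "finite (A v)" if "v < ny" for v using nbr[OF that] finite_subset by blast
  have "{e' \<in> E. edges_cross {(a, b). a \<le> b \<and> b < nx} r (x, nx + u) e'} =
      (\<lambda>(v, x'). (x', nx + v)) ` (SIGMA v:{..<ny}. ?B v)"
  proof (intro set_eqI iffI)
    fix z assume "z \<in> {e' \<in> E. edges_cross {(a, b). a \<le> b \<and> b < nx} r (x, nx + u) e'}"
    then obtain x' v where z: "z = (x', nx + v)" "v < ny" "x' \<in> A v"
      and c: "edges_cross {(a, b). a \<le> b \<and> b < nx} r (x, nx + u) (x', nx + v)" using E by auto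
    have "x' < nx" using z nbr by blast
    then have "x' \<in> ?B v"
      using c z irr tot[of v] x by (cases "v = u") (auto simp: strict_order_nat)
    then show "z \<in> (\<lambda>(v, x'). (x', nx + v)) ` (SIGMA v:{..<ny}. ?B v)" using z by force
  next
    fix z assume "z \<in> (\<lambda>(v, x'). (x', nx + v)) ` (SIGMA v:{..<ny}. ?B v)"
    then obtain v x' where z: "z = (x', nx + v)" "v < ny" "x' \<in> ?B v" by auto
    have "x' \<in> A v" "v \<noteq> u" using z(3) by (auto split: if_splits)
    then have "x' < nx" using z nbr by blast
    then show "z \<in> {e' \<in> E. edges_cross {(a, b). a \<le> b \<and> b < nx} r (x, nx + u) e'}"
      using z E tot[OF z(2) \<open>v \<noteq> u\<close>] x \<open>x' \<in> A v\<close> by (auto simp: strict_order_nat split: if_splits)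
  qed
  moreover have "inj_on (\<lambda>(v, x'). (x', nx + v)) (SIGMA v:{..<ny}. ?B v)" by (auto simp: inj_on_def)
  ultimately have "card {e' \<in> E. edges_cross {(a, b). a \<le> b \<and> b < nx} r (x, nx + u) e'} =
      card (SIGMA v:{..<ny}. ?B v)" by (simp add: card_image)
  also have "\<dots> = (\<Sum>v<ny. card (?B v))" by (rule card_SigmaI) (use fin in auto)
  also have "\<dots> = (\<Sum>v \<in> {..<ny} - {u}. card (?B v))"
    using u by (subst sum.remove[of _ u]) auto
  also have "\<dots> = (\<Sum>v \<in> {..<ny} - {u}. if strictly_below r (nx + v) (nx + u)
       then card {x' \<in> A v. x < x'} else card {x' \<in> A v. x' < x})"
    by (intro sum.cong) auto
  finally show ?thesis .
qed

text \<open>For offsets below \<open>w\<close> the numbers \<open>z + j * w + p\<close> are ordered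
  lexicographically by \<open>(j, p)\<close>. Hence each side of a point consists of whole blocks
  and a part of its own block.\<close>

lemma card_block_less:
  fixes D :: "nat \<Rightarrow> nat set"
  assumes "\<And>j. j < m \<Longrightarrow> D j \<subseteq> {..<w}" "j < m" "t < w"
  shows "card {x. (\<exists>j'<m. \<exists>p\<in>D j'. x = z + j' * w + p) \<and> x < z + j * w + t} =
      (\<Sum>j'<j. card (D j')) + card {p \<in> D j. p < t}"
    and "card {x. (\<exists>j'<m. \<exists>p\<in>D j'. x = z + j' * w + p) \<and> z + j * w + t < x} =
      (\<Sum>j'\<in>{j<..<m}. card (D j')) + card {p \<in> D j. t < p}"
    and "card {x. \<exists>j'<m. \<exists>p\<in>D j'. x = z + j' * w + p} = (\<Sum>j'<m. card (D j'))"
proof -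
  have lex: "j1 * w + p1 < j2 * w + p2 \<longleftrightarrow> j1 < j2 \<or> j1 = j2 \<and> p1 < p2" if "p1 < w" "p2 < w" for j1 j2 p1 p2
  proof -
    have 1: "a * w + p < b * w + q" if "a < b" "p < w" for a b p q
    proof -
      have "a * w + p < Suc a * w" using that by simp
      also have "\<dots> \<le> b * w" using that by (intro mult_right_mono) auto
      finally show ?thesis by simp
    qed
    show ?thesis using 1[of j1 j2 p1 p2] 1[of j2 j1 p2 p1] that by (cases j1 j2 rule: linorder_cases) auto
  qed
  let ?f = "\<lambda>(j', p). z + j' * w + p"
  have inj: "inj_on ?f (SIGMA j':{..<m}. D j')"
  proof (rule inj_onI)
    fix a b assume a: "a \<in> (SIGMA j':{..<m}. D j')" "b \<in> (SIGMA j':{..<m}. D j')" "?f a = ?f b"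
    obtain j1 p1 j2 p2 where ab: "a = (j1, p1)" "b = (j2, p2)" by fastforce
    have "p1 < w" "p2 < w" using a ab assms(1) by auto
    then show "a = b" using a lex[of p1 p2 j1 j2] lex[of p2 p1 j2 j1] unfolding ab by auto
  qed
  have fin: "finite (D j')" if "j' < m" for j' using assms(1)[OF that] finite_subset by blast
  have cnt: "card {x. (\<exists>j'<m. \<exists>p\<in>D j'. x = z + j' * w + p) \<and> P x} =
      (\<Sum>j'<m. card {p \<in> D j'. P (z + j' * w + p)})" for P
  proof -
    have "{x. (\<exists>j'<m. \<exists>p\<in>D j'. x = z + j' * w + p) \<and> P x} = ?f ` (SIGMA j':{..<m}. {p \<in> D j'. P (z + j' * w + p)})"
      by force
    moreover have "inj_on ?f (SIGMA j':{..<m}. {p \<in> D j'. P (z + j' * w + p)})"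
      by (rule inj_on_subset[OF inj]) auto
    ultimately have "card {x. (\<exists>j'<m. \<exists>p\<in>D j'. x = z + j' * w + p) \<and> P x} =
       card (SIGMA j':{..<m}. {p \<in> D j'. P (z + j' * w + p)})" by (simp add: card_image)
    also have "\<dots> = (\<Sum>j'<m. card {p \<in> D j'. P (z + j' * w + p)})"
      by (rule card_SigmaI) (use fin in auto)
    finally show ?thesis .
  qed
  have split: "(\<Sum>j'<m. h j') = (\<Sum>j'<j. h j') + h j + (\<Sum>j'\<in>{j<..<m}. h j')" for h :: "nat \<Rightarrow> nat"
  proof -
    have "{..<m} = ({..<j} \<union> {j}) \<union> {j<..<m}" "({..<j} \<union> {j}) \<inter> {j<..<m} = {}" using assms(2) by auto
    then show ?thesis by (simp add: sum.union_disjoint)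
  qed
  have c1: "{p \<in> D j'. z + j' * w + p < z + j * w + t} = (if j' < j then D j' else if j' = j then {p \<in> D j. p < t} else {})"
    if "j' < m" for j'
  proof -
    have "z + j' * w + p < z + j * w + t \<longleftrightarrow> j' < j \<or> j' = j \<and> p < t" if "p \<in> D j'" for p
      using lex[of p t j' j] assms(1)[OF \<open>j' < m\<close>] assms(3) that by auto
    then show ?thesis by auto
  qed
  have c2: "{p \<in> D j'. z + j * w + t < z + j' * w + p} = (if j < j' then D j' else if j' = j then {p \<in> D j. t < p} else {})"
    if "j' < m" for j'
  proof -
    have "z + j * w + t < z + j' * w + p \<longleftrightarrow> j < j' \<or> j' = j \<and> t < p" if "p \<in> D j'" for p
      using lex[of t p j j'] assms(1)[OF \<open>j' < m\<close>] assms(3) that by auto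
    then show ?thesis by auto
  qed
  have "card {x. (\<exists>j'<m. \<exists>p\<in>D j'. x = z + j' * w + p) \<and> x < z + j * w + t} =
      (\<Sum>j'<m. card (if j' < j then D j' else if j' = j then {p \<in> D j. p < t} else {}))"
    unfolding cnt by (intro sum.cong refl arg_cong[of _ _ card] c1) simp
  also have "\<dots> = (\<Sum>j'<j. card (D j')) + card {p \<in> D j. p < t}"
    unfolding split by simp
  finally show "card {x. (\<exists>j'<m. \<exists>p\<in>D j'. x = z + j' * w + p) \<and> x < z + j * w + t} =
      (\<Sum>j'<j. card (D j')) + card {p \<in> D j. p < t}" .
  have "card {x. (\<exists>j'<m. \<exists>p\<in>D j'. x = z + j' * w + p) \<and> z + j * w + t < x} =
      (\<Sum>j'<m. card (if j < j' then D j' else if j' = j then {p \<in> D j. t < p} else {}))"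
    unfolding cnt by (intro sum.cong refl arg_cong[of _ _ card] c2) simp
  also have "\<dots> = (\<Sum>j'\<in>{j<..<m}. card (D j')) + card {p \<in> D j. t < p}"
    unfolding split by simp
  finally show "card {x. (\<exists>j'<m. \<exists>p\<in>D j'. x = z + j' * w + p) \<and> z + j * w + t < x} =
      (\<Sum>j'\<in>{j<..<m}. card (D j')) + card {p \<in> D j. t < p}" .
  show "card {x. \<exists>j'<m. \<exists>p\<in>D j'. x = z + j' * w + p} = (\<Sum>j'<m. card (D j'))"
    using cnt[of "\<lambda>_. True"] by simp
qed

subsection \<open>The gadget\<close>

text \<open>
  The universe is \<open>{..<2 * N}\<close>; the \<open>j\<close>-th of \<open>m\<close> sets is \<open>{lit j s | s. s < W}\<close>, where
  repetitions are allowed.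
\<close>

locale gadget =
  fixes N m W :: nat and lit :: "nat \<Rightarrow> nat \<Rightarrow> nat"
begin

definition item_edges :: nat where "item_edges = 2 * N * (2 * W * m)"
text \<open>If \<open>N\<close> items precede the pivot and \<open>h\<close> of the \<open>W\<close>
  places of set \<open>j\<close> hold one of them, the edge from the pivot to block \<open>j\<close>
  crosses \<open>2 * W * m * N + W - 2 * h\<close> item edges. The bound is the value for
  \<open>h = 1\<close>.\<close>

definition bound :: nat where "bound = 2 * W * m * N + W - 2"
text \<open>With the guards exchanged, the leftmost edge of guard 0 has at least
  \<open>gc + gd + 1 + 2 * ge + m\<close> crossings; this exceeds \<open>crossings\<close> as soon
  as \<open>ge > item_edges\<close>.\<close>

definition ge :: nat where "ge = item_edges + 1"
text \<open>Large enough that two guards on the same side of the pivot give one of its outermost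
  edges more than \<open>2 * gc + bound\<close> crossings.\<close>

definition gd :: nat where "gd = ge + bound"
text \<open>Determined by the edges of an item placed outside the guards: the estimate
  \<open>(1 + gd) + gc + (ge + m) + item_edges\<close> for their crossings comes out as exactly
  \<open>crossings\<close>.\<close>

definition gc :: nat where "gc = 2 * ge + m + item_edges + 1"
definition crossings :: nat where "crossings = 2 * gc + bound"
definition half_width :: nat where "half_width = 2 * (2 * N * W)"
definition width :: nat where "width = half_width + 1 + 2 * N * W"
definition center :: nat where "center = 1 + ge + gd + gc"
definition center_end :: nat where "center_end = center + m * width"
definition nX :: nat where "nX = center_end + gc + gd + ge + 1"
definition nY :: nat where "nY = 3 + 2 * N"

text \<open>
  Vertex 2 of \<open>Y\<close> is the pivot, vertices 0 and 1 are its guards and vertex \<open>3 + i\<close> is item \<open>i\<close>.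
  From left to right, \<open>X\<close> consists of one neighbour of guard 0, \<open>ge\<close> of the pivot, \<open>gd\<close> of guard 0,
  \<open>gc\<close> of guard 1, the \<open>m\<close> blocks, and the mirror image of the outer part with the guards swapped.
  Each block has a neighbour of the pivot in the middle, and \<open>2 * W\<close> neighbours of each item.
\<close>

definition adj :: "nat \<Rightarrow> nat \<Rightarrow> bool" where
  "adj v x \<longleftrightarrow>
    (v = 0 \<and> (x = 0 \<or> (1 + ge \<le> x \<and> x < 1 + ge + gd) \<or> (center_end \<le> x \<and> x < center_end + gc))) \<or>
    (v = 1 \<and> ((1 + ge + gd \<le> x \<and> x < center) \<or> (center_end + gc \<le> x \<and> x < center_end + gc + gd) \<or>
       x = center_end + gc + gd + ge)) \<or>
    (v = 2 \<and> ((1 \<le> x \<and> x < 1 + ge) \<or> (\<exists>j<m. x = center + j * width + half_width) \<or>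
       (center_end + gc + gd \<le> x \<and> x < center_end + gc + gd + ge))) \<or>
    (3 \<le> v \<and> (\<exists>j<m. \<exists>s<W.
       x = center + j * width + 2 * ((v - 3) * W + s) \<or>
       (x = center + j * width + 2 * ((v - 3) * W + s) + 1 \<and> lit j s = v - 3) \<or>
       (x = center + j * width + half_width + 1 + ((v - 3) * W + s) \<and> lit j s \<noteq> v - 3)))"

definition edges :: "(nat \<times> nat) set" where
  "edges = {(x, nX + v) | x v. x < nX \<and> v < nY \<and> adj v x}"

definition order :: "nat rel" where "order = {(a, b). a \<le> b \<and> b < nX}"

definition graph_instance :: planarity_input where
  "graph_instance = ({..<nX}, {nX..<nX + nY}, edges, crossings, order)"

definition hitting :: "nat set \<Rightarrow> bool" where
  "hitting S \<longleftrightarrow> S \<subseteq> {..<2 * N} \<and> card S = N \<and> (\<forall>j<m. \<exists>s<W. lit j s \<in> S)"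

definition L :: "nat \<Rightarrow> nat \<Rightarrow> nat" where "L v x = card {x'. adj v x' \<and> x' < x}"
definition R :: "nat \<Rightarrow> nat \<Rightarrow> nat" where "R v x = card {x'. adj v x' \<and> x < x'}"

text \<open>For every place \<open>s\<close> the item has one fixed neighbour left of the middle and
  one movable neighbour, which lies left of the middle if the item occurs at \<open>s\<close> and
  right of it otherwise. The total \<open>2 * W\<close> does not depend on \<open>j\<close>, so an
  occurrence is felt only by the pivot's edge into its own block.\<close>

definition offsets :: "nat \<Rightarrow> nat \<Rightarrow> nat set" where
  "offsets i j = {2 * (i * W + s) | s. s < W} \<union> {2 * (i * W + s) + 1 | s. s < W \<and> lit j s = i} \<union>
    {half_width + 1 + (i * W + s) | s. s < W \<and> lit j s \<noteq> i}"

definition occ :: "nat \<Rightarrow> nat \<Rightarrow> nat" where "occ j i = card {s. s < W \<and> lit j s = i}"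

lemma occ_le: "occ j i \<le> W"
  using card_mono[of "{..<W}" "{s. s < W \<and> lit j s = i}"] by (auto simp: occ_def)

lemma slot_less: "i < 2 * N \<Longrightarrow> s < W \<Longrightarrow> i * W + s < 2 * N * W"
proof -
  assume "i < 2 * N" "s < W"
  then have "i * W + s < Suc i * W" by simp
  also have "\<dots> \<le> 2 * N * W" using \<open>i < 2 * N\<close> by (intro mult_right_mono) auto
  finally show ?thesis .
qed

lemma offsets_less: "i < 2 * N \<Longrightarrow> offsets i j \<subseteq> {..<width}"
  using slot_less[of i] by (fastforce simp: offsets_def width_def half_width_def)

lemma card_offsets:
  assumes "i < 2 * N"
  shows "card {p \<in> offsets i j. p < half_width} = W + occ j i"
    and "card {p \<in> offsets i j. half_width < p} = W - occ j i"
    and "card (offsets i j) = 2 * W"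
proof -
  let ?A = "(\<lambda>s. 2 * (i * W + s)) ` {..<W}" and ?B = "(\<lambda>s. 2 * (i * W + s) + 1) ` {s. s < W \<and> lit j s = i}"
  let ?C = "(\<lambda>s. half_width + 1 + (i * W + s)) ` ({..<W} - {s. s < W \<and> lit j s = i})"
  have o: "offsets i j = ?A \<union> ?B \<union> ?C" by (auto simp: offsets_def)
  have lt: "p < half_width" if "p \<in> ?A \<union> ?B" for p
    using that slot_less[OF assms] by (fastforce simp: half_width_def)
  have gt: "half_width < p" if "p \<in> ?C" for p using that by auto
  have 1: "{p \<in> offsets i j. p < half_width} = ?A \<union> ?B"
    unfolding o using lt gt by (auto dest: less_asym)
  have 2: "{p \<in> offsets i j. half_width < p} = ?C"
    unfolding o using lt gt by (auto dest: less_asym)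
  have AB: "?A \<inter> ?B = {}"
  proof -
    have "even p" if "p \<in> ?A" for p using that by auto
    moreover have "odd p" if "p \<in> ?B" for p using that by auto
    ultimately show ?thesis by blast
  qed
  have cA: "card ?A = W" by (subst card_image) (auto simp: inj_on_def)
  have cB: "card ?B = occ j i" by (subst card_image) (auto simp: inj_on_def occ_def)
  have cC: "card ?C = W - occ j i"
    by (subst card_image) (auto simp: inj_on_def occ_def card_Diff_subset subset_eq)
  show I: "card {p \<in> offsets i j. p < half_width} = W + occ j i"
    unfolding 1 using cA cB AB by (subst card_Un_disjoint) auto
  show II: "card {p \<in> offsets i j. half_width < p} = W - occ j i" unfolding 2 by (rule cC)
  have "offsets i j = {p \<in> offsets i j. p < half_width} \<union> {p \<in> offsets i j. half_width < p}"
    by (simp only: 1 2) (rule o)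
  moreover have "card ({p \<in> offsets i j. p < half_width} \<union> {p \<in> offsets i j. half_width < p}) =
      card {p \<in> offsets i j. p < half_width} + card {p \<in> offsets i j. half_width < p}"
    by (rule card_Un_disjoint) (unfold 1 2, insert lt gt, auto dest: less_asym)
  ultimately have "card (offsets i j) = card {p \<in> offsets i j. p < half_width} + card {p \<in> offsets i j. half_width < p}"
    by simp
  then show "card (offsets i j) = 2 * W" using I II occ_le[of j i] by simp
qed

lemma adj_item: "adj (3 + i) x \<longleftrightarrow> (\<exists>j<m. \<exists>p\<in>offsets i j. x = center + j * width + p)"
proof -
  have "adj (3 + i) x \<longleftrightarrow> (\<exists>j<m. \<exists>s<W. x = center + j * width + 2 * (i * W + s) \<or>
       (x = center + j * width + (2 * (i * W + s) + 1) \<and> lit j s = i) \<or>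
       (x = center + j * width + (half_width + 1 + (i * W + s)) \<and> lit j s \<noteq> i))"
    by (simp add: adj_def add.assoc)
  then show ?thesis unfolding offsets_def by blast
qed

lemma item_LR:
  assumes "i < 2 * N" "j < m"
  shows "L (3 + i) (center + j * width + half_width) = 2 * W * j + (W + occ j i)"
    and "R (3 + i) (center + j * width + half_width) = 2 * W * (m - 1 - j) + (W - occ j i)"
proof -
  have h: "half_width < width" by (simp add: width_def)
  note c = card_block_less[of m "offsets i" width j half_width center, OF offsets_less[OF assms(1)] assms(2) h]
  show "L (3 + i) (center + j * width + half_width) = 2 * W * j + (W + occ j i)"
    unfolding L_def adj_item c(1) card_offsets[OF assms(1)] by simp
  show "R (3 + i) (center + j * width + half_width) = 2 * W * (m - 1 - j) + (W - occ j i)"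
    unfolding R_def adj_item c(2) card_offsets[OF assms(1)] by simp
qed

lemma finite_adj: "finite {x. adj v x}"
proof (cases "v < 3")
  case True
  then have "{x. adj v x} \<subseteq> {..nX} \<union> (\<lambda>j. center + j * width + half_width) ` {..<m}"
    by (auto simp: adj_def nX_def center_end_def)
  then show ?thesis using finite_subset by blast
next
  case False
  then obtain i where i: "v = 3 + i" by (metis le_Suc_ex not_less)
  have "finite (offsets i j)" for j unfolding offsets_def by (intro finite_UnI finite_image_set) auto
  moreover have "{x. adj v x} = (\<Union>j\<in>{..<m}. (\<lambda>p. center + j * width + p) ` offsets i j)"
    by (auto simp: i adj_item)
  ultimately show ?thesis by simp
qed

lemma item_degree:
  assumes "i < 2 * N"
  shows "card {x. adj (3 + i) x} = 2 * W * m"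
proof (cases "m = 0")
  case True
  then have "\<not> adj (3 + i) x" for x using adj_item by simp
  then show ?thesis using True by simp
next
  case False
  then show ?thesis
    using card_block_less(3)[of m "offsets i" width 0 0 center] offsets_less[OF assms]
    unfolding adj_item by (simp add: card_offsets[OF assms] width_def)
qed

lemma L_le: "{x'. adj v x' \<and> x' < x} \<subseteq> T \<Longrightarrow> finite T \<Longrightarrow> L v x \<le> card T"
  unfolding L_def by (rule card_mono)

lemma R_le: "{x'. adj v x' \<and> x < x'} \<subseteq> T \<Longrightarrow> finite T \<Longrightarrow> R v x \<le> card T"
  unfolding R_def by (rule card_mono)

lemma L_ge: "T \<subseteq> {x'. adj v x' \<and> x' < x} \<Longrightarrow> card T \<le> L v x"
  unfolding L_def by (rule card_mono[OF finite_subset[OF _ finite_adj]]) auto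

lemma R_ge: "T \<subseteq> {x'. adj v x' \<and> x < x'} \<Longrightarrow> card T \<le> R v x"
  unfolding R_def by (rule card_mono[OF finite_subset[OF _ finite_adj]]) auto

lemma item_LR_le:
  assumes "i < 2 * N"
  shows "L (3 + i) x \<le> 2 * W * m" "R (3 + i) x \<le> 2 * W * m"
  using L_le[of "3 + i" x "{x. adj (3 + i) x}"] R_le[of "3 + i" x "{x. adj (3 + i) x}"]
    finite_adj item_degree[OF assms] by auto

end

section \<open>Crossings of the individual edges\<close>

context gadget
begin

definition test :: "nat \<Rightarrow> nat" where "test j = center + j * width + half_width"

lemma test_less: "j < m \<Longrightarrow> center \<le> test j \<and> test j < center_end"
proof -
  assume "j < m"
  then have "Suc j * width \<le> m * width" by (intro mult_right_mono) auto
  then show ?thesis by (simp add: test_def center_end_def width_def)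
qed

lemma adj_pivot: "adj 2 x \<longleftrightarrow> (1 \<le> x \<and> x < 1 + ge) \<or> (\<exists>j<m. x = test j) \<or>
    (center_end + gc + gd \<le> x \<and> x < center_end + gc + gd + ge)"
  by (simp add: adj_def test_def)

lemma adj_center: "adj (3 + i) x \<Longrightarrow> i < 2 * N \<Longrightarrow> center \<le> x \<and> x < center_end"
proof -
  assume "adj (3 + i) x" "i < 2 * N"
  then obtain j p where j: "j < m" "p < width" "x = center + j * width + p"
    unfolding adj_item using offsets_less by blast
  then have "Suc j * width \<le> m * width" by (intro mult_right_mono) auto
  then show ?thesis using j by (simp add: center_end_def)
qed

lemma vertex_cases:
  assumes "v < nY"
  obtains "v = 0" | "v = 1" | "v = 2" | i where "v = 3 + i" "i < 2 * N"
proof -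
  have "v = 0 \<or> v = 1 \<or> v = 2 \<or> (\<exists>i. v = 3 + i \<and> i < 2 * N)"
    using assms by (cases "v < 3") (auto simp: nY_def intro: exI[of _ "v - 3"])
  then show ?thesis using that by blast
qed

lemma center_le: "1 + ge + gd \<le> center" "center \<le> center_end"
  by (simp_all add: center_def center_end_def)

lemma adj_less: "v < nY \<Longrightarrow> adj v x \<Longrightarrow> x < nX"
proof (erule vertex_cases)
  fix i assume "adj v x" "v = 3 + i" "i < 2 * N"
  then show "x < nX" using adj_center[of i x] by (simp add: nX_def)
next
  assume "v = 2" "adj v x"
  then show "x < nX" using center_le by (auto simp: adj_pivot nX_def dest!: test_less)
qed (use center_le in \<open>auto simp: adj_def nX_def\<close>)

lemma LR_upper:
  shows R0: "R 0 x \<le> gd + gc" and L1: "x < nX \<Longrightarrow> L 1 x \<le> gc + gd"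
    and R0': "1 + ge + gd \<le> x \<Longrightarrow> R 0 x \<le> gc" and L1': "x < center_end + gc \<Longrightarrow> L 1 x \<le> gc"
    and R0'': "center_end + gc \<le> x \<Longrightarrow> R 0 x = 0" and L1'': "x < 1 + ge \<Longrightarrow> L 1 x = 0"
    and L0: "x < center_end \<Longrightarrow> L 0 x \<le> 1 + gd" and R1: "center \<le> x \<Longrightarrow> R 1 x \<le> 1 + gd"
    and L2: "L 2 x \<le> 2 * ge + m" and R2: "R 2 x \<le> 2 * ge + m"
    and L2': "x < center_end \<Longrightarrow> L 2 x \<le> ge + m" and R2': "center \<le> x \<Longrightarrow> R 2 x \<le> ge + m"
proof -
  note c = center_le
  have un: "card (A \<union> B) \<le> a + b" if "card A \<le> a" "card B \<le> b" for A B :: "nat set" and a b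
    using card_Un_le[of A B] that by linarith
  have t: "card (test ` {..<m}) \<le> m" using card_image_le[of "{..<m}" test] by simp
  show "R 0 x \<le> gd + gc"
    by (rule order_trans[OF R_le[of _ _ "{1 + ge..<1 + ge + gd} \<union> {center_end..<center_end + gc}"] un])
      (auto simp: adj_def)
  show "L 1 x \<le> gc + gd" if "x < nX"
    by (rule order_trans[OF L_le[of _ _ "{1 + ge + gd..<center} \<union> {center_end + gc..<center_end + gc + gd}"] un])
      (use that in \<open>auto simp: adj_def center_def nX_def\<close>)
  show "R 0 x \<le> gc" if "1 + ge + gd \<le> x"
    by (rule order_trans[OF R_le[of _ _ "{center_end..<center_end + gc}"]])
      (use that in \<open>auto simp: adj_def\<close>)
  show "L 1 x \<le> gc" if "x < center_end + gc"
    by (rule order_trans[OF L_le[of _ _ "{1 + ge + gd..<center}"]])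
      (use that in \<open>auto simp: adj_def center_def\<close>)
  show "R 0 x = 0" if "center_end + gc \<le> x"
  proof -
    have "{x'. adj 0 x' \<and> x < x'} = {}" using that c by (auto simp: adj_def)
    then show ?thesis by (simp only: R_def card.empty)
  qed
  show "L 1 x = 0" if "x < 1 + ge"
  proof -
    have "{x'. adj 1 x' \<and> x' < x} = {}" using that c by (auto simp: adj_def)
    then show ?thesis by (simp only: L_def card.empty)
  qed
  show "L 0 x \<le> 1 + gd" if "x < center_end"
    by (rule order_trans[OF L_le[of _ _ "{0} \<union> {1 + ge..<1 + ge + gd}"] un])
      (use that in \<open>auto simp: adj_def\<close>)
  show "R 1 x \<le> 1 + gd" if "center \<le> x"
    by (rule order_trans[OF R_le[of _ _ "{center_end + gc + gd + ge} \<union> {center_end + gc..<center_end + gc + gd}"] un])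
      (use that in \<open>auto simp: adj_def\<close>)
  have two: "2 * ge + m = ge + m + ge" by simp
  show "L 2 x \<le> 2 * ge + m" unfolding two
    by (rule order_trans[OF L_le[of _ _ "{1..<1 + ge} \<union> test ` {..<m} \<union> {center_end + gc + gd..<center_end + gc + gd + ge}"] un[OF un]])
      (use t in \<open>auto simp: adj_pivot\<close>)
  show "R 2 x \<le> 2 * ge + m" unfolding two
    by (rule order_trans[OF R_le[of _ _ "{1..<1 + ge} \<union> test ` {..<m} \<union> {center_end + gc + gd..<center_end + gc + gd + ge}"] un[OF un]])
      (use t in \<open>auto simp: adj_pivot\<close>)
  show "L 2 x \<le> ge + m" if "x < center_end"
    by (rule order_trans[OF L_le[of _ _ "{1..<1 + ge} \<union> test ` {..<m}"] un])
      (use t that in \<open>auto simp: adj_pivot\<close>)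
  show "R 2 x \<le> ge + m" if "center \<le> x"
    by (rule order_trans[OF R_le[of _ _ "{center_end + gc + gd..<center_end + gc + gd + ge} \<union> test ` {..<m}"] un])
      (use t that c in \<open>auto simp: adj_pivot\<close>)
qed

text \<open>These bounds concern the edges into the blocks and the edges that refute a misplaced
  guard: 1 and \<open>center_end + gc + gd + ge - 1\<close> are the outermost neighbours of the
  pivot, 0 is the leftmost neighbour of guard 0.\<close>

lemma LR_lower:
  shows "j < m \<Longrightarrow> gc \<le> R 0 (test j)" and "j < m \<Longrightarrow> gc \<le> L 1 (test j)"
    and "gd + gc \<le> R 0 1" and "gc + gd + 1 \<le> R 1 1" and "gc + gd + 1 \<le> R 1 0" and "2 * ge + m \<le> R 2 0"
    and "1 + gd + gc \<le> L 0 (center_end + gc + gd + ge - 1)"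
    and "gc + gd \<le> L 1 (center_end + gc + gd + ge - 1)"
proof -
  note c = center_le
  have ge: "1 \<le> ge" by (simp add: ge_def)
  have cu: "a + b \<le> card (A \<union> B)" if "a \<le> card A" "b \<le> card B" "A \<inter> B = {}" "finite A" "finite B"
    for A B :: "nat set" and a b using that card_Un_disjoint[of A B] by simp
  show "gc \<le> R 0 (test j)" if "j < m"
    by (rule order_trans[OF _ R_ge[of "{center_end..<center_end + gc}"]])
      (use test_less[OF that] in \<open>auto simp: adj_def\<close>)
  show "gc \<le> L 1 (test j)" if "j < m"
    by (rule order_trans[OF _ L_ge[of "{1 + ge + gd..<center}"]])
      (use test_less[OF that] in \<open>auto simp: adj_def center_def\<close>)
  show "gd + gc \<le> R 0 1"
    by (rule order_trans[OF cu R_ge[of "{1 + ge..<1 + ge + gd} \<union> {center_end..<center_end + gc}"]])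
      (use c ge in \<open>auto simp: adj_def\<close>)
  show "gc + gd + 1 \<le> R 1 1"
    by (rule order_trans[OF cu[OF cu] R_ge[of "({1 + ge + gd..<center} \<union> {center_end + gc..<center_end + gc + gd}) \<union> {center_end + gc + gd + ge}"]])
      (use c ge in \<open>auto simp: adj_def center_def\<close>)
  show "gc + gd + 1 \<le> R 1 0"
    by (rule order_trans[OF cu[OF cu] R_ge[of "({1 + ge + gd..<center} \<union> {center_end + gc..<center_end + gc + gd}) \<union> {center_end + gc + gd + ge}"]])
      (use c ge in \<open>auto simp: adj_def center_def\<close>)
  have width: "0 < width" by (simp add: width_def)
  have ct: "card (test ` {..<m}) = m"
    using width by (subst card_image) (auto simp: inj_on_def test_def)
  have tl: "1 + ge \<le> test j \<and> test j < center_end" if "j < m" for j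
    using test_less[OF that] c by simp
  have two: "2 * ge + m = ge + m + ge" by simp
  show "2 * ge + m \<le> R 2 0" unfolding two
    by (rule order_trans[OF cu[OF cu] R_ge[of "({1..<1 + ge} \<union> test ` {..<m}) \<union> {center_end + gc + gd..<center_end + gc + gd + ge}"]])
      (use c ge ct in \<open>auto simp: adj_pivot dest: tl\<close>)
  show "1 + gd + gc \<le> L 0 (center_end + gc + gd + ge - 1)"
    by (rule order_trans[OF cu[OF cu] L_ge[of "({0} \<union> {1 + ge..<1 + ge + gd}) \<union> {center_end..<center_end + gc}"]])
      (use c ge in \<open>auto simp: adj_def\<close>)
  show "gc + gd \<le> L 1 (center_end + gc + gd + ge - 1)"
    by (rule order_trans[OF cu L_ge[of "{1 + ge + gd..<center} \<union> {center_end + gc..<center_end + gc + gd}"]])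
      (use c ge in \<open>auto simp: adj_def center_def\<close>)
qed

text \<open>The order of \<open>Y\<close> enters only through \<open>bf v u\<close>, read as
  \<open>v\<close> precedes \<open>u\<close>; a comparison of ranks can take its place.\<close>

definition side :: "(nat \<Rightarrow> nat \<Rightarrow> bool) \<Rightarrow> nat \<Rightarrow> nat \<Rightarrow> nat \<Rightarrow> nat" where
  "side bf u x v = (if v = u then 0 else if bf v u then R v x else L v x)"

definition cost :: "(nat \<Rightarrow> nat \<Rightarrow> bool) \<Rightarrow> nat \<Rightarrow> nat \<Rightarrow> nat" where
  "cost bf u x = side bf u x 0 + side bf u x 1 + side bf u x 2 + (\<Sum>i<2 * N. side bf u x (3 + i))"

lemma planar_iff_cost:
  assumes r: "linear_order_on {nX..<nX + nY} r"
  shows "k_planar crossings edges order r \<longleftrightarrow>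
    (\<forall>u<nY. \<forall>x. adj u x \<longrightarrow> cost (\<lambda>v u. strictly_below r (nX + v) (nX + u)) u x \<le> crossings)"
proof -
  have E: "edges = {(x, nX + v) | x v. v < nY \<and> x \<in> {x. adj v x}}"
    using adj_less by (auto simp: edges_def)
  have A: "\<And>v. v < nY \<Longrightarrow> {x. adj v x} \<subseteq> {..<nX}" using adj_less by auto
  have cost: "card {e' \<in> edges. edges_cross order r (x, nX + u) e'} =
      cost (\<lambda>v u. strictly_below r (nX + v) (nX + u)) u x" if "u < nY" "adj u x" for u x
  proof -
    have "card {e' \<in> edges. edges_cross order r (x, nX + u) e'} =
       (\<Sum>v \<in> {..<nY} - {u}. if strictly_below r (nX + v) (nX + u)
       then card {x' \<in> {x. adj v x}. x < x'} else card {x' \<in> {x. adj v x}. x' < x})"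
      unfolding order_def by (rule crossing_count[OF A E r that(1) adj_less[OF that]])
    also have "\<dots> = (\<Sum>v \<in> {..<nY} - {u}. side (\<lambda>v u. strictly_below r (nX + v) (nX + u)) u x v)"
      by (rule sum.cong) (auto simp: side_def L_def R_def)
    also have "\<dots> = (\<Sum>v<nY. side (\<lambda>v u. strictly_below r (nX + v) (nX + u)) u x v)"
      using that by (subst (2) sum.remove[of _ u]) (auto simp: side_def)
    also have "\<dots> = cost (\<lambda>v u. strictly_below r (nX + v) (nX + u)) u x"
      unfolding cost_def nY_def by (simp add: sum.lessThan_Suc_shift numeral_3_eq_3 numeral_2_eq_2 del: sum.lessThan_Suc)
    finally show ?thesis .
  qed
  show ?thesis
    unfolding k_planar_def
  proof (intro iffI allI impI ballI)
    fix u x assume a: "\<forall>e\<in>edges. card {e' \<in> edges. edges_cross order r e e'} \<le> crossings" "u < nY" "adj u x"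
    then have "(x, nX + u) \<in> edges" using E by auto
    then show "cost (\<lambda>v u. strictly_below r (nX + v) (nX + u)) u x \<le> crossings" using a cost by fastforce
  next
    fix e assume a: "\<forall>u<nY. \<forall>x. adj u x \<longrightarrow> cost (\<lambda>v u. strictly_below r (nX + v) (nX + u)) u x \<le> crossings"
      "e \<in> edges"
    then obtain x u where "e = (x, nX + u)" "u < nY" "adj u x" unfolding edges_def by blast
    then show "card {e' \<in> edges. edges_cross order r e e'} \<le> crossings" using a cost by simp
  qed
qed

lemma items_le: "(\<Sum>i<2 * N. side bf u x (3 + i)) \<le> item_edges"
proof -
  have "side bf u x (3 + i) \<le> 2 * W * m" if "i < 2 * N" for i
    using item_LR_le[OF that] by (simp add: side_def)
  then have "(\<Sum>i<2 * N. side bf u x (3 + i)) \<le> card {..<2 * N} * (2 * W * m)"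
    using sum_bounded_above[of "{..<2 * N}" "\<lambda>i. side bf u x (3 + i)" "2 * W * m"] by simp
  then show ?thesis by (simp add: item_edges_def)
qed

text \<open>Crossings of the pivot's edge into block \<open>j\<close> with item edges, if the items
  before the pivot are those in \<open>S\<close>.\<close>

definition items_at :: "nat set \<Rightarrow> nat \<Rightarrow> nat" where
  "items_at S j = (\<Sum>i<2 * N. if i \<in> S then R (3 + i) (test j) else L (3 + i) (test j))"

lemma sum_occ:
  assumes "finite S"
  shows "(\<Sum>i\<in>S. occ j i) = card {s. s < W \<and> lit j s \<in> S}"
proof -
  have "{s. s < W \<and> lit j s \<in> S} = (\<Union>i\<in>S. {s. s < W \<and> lit j s = i})" by auto
  then show ?thesis unfolding occ_def using assms
    by (simp only:) (rule card_UN_disjoint[symmetric], auto)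
qed

text \<open>Occurrences of items in \<open>S\<close> lower the count; adding them on the left avoids
  truncated subtraction.\<close>

lemma items_at_sum:
  assumes S: "S \<subseteq> {..<2 * N}" and j: "j < m"
  shows "items_at S j + (\<Sum>i\<in>S. occ j i) =
    card S * (2 * W * (m - 1 - j) + W) + (2 * N - card S) * (2 * W * j + W) + (\<Sum>i\<in>{..<2 * N} - S. occ j i)"
proof -
  have fin: "finite S" using S finite_subset by blast
  have "items_at S j = (\<Sum>i\<in>S. if i \<in> S then R (3 + i) (test j) else L (3 + i) (test j)) +
      (\<Sum>i\<in>{..<2 * N} - S. if i \<in> S then R (3 + i) (test j) else L (3 + i) (test j))"
    unfolding items_at_def using S by (simp add: sum.subset_diff[of S])
  also have "\<dots> = (\<Sum>i\<in>S. 2 * W * (m - 1 - j) + (W - occ j i)) + (\<Sum>i\<in>{..<2 * N} - S. 2 * W * j + (W + occ j i))"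
    using S item_LR[OF _ j] by (intro arg_cong2[of _ _ _ _ "(+)"] sum.cong) (auto simp: test_def)
  finally have 1: "items_at S j = (\<Sum>i\<in>S. 2 * W * (m - 1 - j) + (W - occ j i)) +
      (\<Sum>i\<in>{..<2 * N} - S. 2 * W * j + (W + occ j i))" .
  have "(\<Sum>i\<in>S. 2 * W * (m - 1 - j) + (W - occ j i)) + (\<Sum>i\<in>S. occ j i) = (\<Sum>i\<in>S. 2 * W * (m - 1 - j) + W)"
    unfolding sum.distrib[symmetric] by (intro sum.cong) (simp_all add: trans_le_add2[OF occ_le] occ_le)
  then have 2: "(\<Sum>i\<in>S. 2 * W * (m - 1 - j) + (W - occ j i)) + (\<Sum>i\<in>S. occ j i) =
      card S * (2 * W * (m - 1 - j) + W)" by simp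
  have "(\<Sum>i\<in>{..<2 * N} - S. 2 * W * j + (W + occ j i)) =
     (\<Sum>i\<in>{..<2 * N} - S. 2 * W * j + W) + (\<Sum>i\<in>{..<2 * N} - S. occ j i)"
    by (simp only: sum.distrib[symmetric] add.assoc)
  then have "(\<Sum>i\<in>{..<2 * N} - S. 2 * W * j + (W + occ j i)) =
     (2 * N - card S) * (2 * W * j + W) + (\<Sum>i\<in>{..<2 * N} - S. occ j i)"
    using S fin by (simp add: card_Diff_subset)
  then show ?thesis using 1 2 by simp
qed

end

section \<open>Drawings and hitting sets\<close>

locale valid_gadget = gadget +
  assumes m: "2 \<le> m" and W: "2 \<le> W" and lit: "\<And>j s. j < m \<Longrightarrow> s < W \<Longrightarrow> lit j s < 2 * N"
begin

text \<open>For \<open>card S = N\<close> the two main terms of \<open>items_at_sum\<close> add up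
  to \<open>2 * W * m * N\<close> at every \<open>j\<close>, and since \<open>P j + Q j = W\<close>
  the bound says \<open>P j \<ge> 1\<close>, that is, set \<open>j\<close> is hit. If
  \<open>S\<close> is larger, block 0 exceeds the bound; if it is smaller, the last block
  does.\<close>

lemma items_at_le_bound_iff:
  assumes S: "S \<subseteq> {..<2 * N}"
  shows "(\<forall>j<m. items_at S j \<le> bound) \<longleftrightarrow> hitting S"
proof -
  have fin: "finite S" using S finite_subset by blast
  have a: "card S \<le> 2 * N" using card_mono[OF _ S] by simp
  define P where "P j = (\<Sum>i\<in>S. occ j i)" for j
  define Q where "Q j = (\<Sum>i\<in>{..<2 * N} - S. occ j i)" for j
  have PQ: "P j + Q j = W" if "j < m" for j
  proof -
    have "P j + Q j = (\<Sum>i<2 * N. occ j i)"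
      unfolding P_def Q_def using S by (simp add: sum.subset_diff[of S "{..<2 * N}"])
    also have "\<dots> = card {s. s < W \<and> lit j s \<in> {..<2 * N}}" by (rule sum_occ) simp
    also have "{s. s < W \<and> lit j s \<in> {..<2 * N}} = {..<W}" using lit[OF that] by auto
    finally show ?thesis by simp
  qed
  have P: "1 \<le> P j \<longleftrightarrow> (\<exists>s<W. lit j s \<in> S)" for j
    unfolding P_def sum_occ[OF fin] by (auto simp: Suc_le_eq card_gt_0_iff)
  have main: "items_at S j + P j =
      card S * (2 * W * (m - 1 - j) + W) + (2 * N - card S) * (2 * W * j + W) + Q j" if "j < m" for j
    using items_at_sum[OF S that] by (simp add: P_def Q_def)
  have half: "items_at S j \<le> bound \<longleftrightarrow> (\<exists>s<W. lit j s \<in> S)" if cS: "card S = N" and jm: "j < m" for j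
  proof -
    obtain k where k: "m = Suc (j + k)" using jm less_imp_Suc_add by blast
    have "card S * (2 * W * (m - 1 - j) + W) + (2 * N - card S) * (2 * W * j + W) = 2 * W * m * N"
      using cS by (simp add: k algebra_simps)
    then have "items_at S j + P j = 2 * W * m * N + Q j" using main[OF jm] by simp
    moreover obtain X where "X = 2 * W * m * N" by simp
    ultimately have "items_at S j \<le> bound \<longleftrightarrow> 1 \<le> P j"
      using PQ[OF jm] W unfolding bound_def by presburger
    then show ?thesis using P[of j] by simp
  qed
  obtain q where q: "m = Suc (Suc q)" using m by (metis Suc_le_D numeral_2_eq_2 Suc_le_mono)
  \<comment> \<open>As \<open>c + d\<close> is even, \<open>d < c\<close> gives
    \<open>c \<ge> d + 2\<close>. This lifts the main term at least \<open>2 * W\<close> above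
    \<open>2 * W * m * N\<close>, and the correction \<open>p \<le> W\<close> takes back at most
    half of that.\<close>
  have extreme: "bound < A" if "A + p = c * (2 * W * Suc q + W) + d * W + y" "p \<le> W" "c + d = 2 * N" "d < c" for A p c d y
  proof -
    note cd = that(3,4)
    have "even (c + d)" using cd by simp
    then have "even (c - d)" using cd by simp
    then obtain z where z: "c - d = 2 * z" by blast
    then obtain r where "z = Suc r" using cd by (cases z) auto
    with z cd have r: "c = d + 2 + 2 * r" "N = d + 1 + r" by auto
    have "c * (2 * W * Suc q + W) + d * W = 2 * W * m * N + 2 * W * q * (1 + r) + 2 * W + 2 * W * r"
      unfolding r q by (simp add: algebra_simps)
    then have "2 * W * m * N + 2 * W \<le> A + p" using that(1) by linarith
    then show ?thesis using that(2) W unfolding bound_def by linarith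
  qed
  have size: "card S = N" if b: "\<forall>j<m. items_at S j \<le> bound"
  proof (rule ccontr)
    assume "card S \<noteq> N"
    then consider "2 * N - card S < card S" | "card S < 2 * N - card S" using a by linarith
    then show False
    proof cases
      case 1
      have "items_at S 0 + P 0 = card S * (2 * W * Suc q + W) + (2 * N - card S) * W + Q 0"
        using main[of 0] m by (simp add: q)
      then have "bound < items_at S 0"
        by (rule extreme) (use PQ[of 0] m a 1 in auto)
      then show False using b m by fastforce
    next
      case 2
      have "items_at S (Suc q) + P (Suc q) = (2 * N - card S) * (2 * W * Suc q + W) + card S * W + Q (Suc q)"
        using main[of "Suc q"] by (simp add: q)
      then have "bound < items_at S (Suc q)"
        by (rule extreme) (use PQ[of "Suc q"] q a 2 in auto)
      then show False using b q by fastforce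
    qed
  qed
  show ?thesis unfolding hitting_def using size half S by blast
qed


lemma crossings_eq: "crossings = 2 * gc + bound" "gd = ge + bound" "gc = 2 * ge + m + item_edges + 1"
    "ge = item_edges + 1"
  by (simp_all add: crossings_def gd_def gc_def ge_def)

text \<open>One edge refutes each wrong placement: the leftmost edge of the pivot if both guards
  precede it, its rightmost edge if both follow it, and the leftmost edge of guard 0 if the guards
  are exchanged. In the remaining case each edge from the pivot into a block has at least
  \<open>2 * gc\<close> crossings with guard edges, so at most \<open>bound\<close> are left for the
  items.\<close>

lemma planar_imp_hitting:
  assumes r: "linear_order_on {nX..<nX + nY} r" and pl: "k_planar crossings edges order r"
  shows "\<exists>S. hitting S"
proof -
  define bf where "bf = (\<lambda>v u. strictly_below r (nX + v) (nX + u))"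
  have C: "cost bf u x \<le> crossings" if "u < nY" "adj u x" for u x
    using planar_iff_cost[OF r] pl that unfolding bf_def by blast
  have nY: "0 < nY" "1 < nY" "2 < nY" by (simp_all add: nY_def)
  have total: "bf u v" if "u < nY" "v < nY" "u \<noteq> v" "\<not> bf v u" for u v
  proof -
    have "total_on {nX..<nX + nY} r" using r by (auto simp: order_on_defs)
    moreover have "nX + u \<in> {nX..<nX + nY}" "nX + v \<in> {nX..<nX + nY}" "nX + u \<noteq> nX + v"
      using that by auto
    ultimately have "(nX + u, nX + v) \<in> r \<or> (nX + v, nX + u) \<in> r" unfolding total_on_def by blast
    then show ?thesis using that by (auto simp: bf_def strictly_below_def)
  qed
  have trans: "bf u w" if "bf u v" "bf v w" for u v w
  proof -
    have "trans r" "antisym r" using r by (auto simp: order_on_defs)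
    then show ?thesis using that unfolding bf_def strictly_below_def by (metis antisymD transD)
  qed
  have ge: "1 \<le> ge" by (simp add: ge_def)
  have "\<not> (bf 0 2 \<and> bf 1 2)"
  proof
    assume "bf 0 2 \<and> bf 1 2"
    then have "R 0 1 + R 1 1 \<le> cost bf 2 1" by (simp add: cost_def side_def)
    moreover have "cost bf 2 1 \<le> crossings" using C[OF nY(3), of 1] ge by (simp add: adj_pivot)
    ultimately show False using LR_lower(3,4) crossings_eq by linarith
  qed
  moreover have "\<not> (\<not> bf 0 2 \<and> \<not> bf 1 2)"
  proof
    let ?x = "center_end + gc + gd + ge - 1"
    assume "\<not> bf 0 2 \<and> \<not> bf 1 2"
    then have "L 0 ?x + L 1 ?x \<le> cost bf 2 ?x" by (simp add: cost_def side_def)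
    moreover have "adj 2 ?x" using ge unfolding adj_pivot by auto
    then have "cost bf 2 ?x \<le> crossings" using C[OF nY(3)] by blast
    ultimately show False using LR_lower(7,8) crossings_eq by linarith
  qed
  moreover have "\<not> (bf 1 2 \<and> \<not> bf 0 2)"
  proof
    assume a: "bf 1 2 \<and> \<not> bf 0 2"
    then have "bf 2 0" using total[of 2 0] nY by simp
    moreover from this a have "bf 1 0" using trans by blast
    ultimately have "R 1 0 + R 2 0 \<le> cost bf 0 0" by (simp add: cost_def side_def)
    moreover have "cost bf 0 0 \<le> crossings" using C[OF nY(1), of 0] by (simp add: adj_def)
    ultimately show False using LR_lower(5,6) crossings_eq by linarith
  qed
  ultimately have g: "bf 0 2" "\<not> bf 1 2" by blast+
  define S where "S = {i. i < 2 * N \<and> bf (3 + i) 2}"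
  have "items_at S j \<le> bound" if j: "j < m" for j
  proof -
    have "(\<Sum>i<2 * N. side bf 2 (test j) (3 + i)) = items_at S j"
      unfolding items_at_def by (rule sum.cong) (auto simp: side_def S_def)
    then have "cost bf 2 (test j) = R 0 (test j) + L 1 (test j) + items_at S j"
      using g by (simp add: cost_def side_def)
    moreover have "adj 2 (test j)" using j by (auto simp: adj_pivot)
    then have "cost bf 2 (test j) \<le> crossings" using C[OF nY(3)] by blast
    ultimately show ?thesis using LR_lower(1,2)[OF j] crossings_eq(1) by linarith
  qed
  then have "hitting S" using items_at_le_bound_iff[of S] by (auto simp: S_def)
  then show ?thesis by blast
qed

text \<open>The order is: the items of \<open>S\<close>, guard 0, the pivot, guard 1, the other
  items. Only the pivot's edges into the blocks need the exact count \<open>items_at\<close>; for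
  all other edges the crude bound \<open>item_edges\<close> is enough.\<close>

lemma hitting_imp_planar:
  assumes S: "hitting S"
  shows "\<exists>r. linear_order_on {nX..<nX + nY} r \<and> k_planar crossings edges order r"
proof -
  define rank where "rank v = (if v = 0 then 2 * N else if v = 1 then 2 * N + 2 else if v = 2 then 2 * N + 1
    else if v - 3 \<in> S then v - 3 else 2 * N + v)" for v
  have SN: "S \<subseteq> {..<2 * N}" using S by (simp add: hitting_def)
  have rank_S: "rank (3 + i) = (if i \<in> S then i else 2 * N + 3 + i)" for i by (simp add: rank_def)
  have rank012: "rank 0 = 2 * N" "rank 1 = 2 * N + 2" "rank 2 = 2 * N + 1"
    "rank (Suc 0) = 2 * N + 2" by (simp_all add: rank_def)
  have less: "i < 2 * N" if "i \<in> S" for i using that SN by auto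
  have inj: "u = v" if "u < nY" "v < nY" "rank u = rank v" for u v
    using that(1)
  proof (rule vertex_cases)
    fix i assume i: "u = 3 + i" "i < 2 * N"
    show ?thesis using that(2) by (rule vertex_cases)
      (use i that(3) in \<open>auto simp: rank_S rank012 split: if_splits dest: less\<close>)
  qed (rule vertex_cases[OF that(2)]; use that(3) in \<open>auto simp: rank_S rank012 split: if_splits dest: less\<close>)+
  define r where "r = {(a, b). a \<in> {nX..<nX + nY} \<and> b \<in> {nX..<nX + nY} \<and> rank (a - nX) \<le> rank (b - nX)}"
  have inj': "a = b" if "a \<in> {nX..<nX + nY}" "b \<in> {nX..<nX + nY}" "rank (a - nX) = rank (b - nX)" for a b
  proof -
    have "a - nX < nY" "b - nX < nY" using that by (auto simp: less_diff_conv2)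
    then have "a - nX = b - nX" using inj that(3) by blast
    then show ?thesis using that by auto
  qed
  have lin: "linear_order_on {nX..<nX + nY} r"
    unfolding order_on_defs
  proof (intro conjI)
    show "antisym r" unfolding antisym_def r_def using inj' by fastforce
    show "total_on {nX..<nX + nY} r" unfolding total_on_def r_def by auto
  qed (auto simp: r_def refl_on_def trans_def)
  have bf: "strictly_below r (nX + v) (nX + u) \<longleftrightarrow> rank v < rank u" if "v < nY" "u < nY" for u v
    using inj[OF that] that by (auto simp: strictly_below_def r_def order.strict_iff_order)
  let ?bf = "\<lambda>v u. rank v < rank u"
  have "cost (\<lambda>v u. strictly_below r (nX + v) (nX + u)) u x = cost ?bf u x" if "u < nY" for u x
  proof -
    have nY: "0 < nY" "1 < nY" "2 < nY" "\<And>i. i < 2 * N \<Longrightarrow> 3 + i < nY" by (simp_all add: nY_def)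
    then have "side (\<lambda>v u. strictly_below r (nX + v) (nX + u)) u x v = side ?bf u x v" if "v < nY" for v
      using bf[OF that \<open>u < nY\<close>] by (simp add: side_def)
    then show ?thesis unfolding cost_def using nY by simp
  qed
  moreover have "cost ?bf u x \<le> crossings" if u: "u < nY" and x: "adj u x" for u x
    using u
  proof (rule vertex_cases)
    note I = items_le[of ?bf u x]
    {
      assume u0: "u = 0"
      have "x < center_end + gc" using x center_le unfolding u0 adj_def by auto
      then have "cost ?bf u x \<le> gc + (2 * ge + m) + item_edges"
        using I L1'[of x] L2[of x] unfolding u0 cost_def side_def rank012 by simp
      then show ?thesis using crossings_eq by linarith
    next
      assume u1: "u = 1"
      have "1 + ge + gd \<le> x" using x center_le unfolding u1 adj_def by auto
      then have "cost ?bf u x \<le> gc + (2 * ge + m) + item_edges"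
        using I R0'[of x] R2[of x] unfolding u1 cost_def side_def rank012 by simp
      then show ?thesis using crossings_eq by linarith
    next
      assume u2: "u = 2"
      have c: "cost ?bf u x = R 0 x + L 1 x + (\<Sum>i<2 * N. side ?bf u x (3 + i))"
        unfolding u2 cost_def side_def rank012 by simp
      consider "x < 1 + ge" | j where "j < m" "x = test j" | "center_end + gc + gd \<le> x"
        using x unfolding u2 adj_pivot by blast
      then show ?thesis
      proof cases
        case 1
        then show ?thesis using c I R0[of x] L1''[of x] crossings_eq by linarith
      next
        case 3
        then have "center_end + gc \<le> x" by simp
        then show ?thesis using c I R0''[of x] L1[OF adj_less[OF u x]] crossings_eq by linarith
      next
        case 2
        have "(\<Sum>i<2 * N. side ?bf u x (3 + i)) = items_at S j"
          unfolding items_at_def by (rule sum.cong) (use less in \<open>fastforce simp: side_def u2 rank_S rank012 2\<close>)+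
        moreover have "items_at S j \<le> bound" using items_at_le_bound_iff[OF SN] S 2 by blast
        ultimately show ?thesis
          using c R0'[of x] L1'[of x] test_less[OF 2(1)] center_le crossings_eq(1) unfolding 2(2) by linarith
      qed
    next
      fix i assume i: "u = 3 + i" "i < 2 * N"
      have xc: "center \<le> x" "x < center_end" using adj_center[of i x] x i by auto
      show ?thesis
      proof (cases "i \<in> S")
        case True
        then have "cost ?bf u x = L 0 x + L 1 x + L 2 x + (\<Sum>i<2 * N. side ?bf u x (3 + i))"
          using i unfolding cost_def side_def rank012 i(1) rank_S by simp
        then show ?thesis using I L0[of x] L1'[of x] L2'[of x] xc crossings_eq by linarith
      next
        case False
        then have "cost ?bf u x = R 0 x + R 1 x + R 2 x + (\<Sum>i<2 * N. side ?bf u x (3 + i))"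
          using i unfolding cost_def side_def rank012 i(1) rank_S by simp
        then show ?thesis using I R0'[of x] R1[of x] R2'[of x] xc center_le crossings_eq by linarith
      qed
    }
  qed
  ultimately have "k_planar crossings edges order r" unfolding planar_iff_cost[OF lin] by simp
  then show ?thesis using lin by blast
qed

theorem yes_instance_iff_hitting: "yes_instance graph_instance \<longleftrightarrow> (\<exists>S. hitting S)"
proof -
  have "linear_order_on {..<nX} order" unfolding order_def by (rule linear_order_nat)
  then show ?thesis
    using planar_imp_hitting hitting_imp_planar
    by (auto simp: graph_instance_def two_layer_drawing_def)
qed

lemma valid_graph_instance: "valid_instance graph_instance"
  using adj_less linear_order_nat[of nX]
  by (auto simp: graph_instance_def two_layer_network_def edges_def order_def)

end

section \<open>Computations as hitting sets\<close>

subsection \<open>Runs of a machine\<close>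

text \<open>Halting states get the idle transition, so that one function describes every time step
  and the clauses need no case for halting.\<close>

definition effect :: "tm \<Rightarrow> nat \<Rightarrow> nat list \<Rightarrow> nat \<times> (nat \<times> move) list" where
  "effect V s rs = (if halting_state V s then (s, map (\<lambda>a. (a, Stay)) rs) else delta V s rs)"

lemma tm_step_effect:
  "tm_step V (s, ts) = (fst (effect V s (map tape_read ts)),
     map2 tape_act (snd (effect V s (map tape_read ts))) ts)"
proof (cases "halting_state V s")
  case True
  have "map2 tape_act (map (\<lambda>a. (a, Stay)) (map tape_read ts)) ts = ts"
    by (rule nth_equalityI) auto
  then show ?thesis using True by (simp add: effect_def)
qed (simp add: effect_def split: prod.split)

lemma effect_wf:
  assumes "wf_tm V" "s < num_states V" "length rs = num_tapes V" "\<forall>a\<in>set rs. a < num_symbols V"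
  shows "fst (effect V s rs) < num_states V" "length (snd (effect V s rs)) = num_tapes V"
    "i < num_tapes V \<Longrightarrow> fst (snd (effect V s rs) ! i) < num_symbols V"
proof -
  obtain s' acts where D: "delta V s rs = (s', acts)" by fastforce
  have "\<forall>q rs. q < num_states V \<and> length rs = num_tapes V \<and> (\<forall>a\<in>set rs. a < num_symbols V) \<longrightarrow>
        (case delta V q rs of (q', acts) \<Rightarrow>
           q' < num_states V \<and> length acts = num_tapes V \<and>
           (\<forall>(a, m)\<in>set acts. a < num_symbols V))"
    using assms(1) unfolding wf_tm_def by (elim conjE)
  from this[rule_format, of s rs] assms(2-4)
  have d: "s' < num_states V" "length acts = num_tapes V" "\<forall>(a, m)\<in>set acts. a < num_symbols V"
    by (simp_all add: D)
  show "fst (effect V s rs) < num_states V" "length (snd (effect V s rs)) = num_tapes V"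
    using d assms(2,3) by (simp_all add: effect_def D)
  assume i: "i < num_tapes V"
  show "fst (snd (effect V s rs) ! i) < num_symbols V"
  proof (cases "halting_state V s")
    case True
    then show ?thesis using assms i by (simp add: effect_def)
  next
    case False
    have "acts ! i \<in> set acts" using d i by simp
    then show ?thesis using False d(3) by (auto simp: effect_def D)
  qed
qed

lemma wf_tm_bounds: "wf_tm V \<Longrightarrow> 4 \<le> num_symbols V" "wf_tm V \<Longrightarrow> 1 \<le> num_tapes V"
  "wf_tm V \<Longrightarrow> start_state V < num_states V"
  unfolding wf_tm_def by (elim conjE; assumption)+

text \<open>After \<open>t\<close> steps a head is at most \<open>t\<close> cells away from its
  start, so \<open>2 * T x + 1\<close> cells per tape capture the head positions of a run up to time
  \<open>T x\<close>.\<close>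

lemma config_invariant:
  assumes V: "wf_tm V" and y: "\<forall>a\<in>set y. a < 4"
  shows "fst (config_after V y t) < num_states V \<and> length (snd (config_after V y t)) = num_tapes V \<and>
    (\<forall>i<num_tapes V. (\<forall>z. fst (snd (config_after V y t) ! i) z < num_symbols V) \<and>
       \<bar>snd (snd (config_after V y t) ! i)\<bar> \<le> int t)"
proof (induction t)
  case 0
  have tape: "fst (input_tape u) z < num_symbols V \<and> snd (input_tape u) = 0" if u: "\<forall>a\<in>set u. a < 4" for u z
  proof -
    have "u ! k < num_symbols V" if "k < length u" for k
      using u nth_mem[OF that] wf_tm_bounds(1)[OF V] by (meson order_less_le_trans)
    then show ?thesis using wf_tm_bounds(1)[OF V] by (auto simp: input_tape_def blank_def)
  qed
  have "(input_tape y # replicate (num_tapes V - 1) (input_tape [])) ! i = input_tape y \<or>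
      (input_tape y # replicate (num_tapes V - 1) (input_tape [])) ! i = input_tape []"
    if "i < num_tapes V" for i using that by (cases i) auto
  then have "(\<forall>z. fst ((input_tape y # replicate (num_tapes V - 1) (input_tape [])) ! i) z < num_symbols V) \<and>
      \<bar>snd ((input_tape y # replicate (num_tapes V - 1) (input_tape [])) ! i)\<bar> \<le> int 0"
    if "i < num_tapes V" for i using that tape[OF y] tape[of "[]"] by (metis abs_0 empty_iff list.set(1) of_nat_0 order_refl)
  moreover have "start_state V < num_states V" "1 \<le> num_tapes V" using wf_tm_bounds[OF V] by auto
  ultimately show ?case by (simp add: config_after_def initial_config_def)
next
  case (Suc t)
  obtain s ts where c: "config_after V y t = (s, ts)" by fastforce
  let ?rs = "map tape_read ts"
  have IH: "s < num_states V" "length ts = num_tapes V"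
    "\<And>i z. i < num_tapes V \<Longrightarrow> fst (ts ! i) z < num_symbols V"
    "\<And>i. i < num_tapes V \<Longrightarrow> \<bar>snd (ts ! i)\<bar> \<le> int t" using Suc c by auto
  have rs: "\<forall>a\<in>set ?rs. a < num_symbols V"
  proof
    fix a assume "a \<in> set ?rs"
    then obtain i where "i < num_tapes V" "a = tape_read (ts ! i)" using IH(2) by (auto simp: in_set_conv_nth)
    then show "a < num_symbols V" using IH(3)[of i] by (cases "ts ! i") auto
  qed
  note e = effect_wf[OF V IH(1) _ rs]
  have n: "config_after V y (Suc t) = (fst (effect V s ?rs), map2 tape_act (snd (effect V s ?rs)) ts)"
    using c tm_step_effect[of V s ts] by (simp add: config_after_def)
  have "(\<forall>z. fst (tape_act (snd (effect V s ?rs) ! i) (ts ! i)) z < num_symbols V) \<and>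
     \<bar>snd (tape_act (snd (effect V s ?rs) ! i) (ts ! i))\<bar> \<le> int (Suc t)" if i: "i < num_tapes V" for i
  proof -
    obtain a mv where am: "snd (effect V s ?rs) ! i = (a, mv)" by fastforce
    obtain tt h where th: "ts ! i = (tt, h)" by fastforce
    have "a < num_symbols V" using e(3)[OF _ i] am IH(2) by simp
    moreover have "\<bar>move_offset mv\<bar> \<le> 1" by (cases mv) auto
    ultimately show ?thesis using IH(3)[OF i] IH(4)[OF i] unfolding am th by auto
  qed
  then show ?case unfolding n using e(1,2) IH(2) by simp
qed

lemma accept_state_stays:
  assumes "fst (config_after V y t) = accept_state V" "t \<le> t'"
  shows "fst (config_after V y t') = accept_state V"
  using assms(2)
proof (induction t' rule: dec_induct)
  case (step m)
  then show ?case
    by (cases "config_after V y m") (auto simp: config_after_def halting_state_def)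
qed (use assms in simp)

lemma halting_stays:
  assumes "halting_state V (fst (config_after V y t))" "t \<le> t'"
  shows "config_after V y t' = config_after V y t"
  using assms(2)
proof (induction t' rule: dec_induct)
  case (step m)
  then show ?case using assms(1)
    by (cases "config_after V y t") (auto simp: config_after_def)
qed simp

lemma accepts_iff_at:
  assumes "halts_within V y b" "b \<le> T"
  shows "accepts V y \<longleftrightarrow> fst (config_after V y T) = accept_state V"
proof -
  obtain t where t: "t \<le> T" "halting_state V (fst (config_after V y t))"
    using assms unfolding halts_within_def by (meson order_trans)
  have "fst (config_after V y T) = accept_state V" if a: "fst (config_after V y t') = accept_state V" for t'
  proof (cases "t' \<le> T")
    case True
    then show ?thesis using accept_state_stays a by blast
  next
    case False
    have "config_after V y t' = config_after V y t" "config_after V y T = config_after V y t"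
      by (rule halting_stays[OF t(2)], use t(1) False in linarith)+
    then show ?thesis using a by simp
  qed
  then show ?thesis by (auto simp: accepts_def)
qed

subsection \<open>The clauses\<close>

lemma mixed_radix_inj:
  assumes "x * b + y = x' * b + y'" "y < b" "y' < (b :: nat)"
  shows "x = x' \<and> y = y'"
proof -
  have "(x * b + y) div b = x" "(x' * b + y') div b = x'" using assms(2,3) by simp_all
  then show ?thesis using assms(1) by auto
qed

definition move_code :: "move \<Rightarrow> nat" where
  "move_code mv = (case mv of Move_Left \<Rightarrow> 0 | Stay \<Rightarrow> 1 | Move_Right \<Rightarrow> 2)"

lemma move_offset_code: "move_offset mv = int (move_code mv) - 1"
  by (cases mv) (auto simp: move_code_def)

definition literal_true :: "(nat \<Rightarrow> bool) \<Rightarrow> nat \<Rightarrow> bool" where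
  "literal_true \<sigma> l \<longleftrightarrow> (if even l then \<sigma> (l div 2) else \<not> \<sigma> (l div 2))"

abbreviation pos :: "nat \<Rightarrow> nat" where "pos v \<equiv> 2 * v"
abbreviation neg :: "nat \<Rightarrow> nat" where "neg v \<equiv> 2 * v + 1"

lemma literal_true_simps [simp]: "literal_true \<sigma> (pos v) = \<sigma> v" "literal_true \<sigma> (neg v) \<longleftrightarrow> \<not> \<sigma> v"
  "literal_true \<sigma> (Suc (2 * v)) \<longleftrightarrow> \<not> \<sigma> v"
  by (auto simp: literal_true_def)

text \<open>
  The input word is given by its symbols, so that \<open>x = map bit_symbol w\<close>. Time runs from 0 to
  \<open>T x\<close>, and cell \<open>z\<close> of a tape is numbered \<open>z + T x\<close>.
\<close>

locale tableau =
  fixes V :: tm and p q :: "nat poly"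
begin

abbreviation K :: nat where "K \<equiv> num_tapes V"

text \<open>A code stands for a state together with all symbols read. Only the clauses that
  introduce codes need as many as \<open>K + 2\<close> literals; the transition clauses mention a
  code and at most two further facts.\<close>

definition codes :: "(nat \<times> nat list) list" where
  "codes = List.product [0..<num_states V] (List.n_lists K [0..<num_symbols V])"

text \<open>The value 0 out of range makes this and the next four functions finite tables, the form
  that \<open>polytime_table\<close> and \<open>polytime_table2\<close> handle.\<close>

definition old_state :: "nat \<Rightarrow> nat" where
  "old_state c = (if c < length codes then fst (codes ! c) else 0)"
definition old_symbol :: "nat \<Rightarrow> nat \<Rightarrow> nat" where
  "old_symbol c i = (if c < length codes \<and> i < K then snd (codes ! c) ! i else 0)"
definition new_state :: "nat \<Rightarrow> nat" where
  "new_state c = (if c < length codes then fst (effect V (fst (codes ! c)) (snd (codes ! c))) else 0)"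
definition new_symbol :: "nat \<Rightarrow> nat \<Rightarrow> nat" where
  "new_symbol c i = (if c < length codes \<and> i < K
     then fst (snd (effect V (fst (codes ! c)) (snd (codes ! c))) ! i) else 0)"
definition shift :: "nat \<Rightarrow> nat \<Rightarrow> nat" where
  "shift c i = (if c < length codes \<and> i < K
     then move_code (snd (snd (effect V (fst (codes ! c)) (snd (codes ! c))) ! i)) else 0)"

definition value_count :: nat where "value_count = num_symbols V + num_states V + length codes"
definition cert :: "nat list \<Rightarrow> nat" where "cert x = poly q (length x)"
text \<open>Bounds the running time for every certificate of length at most \<open>cert x\<close>,
  and keeps the input with such a certificate inside the numbered cells.\<close>

definition T :: "nat list \<Rightarrow> nat" where
  "T x = poly p (length x + 1 + cert x) + length x + 1 + cert x"
definition cells_count :: "nat list \<Rightarrow> nat" where "cells_count x = 2 * T x + 1"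

definition var :: "nat list \<Rightarrow> nat \<Rightarrow> nat \<Rightarrow> nat \<Rightarrow> nat \<Rightarrow> nat \<Rightarrow> nat" where
  "var x k t i z a = (((k * (T x + 1) + t) * K + i) * cells_count x + z) * value_count + a"

definition var_count :: "nat list \<Rightarrow> nat" where
  "var_count x = 5 * (T x + 1) * K * cells_count x * value_count"

definition state_var where "state_var x t s = var x 0 t 0 0 s"
definition head_var where "head_var x t i z = var x 1 t i z 0"
definition cell_var where "cell_var x t i z a = var x 2 t i z a"
definition read_var where "read_var x t i a = var x 3 t i 0 a"
definition code_var where "code_var x t c = var x 4 t 0 0 c"

text \<open>
  Cells \<open>T x + length x + 1\<close> to \<open>T x + length x + cert x\<close> of tape 0 hold the certificate. The clause of
  type 2 lets each of them be blank or a bit, that of type 3 forbids a bit after a blank. All other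
  clauses say that facts on the run of the machine imply further facts, except that type 10 forbids
  a wrong state at time \<open>T x\<close>. Clauses with parameters out of range are made tautological.
\<close>

definition clause :: "nat list \<Rightarrow> nat \<Rightarrow> nat \<Rightarrow> nat \<Rightarrow> nat \<Rightarrow> nat \<Rightarrow> nat \<Rightarrow> nat \<Rightarrow> nat" where
  "clause x k t i z z' a s =
    (if k = 0 then pos (state_var x 0 (start_state V))
     else if k = 1 then pos (head_var x 0 i (T x))
     else if k = 2 then
       (if i = 0 \<and> T x \<le> z \<and> z < T x + length x then pos (cell_var x 0 i z (letter x (z - T x)))
        else if i = 0 \<and> z = T x + length x then pos (cell_var x 0 i z separator)
        else if i = 0 \<and> T x + length x < z \<and> z \<le> T x + length x + cert x then pos (cell_var x 0 i z (min s 2))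
        else pos (cell_var x 0 i z blank))
     else if k = 3 \<and> T x + length x < z \<and> z < T x + length x + cert x then
       (if s = 0 then neg (cell_var x 0 0 z blank) else pos (cell_var x 0 0 (z + 1) blank))
     else if k = 4 \<and> a < num_symbols V then
       (if s = 0 then neg (head_var x t i z) else if s = 1 then neg (cell_var x t i z a)
        else pos (read_var x t i a))
     else if k = 5 \<and> a < length codes then
       (if s = 0 then neg (state_var x t (old_state a)) else if s = 1 then pos (code_var x t a)
        else neg (read_var x t (s - 2) (old_symbol a (s - 2))))
     else if k = 6 \<and> a < length codes \<and> t < T x then
       (if s = 0 then neg (code_var x t a) else pos (state_var x (t + 1) (new_state a)))
     else if k = 7 \<and> a < length codes \<and> t < T x \<and> 1 \<le> z + shift a i \<and> z + shift a i - 1 < cells_count x then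
       (if s = 0 then neg (code_var x t a) else if s = 1 then neg (head_var x t i z)
        else pos (head_var x (t + 1) i (z + shift a i - 1)))
     else if k = 8 \<and> a < length codes \<and> t < T x then
       (if s = 0 then neg (code_var x t a) else if s = 1 then neg (head_var x t i z)
        else pos (cell_var x (t + 1) i z (new_symbol a i)))
     else if k = 9 \<and> a < num_symbols V \<and> t < T x \<and> z \<noteq> z' then
       (if s = 0 then neg (head_var x t i z) else if s = 1 then neg (cell_var x t i z' a)
        else pos (cell_var x (t + 1) i z' a))
     else if k = 10 \<and> a < num_states V \<and> a \<noteq> accept_state V then neg (state_var x (T x) a)
     else if s = 0 then pos 0 else neg 0)"

definition satisfies :: "nat list \<Rightarrow> (nat \<Rightarrow> bool) \<Rightarrow> bool" where
  "satisfies x \<sigma> \<longleftrightarrow> (\<forall>k<11. \<forall>t\<le>T x. \<forall>i<K. \<forall>z<cells_count x. \<forall>z'<cells_count x. \<forall>a<value_count.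
     \<exists>s<K + 2. literal_true \<sigma> (clause x k t i z z' a s))"

lemma var_less:
  assumes "k < 5" "t \<le> T x" "i < K" "z < cells_count x" "a < value_count"
  shows "var x k t i z a < var_count x"
proof -
  have step: "u * b + y < U * b" if "u < U" "y < b" for u U b y :: nat
  proof -
    have "u * b + y < Suc u * b" using that by simp
    also have "\<dots> \<le> U * b" using that by (intro mult_right_mono) auto
    finally show ?thesis .
  qed
  show ?thesis unfolding var_def var_count_def
    by (intro step) (use assms in auto)
qed

lemma var_inj:
  assumes "var x k t i z a = var x k' t' i' z' a'" "t \<le> T x" "i < K" "z < cells_count x" "a < value_count"
    "t' \<le> T x" "i' < K" "z' < cells_count x" "a' < value_count"
  shows "k = k' \<and> t = t' \<and> i = i' \<and> z = z' \<and> a = a'"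
proof -
  have "(((k * (T x + 1) + t) * K + i) * cells_count x + z) = (((k' * (T x + 1) + t') * K + i') * cells_count x + z') \<and> a = a'"
    using assms(1)[unfolded var_def] assms(5,9) by (rule mixed_radix_inj)
  moreover from this have "(k * (T x + 1) + t) * K + i = (k' * (T x + 1) + t') * K + i' \<and> z = z'"
    using assms(4,8) by (intro mixed_radix_inj) auto
  moreover from this have "k * (T x + 1) + t = k' * (T x + 1) + t' \<and> i = i'"
    using assms(3,7) by (intro mixed_radix_inj) auto
  moreover from this have "k = k' \<and> t = t'"
    using assms(2,6) by (intro mixed_radix_inj[of k "T x + 1"]) auto
  ultimately show ?thesis by blast
qed

end

locale valid_tableau = tableau +
  assumes wf: "wf_tm V"
begin

lemma K: "1 \<le> K" using wf_tm_bounds[OF wf] by simp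

lemma set_codes: "set codes = {(s, rs). s < num_states V \<and> length rs = K \<and> set rs \<subseteq> {..<num_symbols V}}"
  by (auto simp: codes_def set_n_lists)

lemma value_count_gt:
  "a < num_symbols V \<Longrightarrow> a < value_count" "s < num_states V \<Longrightarrow> s < value_count" "c < length codes \<Longrightarrow> c < value_count"
  "0 < value_count" "2 < value_count" "separator < value_count" "blank < value_count" "start_state V < value_count" "1 < value_count"
  using wf_tm_bounds[OF wf] by (auto simp: value_count_def separator_def blank_def)

lemma T_bounds: "length x + cert x < T x" "poly p (length x + 1 + cert x) \<le> T x" "0 < cells_count x" "T x < cells_count x"
  by (auto simp: T_def cells_count_def)

end

lemma set_with_certificate: "\<forall>a\<in>set (with_certificate w u). a < 4"
  by (auto simp: with_certificate_def bit_symbol_def separator_def)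

lemma length_with_certificate [simp]: "length (with_certificate w u) = length w + 1 + length u"
  by (simp add: with_certificate_def)

lemma nth_with_certificate:
  "i < length w \<Longrightarrow> with_certificate w u ! i = bit_symbol (w ! i)"
  "with_certificate w u ! length w = separator"
  "j < length u \<Longrightarrow> with_certificate w u ! (length w + 1 + j) = bit_symbol (u ! j)"
  by (auto simp: with_certificate_def nth_append)

lemma letter_map_bit_symbol: "i < length w \<Longrightarrow> letter (map bit_symbol w) i = bit_symbol (w ! i)"
  by (auto simp: letter_def bit_symbol_def)

lemma literal_true_0 [simp]: "literal_true \<sigma> 0 = \<sigma> 0" "literal_true \<sigma> (Suc 0) \<longleftrightarrow> \<not> \<sigma> 0"
  using literal_true_simps[of \<sigma> 0] by simp_all

section \<open>Runs and satisfying assignments\<close>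

context valid_tableau
begin

definition run_state :: "nat list \<Rightarrow> nat \<Rightarrow> nat" where "run_state y t = fst (config_after V y t)"
definition run_cell :: "nat list \<Rightarrow> nat \<Rightarrow> nat \<Rightarrow> int \<Rightarrow> nat" where
  "run_cell y t i = fst (snd (config_after V y t) ! i)"
definition run_head :: "nat list \<Rightarrow> nat \<Rightarrow> nat \<Rightarrow> int" where
  "run_head y t i = snd (snd (config_after V y t) ! i)"
definition run_reads :: "nat list \<Rightarrow> nat \<Rightarrow> nat list" where
  "run_reads y t = map (\<lambda>i. run_cell y t i (run_head y t i)) [0..<K]"

lemma run_invariant:
  assumes "\<forall>a\<in>set y. a < 4"
  shows "run_state y t < num_states V" "length (snd (config_after V y t)) = K"
    "i < K \<Longrightarrow> run_cell y t i z < num_symbols V" "i < K \<Longrightarrow> \<bar>run_head y t i\<bar> \<le> int t"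
  using config_invariant[OF wf assms, of t] by (auto simp: run_state_def run_cell_def run_head_def)

lemma run_code:
  assumes "\<forall>a\<in>set y. a < 4"
  obtains c where "c < length codes" "codes ! c = (run_state y t, run_reads y t)"
proof -
  have "(run_state y t, run_reads y t) \<in> set codes"
    using run_invariant[OF assms] by (auto simp: set_codes run_reads_def)
  then show ?thesis using that by (auto simp: in_set_conv_nth)
qed

lemma run_step:
  assumes y: "\<forall>a\<in>set y. a < 4" and cl: "c < length codes"
    and c: "codes ! c = (run_state y t, run_reads y t)"
  shows "run_state y (Suc t) = new_state c"
    and "i < K \<Longrightarrow> run_cell y (Suc t) i = (run_cell y t i)(run_head y t i := new_symbol c i)"
    and "i < K \<Longrightarrow> run_head y (Suc t) i = run_head y t i + int (shift c i) - 1"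
proof -
  obtain s ts where st: "config_after V y t = (s, ts)" by fastforce
  have len: "length ts = K" using run_invariant(2)[OF y, of t] st by simp
  have rs: "map tape_read ts = run_reads y t"
  proof (rule nth_equalityI)
    fix i assume "i < length (map tape_read ts)"
    then show "map tape_read ts ! i = run_reads y t ! i"
      using len by (cases "ts ! i") (simp add: run_reads_def run_cell_def run_head_def st)
  qed (simp add: len run_reads_def)
  have next_eq: "config_after V y (Suc t) = (fst (effect V s (run_reads y t)),
      map2 tape_act (snd (effect V s (run_reads y t))) ts)"
    using st tm_step_effect[of V s ts] by (simp add: config_after_def rs)
  have s: "s = run_state y t" by (simp add: run_state_def st)
  show "run_state y (Suc t) = new_state c"
    by (simp add: run_state_def next_eq new_state_def c cl) (simp add: s run_state_def)
  have sl: "s < num_states V" using run_invariant(1)[OF y, of t] by (simp add: s)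
  have rl: "length (run_reads y t) = K" by (simp add: run_reads_def)
  have rv: "\<forall>a\<in>set (run_reads y t). a < num_symbols V"
    using run_invariant(3)[OF y] by (auto simp: run_reads_def)
  have el: "length (snd (effect V s (run_reads y t))) = K" by (rule effect_wf(2)[OF wf sl rl rv])
  assume i: "i < K"
  obtain a mv where am: "snd (effect V s (run_reads y t)) ! i = (a, mv)" by fastforce
  obtain f h where fh: "ts ! i = (f, h)" by fastforce
  have n: "snd (config_after V y (Suc t)) ! i = (f(h := a), h + move_offset mv)"
    using i len el by (simp add: next_eq am fh)
  show "run_cell y (Suc t) i = (run_cell y t i)(run_head y t i := new_symbol c i)"
    unfolding run_cell_def run_head_def n new_symbol_def c by (simp add: st fh s[symmetric] am cl i)
  show "run_head y (Suc t) i = run_head y t i + int (shift c i) - 1"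
    unfolding run_head_def n shift_def c by (simp add: st fh s[symmetric] am move_offset_code cl i)
qed

lemma run_initial:
  assumes i: "i < K"
  shows "run_state y 0 = start_state V" "run_head y 0 i = 0"
    "run_cell y 0 i z = (if i = 0 \<and> 0 \<le> z \<and> z < int (length y) then y ! nat z else blank)"
proof -
  have 1: "snd (config_after V y 0) ! i = (if i = 0 then input_tape y else input_tape [])"
    using i by (cases i) (auto simp: config_after_def initial_config_def)
  show "run_state y 0 = start_state V" by (simp add: run_state_def config_after_def initial_config_def)
  show "run_head y 0 i = 0" unfolding run_head_def 1 by (simp add: input_tape_def)
  show "run_cell y 0 i z = (if i = 0 \<and> 0 \<le> z \<and> z < int (length y) then y ! nat z else blank)"
    unfolding run_cell_def 1 by (simp add: input_tape_def)
qed

text \<open>By induction on time, every fact of the run is true under \<open>\<sigma>\<close>. The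
  assignment may make further facts true, which does no harm: the actual state at time
  \<open>T x\<close> is among the true ones, and the clauses of type 10 admit only the accepting
  state.\<close>

lemma satisfies_sound:
  assumes x: "x = map bit_symbol w" and sat: "satisfies x \<sigma>"
  shows "\<exists>u. length u \<le> cert x \<and> run_state (with_certificate w u) (T x) = accept_state V"
proof -
  let ?n = "length x"
  have S: "\<exists>s<K + 2. literal_true \<sigma> (clause x k t i z z' a s)"
    if "k < 11" "t \<le> T x" "i < K" "z < cells_count x" "z' < cells_count x" "a < value_count" for k t i z z' a
    using sat that unfolding satisfies_def by blast
  have K0: "0 < K" using K by simp
  note v = value_count_gt and Tb = T_bounds[of x]
  have s0: "\<sigma> (state_var x 0 (start_state V))"
    using S[of 0 0 0 0 0 0] K0 v Tb by (auto simp: clause_def)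
  have s1: "\<sigma> (head_var x 0 i (T x))" if "i < K" for i
    using S[of 1 0 i 0 0 0] that v Tb by (auto simp: clause_def)
  have s2a: "\<sigma> (cell_var x 0 i z blank)"
    if "i < K" "z < cells_count x" "i \<noteq> 0 \<or> z < T x \<or> T x + ?n + cert x < z" for i z
    using S[of 2 0 i z 0 0] that v Tb by (auto simp: clause_def split: if_splits)
  have s2b: "\<sigma> (cell_var x 0 0 z (letter x (z - T x)))" if "T x \<le> z" "z < T x + ?n" for z
    using S[of 2 0 0 z 0 0] that v Tb K0 by (auto simp: clause_def cells_count_def split: if_splits)
  have s2c: "\<sigma> (cell_var x 0 0 (T x + ?n) separator)"
    using S[of 2 0 0 "T x + ?n" 0 0] v Tb K0 by (auto simp: clause_def cells_count_def split: if_splits)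
  have s2d: "\<exists>s\<le>2. \<sigma> (cell_var x 0 0 z s)" if "T x + ?n < z" "z \<le> T x + ?n + cert x" for z
  proof -
    have "z < cells_count x" using that Tb by (simp add: cells_count_def)
    then obtain s where "literal_true \<sigma> (clause x 2 0 0 z 0 0 s)" using S[of 2 0 0 z 0 0] v Tb K0 by auto
    then have "\<sigma> (cell_var x 0 0 z (min s 2))" using that by (auto simp: clause_def)
    then show ?thesis by (meson min.cobounded2)
  qed
  have s3: "\<sigma> (cell_var x 0 0 (z + 1) blank)"
    if "T x + ?n < z" "z < T x + ?n + cert x" "\<sigma> (cell_var x 0 0 z blank)" for z
  proof -
    have "z < cells_count x" using that Tb by (simp add: cells_count_def)
    then show ?thesis using S[of 3 0 0 z 0 0] that v Tb K0 by (auto simp: clause_def split: if_splits)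
  qed
  have s4: "\<sigma> (read_var x t i a)"
    if "t \<le> T x" "i < K" "z < cells_count x" "a < num_symbols V" "\<sigma> (head_var x t i z)" "\<sigma> (cell_var x t i z a)" for t i z a
    using S[of 4 t i z 0 a] that v Tb by (auto simp: clause_def split: if_splits)
  have s5: "\<sigma> (code_var x t c)"
    if t: "t \<le> T x" and c: "c < length codes" "\<sigma> (state_var x t (old_state c))"
      "\<And>i. i < K \<Longrightarrow> \<sigma> (read_var x t i (old_symbol c i))" for t c
  proof -
    obtain s where s: "s < K + 2" "literal_true \<sigma> (clause x 5 t 0 0 0 c s)"
      using S[of 5 t 0 0 0 c] t c v Tb K0 by auto
    then show ?thesis using c(1,2) c(3)[of "s - 2"] by (auto simp: clause_def split: if_splits)
  qed
  have s6: "\<sigma> (state_var x (Suc t) (new_state c))" if "t < T x" "c < length codes" "\<sigma> (code_var x t c)" for t c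
    using S[of 6 t 0 0 0 c] that v Tb K0 by (auto simp: clause_def split: if_splits)
  have s7: "\<sigma> (head_var x (Suc t) i (z + shift c i - 1))"
    if "t < T x" "c < length codes" "i < K" "z < cells_count x" "1 \<le> z + shift c i"
      "z + shift c i - 1 < cells_count x" "\<sigma> (code_var x t c)" "\<sigma> (head_var x t i z)" for t c i z
    using S[of 7 t i z 0 c] that v Tb by (auto simp: clause_def split: if_splits)
  have s8: "\<sigma> (cell_var x (Suc t) i z (new_symbol c i))"
    if "t < T x" "c < length codes" "i < K" "z < cells_count x" "\<sigma> (code_var x t c)" "\<sigma> (head_var x t i z)" for t c i z
    using S[of 8 t i z 0 c] that v Tb by (auto simp: clause_def split: if_splits)
  have s9: "\<sigma> (cell_var x (Suc t) i z' a)"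
    if "t < T x" "i < K" "z < cells_count x" "z' < cells_count x" "z \<noteq> z'" "a < num_symbols V"
      "\<sigma> (head_var x t i z)" "\<sigma> (cell_var x t i z' a)" for t i z z' a
    using S[of 9 t i z z' a] that v Tb by (auto simp: clause_def split: if_splits)
  have s10: "\<not> \<sigma> (state_var x (T x) a)" if "a < num_states V" "a \<noteq> accept_state V" for a
    using S[of 10 0 0 0 0 a] that v Tb K0 by (auto simp: clause_def split: if_splits)
  \<comment> \<open>Several symbols may be true in one certificate cell. The certificate ends before
    the first cell whose blank is true, and up to there 2 takes precedence over 1.\<close>
  define B where "B i \<longleftrightarrow> \<sigma> (cell_var x 0 0 (T x + ?n + 1 + i) blank)" for i
  define l where "l = (LEAST i. i = cert x \<or> B i)"
  have l: "l = cert x \<or> B l" unfolding l_def by (rule LeastI[of _ "cert x"]) simp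
  have l_le: "l \<le> cert x" unfolding l_def by (rule Least_le) simp
  have nB: "\<not> B i" if "i < l" for i using not_less_Least[of i "\<lambda>i. i = cert x \<or> B i"] that by (simp add: l_def)
  have B: "B i" if "l \<le> i" "i < cert x" for i
    using that
  proof (induction i rule: dec_induct)
    case base
    then show ?case using l by auto
  next
    case (step i)
    then show ?case using s3[of "T x + ?n + 1 + i"] by (simp add: B_def)
  qed
  define u where "u = map (\<lambda>i. \<sigma> (cell_var x 0 0 (T x + ?n + 1 + i) 2)) [0..<l]"
  define y where "y = with_certificate w u"
  have len_u: "length u = l" by (simp add: u_def)
  have n: "?n = length w" by (simp add: x)
  have y4: "\<forall>a\<in>set y. a < 4" unfolding y_def by (rule set_with_certificate)
  have init: "\<sigma> (cell_var x 0 i z (run_cell y 0 i (int z - int (T x))))" if i: "i < K" and z: "z < cells_count x" for i z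
  proof (cases "i = 0 \<and> T x \<le> z \<and> z \<le> T x + ?n + cert x")
    case False
    then have "run_cell y 0 i (int z - int (T x)) = blank"
      unfolding run_initial(3)[OF i] using l_le by (auto simp: y_def len_u n)
    then show ?thesis using s2a[OF i z] False by auto
  next
    case True
    then obtain j where j: "z = T x + j" "j \<le> ?n + cert x" by (metis add.assoc le_Suc_ex nat_add_left_cancel_le)
    have c: "run_cell y 0 i (int z - int (T x)) = (if j < length y then y ! j else blank)"
      unfolding run_initial(3)[OF i] using True by (simp add: j)
    consider "j < ?n" | "j = ?n" | k where "j = ?n + 1 + k" "k < l" | k where "j = ?n + 1 + k" "l \<le> k" "k < cert x"
    proof (cases "j \<le> ?n")
      case True
      then show thesis using that(1,2) by linarith
    next
      case False
      define k where "k = j - ?n - 1"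
      then have "j = ?n + 1 + k" "k < cert x" using False j(2) by linarith+
      then show thesis using that(3,4)[of k] by linarith
    qed
    then show ?thesis
    proof cases
      case 1
      then have "y ! j = letter x j" by (simp add: y_def n nth_with_certificate x letter_map_bit_symbol)
      then show ?thesis using 1 s2b[of z] True c by (simp add: j y_def n)
    next
      case 2
      then show ?thesis using s2c True c by (simp add: j y_def n nth_with_certificate)
    next
      case 3
      have "y ! j = bit_symbol (u ! k)" using 3 nth_with_certificate(3)[of k u w] by (simp add: y_def n len_u)
      then have yj: "y ! j = (if \<sigma> (cell_var x 0 0 z 2) then 2 else 1)"
        using 3 by (simp add: u_def bit_symbol_def j add.assoc)
      have "j < length y" using 3 by (simp add: y_def n len_u)
      then have c': "run_cell y 0 i (int z - int (T x)) = (if \<sigma> (cell_var x 0 0 z 2) then 2 else 1)" using c yj by simp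
      have "\<not> \<sigma> (cell_var x 0 0 z 0)" using nB[OF 3(2)] 3(1) by (simp add: B_def j blank_def add.assoc)
      moreover obtain s where "s \<le> 2" "\<sigma> (cell_var x 0 0 z s)" using s2d[of z] 3 l_le by (auto simp: j)
      ultimately have "\<sigma> (cell_var x 0 0 z 1) \<or> \<sigma> (cell_var x 0 0 z 2)"
        by (metis One_nat_def Suc_1 le_SucE le_zero_eq)
      then show ?thesis using True unfolding c' by auto
    next
      case 4
      then have "\<not> j < length y" by (simp add: y_def n len_u)
      then show ?thesis using B[OF 4(2,3)] True c by (simp add: B_def j 4(1) add.assoc)
    qed
  qed
  have hz: "nat (run_head y t i + int (T x)) < cells_count x" "int (nat (run_head y t i + int (T x))) = run_head y t i + int (T x)"
    if "t \<le> T x" "i < K" for t i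
    using run_invariant(4)[OF y4 that(2), of t] that(1) by (auto simp: cells_count_def)
  have run: "\<sigma> (state_var x t (run_state y t)) \<and>
      (\<forall>i<K. \<sigma> (head_var x t i (nat (run_head y t i + int (T x)))) \<and>
        (\<forall>z<cells_count x. \<sigma> (cell_var x t i z (run_cell y t i (int z - int (T x))))))" if "t \<le> T x" for t
    using that
  proof (induction t)
    case 0
    then show ?case using s0 s1 init run_initial K0 by auto
  next
    case (Suc t)
    then have t: "t < T x" "t \<le> T x" by auto
    have IH: "\<sigma> (state_var x t (run_state y t))" "\<And>i. i < K \<Longrightarrow> \<sigma> (head_var x t i (nat (run_head y t i + int (T x))))"
      "\<And>i z. i < K \<Longrightarrow> z < cells_count x \<Longrightarrow> \<sigma> (cell_var x t i z (run_cell y t i (int z - int (T x))))"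
      using Suc by auto
    obtain c where c: "c < length codes" "codes ! c = (run_state y t, run_reads y t)"
      using run_code[OF y4] by blast
    have rd: "\<sigma> (read_var x t i (run_cell y t i (run_head y t i)))" if i: "i < K" for i
    proof (rule s4[OF t(2) i hz(1)[OF t(2) i] run_invariant(3)[OF y4 i] IH(2)[OF i]])
      show "\<sigma> (cell_var x t i (nat (run_head y t i + int (T x))) (run_cell y t i (run_head y t i)))"
        using IH(3)[OF i hz(1)[OF t(2) i]] hz(2)[OF t(2) i] by simp
    qed
    have code: "\<sigma> (code_var x t c)"
    proof (rule s5[OF t(2) c(1)])
      show "\<sigma> (state_var x t (old_state c))" using IH(1) by (simp add: old_state_def c)
      show "\<sigma> (read_var x t i (old_symbol c i))" if "i < K" for i
        using rd[OF that] that by (simp add: old_symbol_def c run_reads_def)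
    qed
    note step = run_step[OF y4 c]
    have "\<sigma> (state_var x (Suc t) (run_state y (Suc t)))" using s6[OF t(1) c(1) code] by (simp add: step(1))
    moreover have "\<sigma> (head_var x (Suc t) i (nat (run_head y (Suc t) i + int (T x))))" if i: "i < K" for i
    proof -
      let ?z = "nat (run_head y t i + int (T x))"
      have e: "int (nat (run_head y (Suc t) i + int (T x))) = int ?z + int (shift c i) - 1"
        using hz(2)[OF t(2) i] hz(2)[OF Suc.prems i] step(3)[OF i] by simp
      have "1 \<le> ?z + shift c i" "nat (run_head y (Suc t) i + int (T x)) = ?z + shift c i - 1" using e by linarith+
      then show ?thesis
        using s7[OF t(1) c(1) i hz(1)[OF t(2) i] _ _ code IH(2)[OF i]] hz(1)[OF Suc.prems i] by simp
    qed
    moreover have "\<sigma> (cell_var x (Suc t) i z (run_cell y (Suc t) i (int z - int (T x))))"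
      if i: "i < K" and z: "z < cells_count x" for i z
    proof (cases "int z - int (T x) = run_head y t i")
      case True
      then have "z = nat (run_head y t i + int (T x))" by linarith
      then have "\<sigma> (head_var x t i z)" using IH(2)[OF i] by simp
      then have "\<sigma> (cell_var x (Suc t) i z (new_symbol c i))" using s8[OF t(1) c(1) i z code] by blast
      then show ?thesis using True by (simp add: step(2)[OF i])
    next
      case False
      have "nat (run_head y t i + int (T x)) \<noteq> z" using False hz(2)[OF t(2) i] by linarith
      then have "\<sigma> (cell_var x (Suc t) i z (run_cell y t i (int z - int (T x))))"
        using s9[OF t(1) i hz(1)[OF t(2) i] z _ run_invariant(3)[OF y4 i] IH(2)[OF i] IH(3)[OF i z]] by blast
      then show ?thesis using False by (simp add: step(2)[OF i])
    qed
    ultimately show ?case by blast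
  qed
  have "run_state y (T x) = accept_state V"
    using run[of "T x"] s10[OF run_invariant(1)[OF y4]] by blast
  then show ?thesis using len_u l_le unfolding y_def by blast
qed

definition fact :: "nat list \<Rightarrow> nat list \<Rightarrow> nat \<Rightarrow> nat \<Rightarrow> nat \<Rightarrow> nat \<Rightarrow> nat \<Rightarrow> bool" where
  "fact x y k t i z a \<longleftrightarrow>
    (if k = 0 then a = run_state y t
     else if k = 1 then int z = run_head y t i + int (T x)
     else if k = 2 then a = run_cell y t i (int z - int (T x))
     else if k = 3 then a = run_cell y t i (run_head y t i)
     else codes ! a = (run_state y t, run_reads y t))"

text \<open>The assignment is read off the run: a variable is true iff the fact that it codes holds.
  By \<open>var_inj\<close> no variable codes two facts.\<close>

lemma satisfies_complete:
  assumes x: "x = map bit_symbol w" and u: "length u \<le> cert x"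
    and acc: "run_state (with_certificate w u) (T x) = accept_state V"
  shows "\<exists>\<sigma>. satisfies x \<sigma>"
proof -
  define y where "y = with_certificate w u"
  let ?n = "length x"
  have n: "?n = length w" by (simp add: x)
  have y4: "\<forall>a\<in>set y. a < 4" unfolding y_def by (rule set_with_certificate)
  define \<sigma> where "\<sigma> v \<longleftrightarrow> (\<exists>k t i z a. t \<le> T x \<and> i < K \<and> z < cells_count x \<and> a < value_count \<and>
    v = var x k t i z a \<and> fact x y k t i z a)" for v
  have \<sigma>: "\<sigma> (var x k t i z a) \<longleftrightarrow> fact x y k t i z a"
    if "t \<le> T x" "i < K" "z < cells_count x" "a < value_count" for k t i z a
    unfolding \<sigma>_def using var_inj[OF _ that] that by blast
  have K0: "0 < K" using K by simp
  note v = value_count_gt and Tb = T_bounds[of x]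
  have sv: "\<sigma> (state_var x t a) \<longleftrightarrow> a = run_state y t" if "t \<le> T x" "a < value_count" for t a
    using \<sigma>[of t 0 0 a 0] that K0 Tb by (simp add: state_var_def fact_def)
  have hv: "\<sigma> (head_var x t i z) \<longleftrightarrow> int z = run_head y t i + int (T x)" if "t \<le> T x" "i < K" "z < cells_count x" for t i z
    using \<sigma>[of t i z 0 1] that v by (simp add: head_var_def fact_def)
  have cv: "\<sigma> (cell_var x t i z a) \<longleftrightarrow> a = run_cell y t i (int z - int (T x))"
    if "t \<le> T x" "i < K" "z < cells_count x" "a < value_count" for t i z a
    using \<sigma>[of t i z a 2] that by (simp add: cell_var_def fact_def)
  have rv: "\<sigma> (read_var x t i a) \<longleftrightarrow> a = run_cell y t i (run_head y t i)"
    if "t \<le> T x" "i < K" "a < value_count" for t i a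
    using \<sigma>[of t i 0 a 3] that Tb by (simp add: read_var_def fact_def)
  have dv: "\<sigma> (code_var x t a) \<longleftrightarrow> codes ! a = (run_state y t, run_reads y t)"
    if "t \<le> T x" "a < value_count" for t a
    using \<sigma>[of t 0 0 a 4] that K0 Tb by (simp add: code_var_def fact_def)
  have three: "\<exists>s<K + 2. P s" if "P 0 \<or> P 1 \<or> P 2" for P :: "nat \<Rightarrow> bool"
    using that K0 by (elim disjE) (force intro: exI[of _ 0], force intro: exI[of _ 1], force intro: exI[of _ 2])
  have cell0: "run_cell y 0 i (int z - int (T x)) =
      (if i = 0 \<and> T x \<le> z \<and> z < T x + length y then y ! (z - T x) else blank)" if "i < K" for i z
    unfolding run_initial(3)[OF that] by (auto simp: nat_diff_distrib')
  have ylen: "length y = ?n + 1 + length u" by (simp add: y_def n)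
  have "\<exists>s<K + 2. literal_true \<sigma> (clause x k t i z z' a s)"
    if k: "k < 11" and t: "t \<le> T x" and i: "i < K" and z: "z < cells_count x" and z': "z' < cells_count x"
      and a: "a < value_count" for k t i z z' a
  proof -
    let ?l = "\<lambda>s. literal_true \<sigma> (clause x k t i z z' a s)"
    consider "k = 0" | "k = 1" | "k = 2" | "k = 3" | "k = 4" | "k = 5" | "k = 6" | "k = 7" | "k = 8" | "k = 9" | "k = 10"
    proof -
      have "k = 0 \<or> k = 1 \<or> k = 2 \<or> k = 3 \<or> k = 4 \<or> k = 5 \<or> k = 6 \<or> k = 7 \<or> k = 8 \<or> k = 9 \<or> k = 10"
        using k by arith
      then show thesis using that by blast
    qed
    then show ?thesis
    proof cases
      case 1
      then have "?l 0" using sv[of 0 "start_state V"] v run_initial(1)[OF i] by (simp add: clause_def)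
      then show ?thesis by - (rule three, blast)
    next
      case 2
      then have "?l 0" using hv[of 0 i "T x"] i Tb run_initial(2)[OF i] by (simp add: clause_def)
      then show ?thesis by - (rule three, blast)
    next
      case 3
      note c1 = cv[of 0 i z, OF _ i z] and c2 = cell0[OF i, of z]
      consider "i = 0" "T x \<le> z" "z < T x + ?n" | "i = 0" "z = T x + ?n" |
        "i = 0" "T x + ?n < z" "z \<le> T x + ?n + cert x" | "i \<noteq> 0 \<or> z < T x \<or> T x + ?n + cert x < z"
        using linorder_less_linear[of z "T x + ?n"] by (meson not_le_imp_less)
      then show ?thesis
      proof cases
        case 1
        then have "y ! (z - T x) = letter x (z - T x)"
          by (simp add: y_def n nth_with_certificate x letter_map_bit_symbol)
        moreover have "letter x (z - T x) < value_count" using v(1) wf_tm_bounds(1)[OF wf] by (auto simp: letter_def)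
        ultimately have "?l 0" using 1 \<open>k = 2\<close> c1[of "letter x (z - T x)"] c2 by (simp add: clause_def ylen)
        then show ?thesis by - (rule three, blast)
      next
        case 2
        have sep: "y ! ?n = separator" by (simp add: y_def n nth_with_certificate)
        from 2 have "?l 0" using \<open>k = 2\<close> c1[of separator] c2 v sep by (simp add: clause_def ylen)
        then show ?thesis by - (rule three, blast)
      next
        case 3
        have "run_cell y 0 i (int z - int (T x)) \<le> 2"
        proof (cases "z < T x + length y")
          case True
          define j where "j = z - T x - length w - 1"
          then have j: "z = T x + (length w + 1 + j)" "j < length u" using 3 True by (simp_all add: n ylen)
          have "run_cell y 0 i (int z - int (T x)) = y ! (z - T x)" using c2 3 True by simp
          also have "\<dots> = bit_symbol (u ! j)" using j nth_with_certificate(3)[OF j(2), of w] by (simp add: y_def)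
          finally show ?thesis by (simp add: bit_symbol_def)
        qed (use c2 in \<open>simp add: blank_def\<close>)
        then have "\<exists>s\<le>2. s = run_cell y 0 i (int z - int (T x))" by blast
        then obtain s where s: "s \<le> 2" "s = run_cell y 0 i (int z - int (T x))" by blast
        then have "?l s" using \<open>k = 2\<close> 3 c1[of s] v by (simp add: clause_def)
        then show ?thesis using s(1) K0 by (intro exI[of _ s]) auto
      next
        case 4
        then have "?l 0" using \<open>k = 2\<close> c1[of blank] c2 v u by (auto simp: clause_def ylen)
        then show ?thesis by - (rule three, blast)
      qed
    next
      case 4
      show ?thesis
      proof (cases "T x + ?n < z \<and> z < T x + ?n + cert x")
        case True
        then have "z + 1 < cells_count x" using Tb by (simp add: cells_count_def)
        then have c: "\<sigma> (cell_var x 0 0 z blank) \<longleftrightarrow> blank = run_cell y 0 0 (int z - int (T x))"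
          "\<sigma> (cell_var x 0 0 (z + 1) blank) \<longleftrightarrow> blank = run_cell y 0 0 (int (z + 1) - int (T x))"
          using cv[of 0 0 z blank] cv[of 0 0 "z + 1" blank] K0 v z by auto
        have "run_cell y 0 0 (int (z + 1) - int (T x)) = blank" if "run_cell y 0 0 (int z - int (T x)) = blank"
        proof (rule ccontr)
          assume nb: "run_cell y 0 0 (int (z + 1) - int (T x)) \<noteq> blank"
          then have "z + 1 < T x + length y" using cell0[OF K0, of "z + 1"] by presburger
          define j where "j = z - T x - length w - 1"
          have j: "z = T x + (length w + 1 + j)" "j < length u"
            using True \<open>z + 1 < T x + length y\<close> unfolding j_def n ylen by linarith+
          have "run_cell y 0 0 (int z - int (T x)) = bit_symbol (u ! j)"
            using cell0[OF K0, of z] nth_with_certificate(3)[OF j(2), of w, folded y_def] j by (simp add: ylen n)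
          then show False using that by (simp add: bit_symbol_def blank_def split: if_splits)
        qed
        then have "?l 0 \<or> ?l 1" using True \<open>k = 3\<close> c by (auto simp: clause_def)
        then show ?thesis by - (rule three, blast)
      next
        case False
        then have "?l 0 \<or> ?l 1" using \<open>k = 3\<close> by (auto simp: clause_def)
        then show ?thesis by - (rule three, blast)
      qed
    next
      case 5
      have "?l 0 \<or> ?l 1 \<or> ?l 2"
      proof (cases "a < num_symbols V \<and> int z = run_head y t i + int (T x) \<and> a = run_cell y t i (int z - int (T x))")
        case True
        have as: "a < num_symbols V" using True by blast
        have "int z = run_head y t i + int (T x)" using True by blast
        then have hz: "int z - int (T x) = run_head y t i" by simp
        have "a = run_cell y t i (int z - int (T x))" using True by blast
        then have "\<sigma> (read_var x t i a)" unfolding rv[OF t i a] hz .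
        then have "?l 2" using \<open>k = 4\<close> as by (simp add: clause_def)
        then show ?thesis by blast
      qed (use \<open>k = 4\<close> hv[OF t i z] cv[OF t i z a] in \<open>auto simp: clause_def\<close>)
      then show ?thesis by (rule three)
    next
      case 6
      show ?thesis
      proof (cases "a < length codes")
        case True
        obtain rs where rs: "codes ! a = (old_state a, rs)" using True by (simp add: old_state_def) (metis prod.collapse)
        have "codes ! a \<in> set codes" using True by (rule nth_mem)
        then have m: "old_state a < num_states V \<and> length rs = K \<and> set rs \<subseteq> {..<num_symbols V}"
          unfolding set_codes rs by simp
        have o: "old_state a < num_states V" "length rs = K" "\<And>j. j < K \<Longrightarrow> rs ! j < num_symbols V"
          using m by (auto, metis lessThan_iff nth_mem subsetD)
        have os: "old_symbol a j = rs ! j" if "j < K" for j using True that by (simp add: old_symbol_def rs)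
        show ?thesis
        proof (cases "old_state a = run_state y t \<and> (\<forall>j<K. rs ! j = run_cell y t j (run_head y t j))")
          case True
          then have "rs = run_reads y t" using o(2) by (intro nth_equalityI) (auto simp: run_reads_def)
          then have "?l 1" using \<open>k = 5\<close> \<open>a < length codes\<close> dv[OF t a] rs True by (simp add: clause_def)
          then show ?thesis by - (rule three, blast)
        next
          case False
          then consider "old_state a \<noteq> run_state y t" | j where "j < K" "rs ! j \<noteq> run_cell y t j (run_head y t j)" by blast
          then show ?thesis
          proof cases
            case 1
            then have "?l 0" using \<open>k = 5\<close> \<open>a < length codes\<close> sv[OF t v(2)[OF o(1)]] by (simp add: clause_def)
            then show ?thesis by - (rule three, blast)
          next
            case 2
            then have "?l (j + 2)" using \<open>k = 5\<close> \<open>a < length codes\<close> rv[OF t 2(1) v(1)[OF o(3)[OF 2(1)]]]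
              by (simp add: clause_def os)
            then show ?thesis using 2(1) by (intro exI[of _ "j + 2"]) simp
          qed
        qed
      next
        case False
        then have "?l 0 \<or> ?l 1" using \<open>k = 5\<close> by (simp add: clause_def)
        then show ?thesis by - (rule three, blast)
      qed
    next
      case 7
      have "?l 0 \<or> ?l 1"
      proof (cases "a < length codes \<and> t < T x \<and> codes ! a = (run_state y t, run_reads y t)")
        case True
        then have "t < T x" by blast
        then have t1: "t + 1 \<le> T x" by simp
        have "a < length codes" "codes ! a = (run_state y t, run_reads y t)" using True by blast+
        then have "new_state a = run_state y (Suc t)" using run_step(1)[OF y4] by simp
        then have "\<sigma> (state_var x (t + 1) (new_state a))"
          using sv[OF t1 v(2)[OF run_invariant(1)[OF y4, of "Suc t"]]] by simp
        moreover have "a < length codes" "t < T x" using True by blast+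
        ultimately have "?l 1" using \<open>k = 6\<close> by (simp add: clause_def)
        then show ?thesis by blast
      qed (use \<open>k = 6\<close> dv[OF t a] in \<open>auto simp: clause_def\<close>)
      then show ?thesis by - (rule three, blast)
    next
      case 8
      have "?l 0 \<or> ?l 1 \<or> ?l 2"
      proof (cases "a < length codes \<and> t < T x \<and> codes ! a = (run_state y t, run_reads y t) \<and>
          1 \<le> z + shift a i \<and> z + shift a i - 1 < cells_count x \<and> int z = run_head y t i + int (T x)")
        case True
        then have "t < T x" by blast
        then have t1: "t + 1 \<le> T x" by simp
        have "run_head y (Suc t) i = run_head y t i + int (shift a i) - 1" using run_step(3)[OF y4 _ _ i] True by blast
        moreover have "int z = run_head y t i + int (T x)" "1 \<le> z + shift a i" using True by blast+
        ultimately have "int (z + shift a i - 1) = run_head y (t + 1) i + int (T x)" by simp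
        moreover have "z + shift a i - 1 < cells_count x" using True by blast
        ultimately have "\<sigma> (head_var x (t + 1) i (z + shift a i - 1))" using hv[OF t1 i] by blast
        moreover have "a < length codes" "t < T x" "1 \<le> z + shift a i" "z + shift a i - 1 < cells_count x" using True by blast+
        ultimately have "?l 2" using \<open>k = 7\<close> by (simp add: clause_def)
        then show ?thesis by blast
      qed (use \<open>k = 7\<close> dv[OF t a] hv[OF t i z] in \<open>auto simp: clause_def\<close>)
      then show ?thesis by (rule three)
    next
      case 9
      have "?l 0 \<or> ?l 1 \<or> ?l 2"
      proof (cases "a < length codes \<and> t < T x \<and> codes ! a = (run_state y t, run_reads y t) \<and> int z = run_head y t i + int (T x)")
        case True
        then have "t < T x" "int z = run_head y t i + int (T x)" by blast+
        then have t1: "t + 1 \<le> T x" and hz: "int z - int (T x) = run_head y t i" by simp_all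
        have c: "run_cell y (Suc t) i = (run_cell y t i)(run_head y t i := new_symbol a i)"
          using run_step(2)[OF y4 _ _ i] True by blast
        then have e: "new_symbol a i = run_cell y (Suc t) i (int z - int (T x))" by (simp add: hz)
        then have "new_symbol a i < value_count" using v(1) run_invariant(3)[OF y4 i] by simp
        then have "\<sigma> (cell_var x (t + 1) i z (new_symbol a i))" using cv[OF t1 i z] e by simp
        moreover have "a < length codes" "t < T x" using True by blast+
        ultimately have "?l 2" using \<open>k = 8\<close> by (simp add: clause_def)
        then show ?thesis by blast
      qed (use \<open>k = 8\<close> dv[OF t a] hv[OF t i z] in \<open>auto simp: clause_def\<close>)
      then show ?thesis by (rule three)
    next
      case 10
      have "?l 0 \<or> ?l 1 \<or> ?l 2"
      proof (cases "a < num_symbols V \<and> t < T x \<and> z \<noteq> z' \<and> int z = run_head y t i + int (T x) \<and>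
          a = run_cell y t i (int z' - int (T x))")
        case True
        then have "t < T x" "int z = run_head y t i + int (T x)" "z \<noteq> z'" and av: "a = run_cell y t i (int z' - int (T x))" by blast+
        then have t1: "t + 1 \<le> T x" and hz: "int z' - int (T x) \<noteq> run_head y t i" by simp_all
        obtain c where "c < length codes" "codes ! c = (run_state y t, run_reads y t)" using run_code[OF y4] by blast
        then have "run_cell y (Suc t) i (int z' - int (T x)) = run_cell y t i (int z' - int (T x))"
          using run_step(2)[OF y4 _ _ i] hz by simp
        then have "\<sigma> (cell_var x (t + 1) i z' a)" using cv[OF t1 i z' a] av by simp
        moreover have "a < num_symbols V" "t < T x" "z \<noteq> z'" using True by blast+
        ultimately have "?l 2" using \<open>k = 9\<close> by (simp add: clause_def)
        then show ?thesis by blast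
      qed (use \<open>k = 9\<close> hv[OF t i z] cv[OF t i z' a] in \<open>auto simp: clause_def\<close>)
      then show ?thesis by (rule three)
    next
      case 11
      have "?l 0 \<or> ?l 1" using \<open>k = 10\<close> sv[of "T x" a] a acc by (auto simp: clause_def y_def)
      then show ?thesis by - (rule three, blast)
    qed
  qed
  then have "satisfies x \<sigma>" unfolding satisfies_def by blast
  then show ?thesis by blast
qed


theorem satisfiable_iff:
  assumes "x = map bit_symbol w"
    and "\<And>u. halts_within V (with_certificate w u) (poly p (length (with_certificate w u)))"
  shows "(\<exists>\<sigma>. satisfies x \<sigma>) \<longleftrightarrow> (\<exists>u. length u \<le> cert x \<and> accepts V (with_certificate w u))"
proof -
  have "accepts V (with_certificate w u) \<longleftrightarrow> run_state (with_certificate w u) (T x) = accept_state V"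
    if "length u \<le> cert x" for u
  proof -
    have "poly p (length (with_certificate w u)) \<le> poly p (length x + 1 + cert x)"
      using that by (intro poly_mono_nat) (simp add: assms(1))
    then have "poly p (length (with_certificate w u)) \<le> T x" using T_bounds(2)[of x] by simp
    then show ?thesis using accepts_iff_at[OF assms(2)[of u]] by (simp add: run_state_def)
  qed
  then show ?thesis using satisfies_sound[OF assms(1)] satisfies_complete[OF assms(1)] by blast
qed

end

section \<open>Polynomial-time computability of the clauses\<close>

lemma polytime_table2:
  assumes "polytime f" "polytime g"
  shows "polytime (\<lambda>w e. if f w e < n \<and> g w e < m then h (f w e) (g w e) else 0)"
proof -
  have "polytime (\<lambda>w e. if g w e < m then
      (if f w e * m + g w e < n * m then h ((f w e * m + g w e) div m) ((f w e * m + g w e) mod m) else 0) else 0)"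
    by (intro polytime_if polytime_less polytime_const assms
        polytime_table[of "\<lambda>w e. f w e * m + g w e" "n * m" "\<lambda>c. h (c div m) (c mod m)"]
        polytime_add polytime_mult)
  moreover have "(if b < m then (if a * m + b < n * m then h ((a * m + b) div m) ((a * m + b) mod m) else 0) else 0) =
      (if a < n \<and> b < m then h a b else 0)" for a b
  proof (cases "b < m")
    case True
    have "a * m + b < n * m \<longleftrightarrow> a < n"
    proof
      assume "a < n"
      then have "Suc a * m \<le> n * m" by (intro mult_right_mono) auto
      then show "a * m + b < n * m" using True by simp
    next
      assume "a * m + b < n * m"
      then have "a * m < n * m" by (rule add_lessD1)
      then show "a < n" by simp
    qed
    then show ?thesis using True by simp
  qed simp
  ultimately show ?thesis by simp
qed

context tableau
begin

lemma polytime_cert [polytime_intros]: "polytime (\<lambda>x e. cert x)"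
  unfolding cert_def by (intro polytime_intros)

lemma polytime_T [polytime_intros]: "polytime (\<lambda>x e. T x)"
  unfolding T_def by (intro polytime_intros)

lemma polytime_cells_count [polytime_intros]: "polytime (\<lambda>x e. cells_count x)"
  unfolding cells_count_def by (intro polytime_intros)

lemma polytime_var_count [polytime_intros]: "polytime (\<lambda>x e. var_count x)"
  unfolding var_count_def by (intro polytime_intros)

lemma polytime_var_code:
  assumes "polytime k" "polytime t" "polytime i" "polytime z" "polytime a"
  shows "polytime (\<lambda>x e. var x (k x e) (t x e) (i x e) (z x e) (a x e))"
  unfolding var_def by (intro polytime_intros assms)

lemma polytime_state_var [polytime_intros]:
  "polytime t \<Longrightarrow> polytime a \<Longrightarrow> polytime (\<lambda>x e. state_var x (t x e) (a x e))"
  unfolding state_var_def by (intro polytime_var_code polytime_const)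

lemma polytime_head_var [polytime_intros]:
  "polytime t \<Longrightarrow> polytime i \<Longrightarrow> polytime z \<Longrightarrow> polytime (\<lambda>x e. head_var x (t x e) (i x e) (z x e))"
  unfolding head_var_def by (intro polytime_var_code polytime_const)

lemma polytime_cell_var [polytime_intros]:
  "polytime t \<Longrightarrow> polytime i \<Longrightarrow> polytime z \<Longrightarrow> polytime a \<Longrightarrow>
    polytime (\<lambda>x e. cell_var x (t x e) (i x e) (z x e) (a x e))"
  unfolding cell_var_def by (intro polytime_var_code polytime_const)

lemma polytime_read_var [polytime_intros]:
  "polytime t \<Longrightarrow> polytime i \<Longrightarrow> polytime a \<Longrightarrow> polytime (\<lambda>x e. read_var x (t x e) (i x e) (a x e))"
  unfolding read_var_def by (intro polytime_var_code polytime_const)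

lemma polytime_code_var [polytime_intros]:
  "polytime t \<Longrightarrow> polytime a \<Longrightarrow> polytime (\<lambda>x e. code_var x (t x e) (a x e))"
  unfolding code_var_def by (intro polytime_var_code polytime_const)

lemma polytime_old_state [polytime_intros]: "polytime f \<Longrightarrow> polytime (\<lambda>x e. old_state (f x e))"
  unfolding old_state_def by (rule polytime_table)

lemma polytime_new_state [polytime_intros]: "polytime f \<Longrightarrow> polytime (\<lambda>x e. new_state (f x e))"
  unfolding new_state_def by (rule polytime_table)

lemma polytime_old_symbol [polytime_intros]:
  "polytime f \<Longrightarrow> polytime g \<Longrightarrow> polytime (\<lambda>x e. old_symbol (f x e) (g x e))"
  unfolding old_symbol_def by (rule polytime_table2)

lemma polytime_new_symbol [polytime_intros]:
  "polytime f \<Longrightarrow> polytime g \<Longrightarrow> polytime (\<lambda>x e. new_symbol (f x e) (g x e))"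
  unfolding new_symbol_def by (rule polytime_table2)

lemma polytime_shift [polytime_intros]:
  "polytime f \<Longrightarrow> polytime g \<Longrightarrow> polytime (\<lambda>x e. shift (f x e) (g x e))"
  unfolding shift_def by (rule polytime_table2)

lemma polytime_clause:
  assumes "polytime k" "polytime t" "polytime i" "polytime z" "polytime z'" "polytime a" "polytime s"
  shows "polytime (\<lambda>x e. clause x (k x e) (t x e) (i x e) (z x e) (z' x e) (a x e) (s x e))"
  unfolding clause_def by (intro polytime_intros assms)

definition clause_count :: "nat list \<Rightarrow> nat" where
  "clause_count x = 11 * (T x + 1) * K * cells_count x * cells_count x * value_count"

definition set_count :: "nat list \<Rightarrow> nat" where "set_count x = var_count x + clause_count x"

text \<open>
  The first \<open>var_count x\<close> sets consist of a variable and its negation: a hitting set of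
  \<open>var_count x\<close> literals then contains exactly one of them.
\<close>

definition element :: "nat list \<Rightarrow> nat \<Rightarrow> nat \<Rightarrow> nat" where
  "element x j s =
    (if j < var_count x then 2 * j + (if s = 0 then 0 else 1)
     else clause x
       ((j - var_count x) div value_count div cells_count x div cells_count x div K div (T x + 1))
       ((j - var_count x) div value_count div cells_count x div cells_count x div K mod (T x + 1))
       ((j - var_count x) div value_count div cells_count x div cells_count x mod K)
       ((j - var_count x) div value_count div cells_count x mod cells_count x)
       ((j - var_count x) div value_count mod cells_count x)
       ((j - var_count x) mod value_count) s)"

lemma polytime_set_count [polytime_intros]: "polytime (\<lambda>x e. set_count x)"
  unfolding set_count_def clause_count_def by (intro polytime_intros)

lemma polytime_element [polytime_intros]:
  assumes "polytime f" "polytime g"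
  shows "polytime (\<lambda>x e. element x (f x e) (g x e))"
  unfolding element_def by (intro polytime_intros polytime_clause assms)

end

section \<open>From clauses to sets of literals\<close>

context valid_tableau
begin

lemma pos_neg_less: "v < n \<Longrightarrow> pos v < 2 * n" "v < n \<Longrightarrow> neg v < 2 * n"
  by simp_all

lemma if_lessI: "(P \<Longrightarrow> a < c) \<Longrightarrow> (\<not> P \<Longrightarrow> b < c) \<Longrightarrow> (if P then a else b) < (c :: nat)"
  by simp

lemma tables_less:
  assumes "c < length codes"
  shows "old_state c < num_states V" "new_state c < num_states V"
    "i < K \<Longrightarrow> old_symbol c i < num_symbols V" "i < K \<Longrightarrow> new_symbol c i < num_symbols V"
proof -
  obtain s rs where c: "codes ! c = (s, rs)" by fastforce
  have "codes ! c \<in> set codes" using assms by (rule nth_mem)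
  then have m: "s < num_states V" "length rs = K" "set rs \<subseteq> {..<num_symbols V}"
    unfolding set_codes c by auto
  have rs: "\<forall>a\<in>set rs. a < num_symbols V" using m(3) by auto
  show "old_state c < num_states V" using m assms by (simp add: old_state_def c)
  show "new_state c < num_states V" using effect_wf(1)[OF wf m(1,2) rs] assms by (simp add: new_state_def c)
  assume i: "i < K"
  show "old_symbol c i < num_symbols V" using m(2) rs i assms by (simp add: old_symbol_def c)
  show "new_symbol c i < num_symbols V"
    using effect_wf(3)[OF wf m(1,2) rs i] assms i by (simp add: new_symbol_def c)
qed

lemma clause_less:
  assumes r: "t \<le> T x" "i < K" "z < cells_count x" "z' < cells_count x" "a < value_count" "s < K + 2"
  shows "clause x k t i z z' a s < 2 * var_count x"
proof -
  have K0: "0 < K" using K by simp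
  note Tb = T_bounds[of x] and v = value_count_gt and d = tables_less
  have sv: "state_var x t a < var_count x" if "t \<le> T x" "a < value_count" for t a
    unfolding state_var_def using that K0 Tb by (intro var_less) auto
  have hv: "head_var x t i z < var_count x" if "t \<le> T x" "i < K" "z < cells_count x" for t i z
    unfolding head_var_def using that v by (intro var_less) auto
  have cv: "cell_var x t i z a < var_count x" if "t \<le> T x" "i < K" "z < cells_count x" "a < value_count" for t i z a
    unfolding cell_var_def using that by (intro var_less) auto
  have rv: "read_var x t i a < var_count x" if "t \<le> T x" "i < K" "a < value_count" for t i a
    unfolding read_var_def using that Tb by (intro var_less) auto
  have dv: "code_var x t a < var_count x" if "t \<le> T x" "a < value_count" for t a
    unfolding code_var_def using that K0 Tb by (intro var_less) auto
  have v0: "0 < var_count x" using sv[of 0 0] v by simp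
  have l: "letter x j < value_count" for j
    using v(1)[of "letter x j"] wf_tm_bounds(1)[OF wf] by (auto simp: letter_def)
  have m2: "min s 2 < value_count" for s using v(5) by simp
  have z1: "z + 1 < cells_count x" if "z < T x + length x + cert x" using that Tb by (simp add: cells_count_def)
  have s2: "s - 2 < K" using r(6) K0 by simp
  show ?thesis
    unfolding clause_def
    by (intro if_lessI pos_neg_less sv hv cv rv dv v0; (elim conjE)?)
      (use r K0 v Tb s2 in \<open>auto intro: l m2 d v(1-3) z1 simp: cells_count_def\<close>)
qed


text \<open>The parameters are the digits of \<open>j\<close> in mixed radix, so that a single index
  runs through all clauses.\<close>

lemma all_clauses_iff:
  "(\<forall>j<clause_count x. P
      (j div value_count div cells_count x div cells_count x div K div (T x + 1))
      (j div value_count div cells_count x div cells_count x div K mod (T x + 1))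
      (j div value_count div cells_count x div cells_count x mod K)
      (j div value_count div cells_count x mod cells_count x)
      (j div value_count mod cells_count x) (j mod value_count)) \<longleftrightarrow>
   (\<forall>k<11. \<forall>t\<le>T x. \<forall>i<K. \<forall>z<cells_count x. \<forall>z'<cells_count x. \<forall>a<value_count. P k t i z z' a)"
  (is "?A \<longleftrightarrow> ?B")
proof
  assume A: ?A
  show ?B
  proof (intro allI impI)
    fix k t i z z' a :: nat
    assume r: "k < 11" "t \<le> T x" "i < K" "z < cells_count x" "z' < cells_count x" "a < value_count"
    have step: "u * b + y < U * b" if "u < U" "y < b" for u U b y :: nat
    proof -
      have "u * b + y < Suc u * b" using that by simp
      also have "\<dots> \<le> U * b" using that by (intro mult_right_mono) auto
      finally show ?thesis .
    qed
    have dm: "(u * b + y) div b = u" "(u * b + y) mod b = y" if "y < b" for u b y :: nat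
      using that by simp_all
    let ?j = "((((k * (T x + 1) + t) * K + i) * cells_count x + z) * cells_count x + z') * value_count + a"
    have "?j < clause_count x" unfolding clause_count_def by (intro step) (use r in auto)
    moreover have "?j div value_count = (((k * (T x + 1) + t) * K + i) * cells_count x + z) * cells_count x + z'"
      "?j mod value_count = a" using r by simp_all
    moreover have "((((k * (T x + 1) + t) * K + i) * cells_count x + z) * cells_count x + z') div cells_count x =
        ((k * (T x + 1) + t) * K + i) * cells_count x + z"
      "((((k * (T x + 1) + t) * K + i) * cells_count x + z) * cells_count x + z') mod cells_count x = z'" using r by simp_all
    moreover have "(((k * (T x + 1) + t) * K + i) * cells_count x + z) div cells_count x = (k * (T x + 1) + t) * K + i"
      "(((k * (T x + 1) + t) * K + i) * cells_count x + z) mod cells_count x = z" using r by simp_all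
    moreover have "((k * (T x + 1) + t) * K + i) div K = k * (T x + 1) + t" "((k * (T x + 1) + t) * K + i) mod K = i"
      using r by simp_all
    moreover have "(k * (T x + 1) + t) div (T x + 1) = k" "(k * (T x + 1) + t) mod (T x + 1) = t"
      by (rule dm, use r in simp)+
    ultimately show "P k t i z z' a" using A[rule_format, of ?j] by (simp only:)
  qed
next
  have K0: "0 < K" using K by simp
  have c0: "0 < cells_count x" by (rule T_bounds)
  have v0: "0 < value_count" by (rule value_count_gt)
  assume B: ?B
  show ?A
  proof (intro allI impI)
    fix j assume j: "j < clause_count x"
    have "j div value_count div cells_count x div cells_count x div K div (T x + 1) < 11"
    proof -
      have s: "u div b < U" if "u < U * b" for u U b :: nat using that by (simp add: less_mult_imp_div_less)
      show ?thesis by (intro s) (use j in \<open>simp add: clause_count_def\<close>)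
    qed
    moreover have "j div value_count div cells_count x div cells_count x div K mod (T x + 1) \<le> T x"
      using mod_less_divisor[of "T x + 1" "j div value_count div cells_count x div cells_count x div K"] by linarith
    ultimately show "P (j div value_count div cells_count x div cells_count x div K div (T x + 1))
      (j div value_count div cells_count x div cells_count x div K mod (T x + 1))
      (j div value_count div cells_count x div cells_count x mod K)
      (j div value_count div cells_count x mod cells_count x)
      (j div value_count mod cells_count x) (j mod value_count)"
      using B K0 c0 v0 by simp
  qed
qed

lemma all_sets_iff:
  "(\<forall>j<set_count x. \<exists>s<K + 2. element x j s \<in> S) \<longleftrightarrow>
    (\<forall>v<var_count x. pos v \<in> S \<or> neg v \<in> S) \<and>
    (\<forall>k<11. \<forall>t\<le>T x. \<forall>i<K. \<forall>z<cells_count x. \<forall>z'<cells_count x. \<forall>a<value_count.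
       \<exists>s<K + 2. clause x k t i z z' a s \<in> S)"
proof -
  have split: "(\<forall>j<n + m. Q j) \<longleftrightarrow> (\<forall>j<n. Q j) \<and> (\<forall>j<m. Q (n + j))" for n m :: nat and Q
    by (metis add_less_cancel_left le_Suc_ex not_le trans_less_add1)
  have "(\<exists>s<K + 2. element x v s \<in> S) \<longleftrightarrow> pos v \<in> S \<or> neg v \<in> S" if "v < var_count x" for v
  proof
    assume "pos v \<in> S \<or> neg v \<in> S"
    then have "element x v 0 \<in> S \<or> element x v 1 \<in> S" using that by (simp add: element_def)
    then show "\<exists>s<K + 2. element x v s \<in> S" by (elim disjE) (force intro: exI[of _ 0], force intro: exI[of _ 1])
  qed (use that in \<open>auto simp: element_def split: if_splits\<close>)
  moreover have "element x (var_count x + j) s = clause x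
      (j div value_count div cells_count x div cells_count x div K div (T x + 1))
      (j div value_count div cells_count x div cells_count x div K mod (T x + 1))
      (j div value_count div cells_count x div cells_count x mod K)
      (j div value_count div cells_count x mod cells_count x)
      (j div value_count mod cells_count x) (j mod value_count) s" for j s
    by (simp add: element_def)
  ultimately show ?thesis
    unfolding set_count_def split using all_clauses_iff[of x "\<lambda>k t i z z' a. \<exists>s<K + 2. clause x k t i z z' a s \<in> S"]
    by simp
qed

lemma element_less: "j < set_count x \<Longrightarrow> s < K + 2 \<Longrightarrow> element x j s < 2 * var_count x"
proof (cases "j < var_count x")
  case False
  have K0: "0 < K" using K by simp
  assume "s < K + 2"
  then show ?thesis using False unfolding element_def
    using mod_less_divisor[of "T x + 1"] K0 T_bounds(3)[of x] value_count_gt(4) by (auto intro!: clause_less simp: less_Suc_eq_le)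
qed (auto simp: element_def)

lemma two_sets: "2 \<le> set_count x"
proof -
  have "0 < var_count x" using var_less[of 0 0 x 0 0 0] K T_bounds[of x] value_count_gt by auto
  moreover have "0 < clause_count x" using K T_bounds(3)[of x] value_count_gt(4) by (simp add: clause_count_def)
  ultimately show ?thesis by (simp add: set_count_def)
qed

sublocale valid_gadget "var_count x" "set_count x" "K + 2" "element x" for x
  by unfold_locales (use K two_sets element_less in auto)

text \<open>The sets of complementary pairs make \<open>l div 2\<close> map a hitting set onto the
  variables. As the hitting set has only \<open>var_count x\<close> elements, this map is injective,
  so no variable is chosen with both signs.\<close>

lemma hitting_iff_satisfiable: "(\<exists>S. hitting x S) \<longleftrightarrow> (\<exists>\<sigma>. satisfies x \<sigma>)"
proof
  assume "\<exists>S. hitting x S"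
  then obtain S where S: "S \<subseteq> {..<2 * var_count x}" "card S = var_count x"
    "\<forall>v<var_count x. pos v \<in> S \<or> neg v \<in> S"
    "\<forall>k<11. \<forall>t\<le>T x. \<forall>i<K. \<forall>z<cells_count x. \<forall>z'<cells_count x. \<forall>a<value_count.
       \<exists>s<K + 2. clause x k t i z z' a s \<in> S"
    unfolding hitting_def all_sets_iff by blast
  have "(\<lambda>l. l div 2) ` S = {..<var_count x}"
  proof
    show "(\<lambda>l. l div 2) ` S \<subseteq> {..<var_count x}" using S(1) by auto
    show "{..<var_count x} \<subseteq> (\<lambda>l. l div 2) ` S"
    proof
      fix v assume "v \<in> {..<var_count x}"
      then have "pos v \<in> S \<or> neg v \<in> S" using S(3) by simp
      moreover have "pos v div 2 = v" "neg v div 2 = v" by simp_all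
      ultimately show "v \<in> (\<lambda>l. l div 2) ` S" by (metis image_eqI)
    qed
  qed
  then have inj: "inj_on (\<lambda>l. l div 2) S"
    using S(1,2) by (intro eq_card_imp_inj_on) (auto intro: finite_subset)
  have "literal_true (\<lambda>v. pos v \<in> S) l" if "l \<in> S" for l
  proof (cases "even l")
    case True
    then show ?thesis using that by (auto elim!: evenE)
  next
    case False
    then obtain v where v: "l = neg v" by (elim oddE)
    have "pos v \<notin> S"
    proof
      assume "pos v \<in> S"
      then have "pos v = neg v" using inj_onD[OF inj, of "pos v" "neg v"] that v by simp
      then show False by presburger
    qed
    then show ?thesis by (simp add: v)
  qed
  then have "satisfies x (\<lambda>v. pos v \<in> S)" unfolding satisfies_def using S(4) by meson
  then show "\<exists>\<sigma>. satisfies x \<sigma>" by blast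
next
  assume "\<exists>\<sigma>. satisfies x \<sigma>"
  then obtain \<sigma> where \<sigma>: "satisfies x \<sigma>" by blast
  define S where "S = {l. l < 2 * var_count x \<and> literal_true \<sigma> l}"
  have "bij_betw (\<lambda>v. if \<sigma> v then pos v else neg v) {..<var_count x} S"
  proof (rule bij_betw_byWitness[where f' = "\<lambda>l. l div 2"])
    show "\<forall>l\<in>S. (if \<sigma> (l div 2) then pos (l div 2) else neg (l div 2)) = l"
      by (auto simp: S_def literal_true_def)
  qed (auto simp: S_def)
  then have "card S = var_count x" using bij_betw_same_card by fastforce
  moreover have "\<forall>k<11. \<forall>t\<le>T x. \<forall>i<K. \<forall>z<cells_count x. \<forall>z'<cells_count x. \<forall>a<value_count.
       \<exists>s<K + 2. clause x k t i z z' a s \<in> S"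
  proof (intro allI impI)
    fix k t i z z' a :: nat
    assume r: "k < 11" "t \<le> T x" "i < K" "z < cells_count x" "z' < cells_count x" "a < value_count"
    then obtain s where s: "s < K + 2" "literal_true \<sigma> (clause x k t i z z' a s)"
      using \<sigma> unfolding satisfies_def by blast
    then have "clause x k t i z z' a s \<in> S" using clause_less[OF r(2-6) s(1)] by (simp add: S_def)
    then show "\<exists>s<K + 2. clause x k t i z z' a s \<in> S" using s(1) by blast
  qed
  moreover have "pos v \<in> S \<or> neg v \<in> S" if "v < var_count x" for v using that by (auto simp: S_def)
  ultimately have "hitting x S" unfolding hitting_def all_sets_iff by (auto simp: S_def)
  then show "\<exists>S. hitting x S" by blast
qed

end

subsection \<open>The reduction\<close>

text \<open>Rewrites a filtered product as nested concatenations, the form covered by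
  \<open>emits_intros\<close>.\<close>

lemma encode_list_filter_product:
  "encode_list f (map g (filter P (List.product xs ys))) =
    concat (map (\<lambda>x. concat (map (\<lambda>y. if P (x, y) then True # f (g (x, y)) else []) ys)) xs) @ [False]"
proof -
  have 1: "concat (map (\<lambda>x. True # f x) (map g (filter P (map (Pair x) ys)))) =
      concat (map (\<lambda>y. if P (x, y) then True # f (g (x, y)) else []) ys)" for x
    by (induction ys) auto
  have "concat (map (\<lambda>x. True # f x) (map g (filter P (List.product xs ys)))) =
      concat (map (\<lambda>x. concat (map (\<lambda>y. if P (x, y) then True # f (g (x, y)) else []) ys)) xs)"
    by (induction xs) (use 1 in auto)
  then show ?thesis by (simp add: encode_list_def)
qed

context gadget
begin

definition edge_list :: "(nat \<times> nat) list" where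
  "edge_list = map (\<lambda>(x, v). (x, nX + v)) (filter (\<lambda>(x, v). adj v x) (List.product [0..<nX] [0..<nY]))"

definition encoding :: "bool list" where
  "encoding = encode_lists [0..<nX] (map ((+) nX) [0..<nY]) edge_list crossings"

lemma encoding_conv: "encoding =
  (concat (map (\<lambda>x. True # encode_nat x) [0..<nX]) @ [False]) @
  (concat (map (\<lambda>v. True # encode_nat (nX + v)) [0..<nY]) @ [False]) @
  (concat (map (\<lambda>x. concat (map (\<lambda>v. if adj v x then True # (encode_nat x @ encode_nat (nX + v)) else [])
     [0..<nY])) [0..<nX]) @ [False]) @ encode_nat crossings"
proof -
  have "encode_list encode_edge edge_list =
     concat (map (\<lambda>x. concat (map (\<lambda>v. if adj v x then True # (encode_nat x @ encode_nat (nX + v)) else [])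
     [0..<nY])) [0..<nX]) @ [False]"
    unfolding edge_list_def encode_list_filter_product prod.case encode_edge.simps ..
  then show ?thesis
    unfolding encoding_def encode_lists_def by (simp add: encode_list_def comp_def)
qed

end

context valid_gadget
begin

lemma encodes_graph_instance: "encodes encoding graph_instance"
proof -
  have "sorted_wrt (strictly_below order) [0..<nX]"
    unfolding order_def sorted_wrt_iff_nth_less by (auto simp: strict_order_nat)
  moreover have "set (map ((+) nX) [0..<nY]) = {nX..<nX + nY}" by (simp add: add.commute)
  moreover have "distinct edge_list"
    unfolding edge_list_def by (auto simp: distinct_map inj_on_def distinct_product)
  moreover have "set edge_list = edges" unfolding edge_list_def edges_def by force
  moreover have "distinct (map ((+) nX) [0..<nY])" by (simp add: distinct_map)
  ultimately show ?thesis
    unfolding graph_instance_def encodes.simps encoding_def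
    by (intro exI[of _ "[0..<nX]"] exI[of _ "map ((+) nX) [0..<nY]"] exI[of _ edge_list]) auto
qed

lemma encoding_in_language_iff: "encoding \<in> One_Sided_k_Planarity \<longleftrightarrow> (\<exists>S. hitting S)"
proof -
  have "encoding \<in> One_Sided_k_Planarity \<longleftrightarrow> yes_instance graph_instance"
    unfolding One_Sided_k_Planarity_def
    using encodes_unique[OF _ valid_graph_instance _ encodes_graph_instance] valid_graph_instance
      encodes_graph_instance by blast
  then show ?thesis using yes_instance_iff_hitting by simp
qed

end

context tableau
begin

lemma polytime_gadget [polytime_intros]:
  "polytime (\<lambda>x e. gadget.item_edges (var_count x) (set_count x) (K + 2))"
  "polytime (\<lambda>x e. gadget.bound (var_count x) (set_count x) (K + 2))"
  "polytime (\<lambda>x e. gadget.ge (var_count x) (set_count x) (K + 2))"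
  "polytime (\<lambda>x e. gadget.gd (var_count x) (set_count x) (K + 2))"
  "polytime (\<lambda>x e. gadget.gc (var_count x) (set_count x) (K + 2))"
  "polytime (\<lambda>x e. gadget.crossings (var_count x) (set_count x) (K + 2))"
  "polytime (\<lambda>x e. gadget.half_width (var_count x) (K + 2))"
  "polytime (\<lambda>x e. gadget.width (var_count x) (K + 2))"
  "polytime (\<lambda>x e. gadget.center (var_count x) (set_count x) (K + 2))"
  "polytime (\<lambda>x e. gadget.center_end (var_count x) (set_count x) (K + 2))"
  "polytime (\<lambda>x e. gadget.nX (var_count x) (set_count x) (K + 2))"
  "polytime (\<lambda>x e. gadget.nY (var_count x))"
  unfolding gadget.crossings_def gadget.nX_def gadget.nY_def gadget.center_end_def gadget.center_def
    gadget.width_def gadget.half_width_def gadget.gc_def gadget.gd_def gadget.ge_def gadget.bound_def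
    gadget.item_edges_def
  by (intro polytime_intros)+

lemma polytime_adj:
  assumes "polytime f" "polytime g"
  shows "polytime (\<lambda>x e. of_bool (gadget.adj (var_count x) (set_count x) (K + 2) (element x) (f x e) (g x e)))"
proof (rule polytime_subst2[OF _ assms])
  show "polytime (\<lambda>x e. of_bool (gadget.adj (var_count x) (set_count x) (K + 2) (element x) (e 0) (e (Suc 0))))"
    unfolding gadget.adj_def by (intro polytime_intros)
qed

lemma emits_encoding:
  "emits (\<lambda>x e. gadget.encoding (var_count x) (set_count x) (K + 2) (element x))"
  unfolding gadget.encoding_conv by (intro emits_intros polytime_intros polytime_adj)

end

theorem One_Sided_k_Planarity_NP_hard: "NP_hard One_Sided_k_Planarity"
  unfolding NP_hard_def
proof
  fix A assume "A \<in> NP"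
  then obtain V and p q :: "nat poly" where V: "wf_tm V"
    "\<And>w u. halts_within V (with_certificate w u) (poly p (length (with_certificate w u)))"
    "\<And>w. w \<in> A \<longleftrightarrow> (\<exists>u. length u \<le> poly q (length w) \<and> accepts V (with_certificate w u))"
    unfolding NP_def by blast
  interpret valid_tableau V p q by unfold_locales (rule V(1))
  let ?f = "\<lambda>w. encoding (map bit_symbol w)"
  have "poly_time_computable ?f" using emits_imp_computable[OF emits_encoding] by simp
  moreover have "w \<in> A \<longleftrightarrow> ?f w \<in> One_Sided_k_Planarity" for w
    unfolding encoding_in_language_iff hitting_iff_satisfiable satisfiable_iff[OF refl V(2)] V(3)
    by (simp add: cert_def)
  ultimately show "poly_reducible A One_Sided_k_Planarity" unfolding poly_reducible_def by blast
qed

section \<open>Membership in NP\<close>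

subsection \<open>Reading an encoding by positions\<close>

text \<open>Applied to predicates that hold on an initial segment, this is the position of the first
  failure: a bounded sum in place of a search.\<close>

definition count :: "nat \<Rightarrow> (nat \<Rightarrow> bool) \<Rightarrow> nat" where "count n P = (\<Sum>i<n. of_bool (P i))"

lemma count_eq:
  assumes "\<And>i. i < n \<Longrightarrow> P i \<longleftrightarrow> i < l" "l \<le> n"
  shows "count n P = l"
proof -
  have "count n P = (\<Sum>i<n. of_bool (i < l))" unfolding count_def using assms(1) by (intro sum.cong) auto
  also have "\<dots> = card ({..<n} \<inter> {i. i < l})" by (subst sum_of_bool_eq) auto
  also have "{..<n} \<inter> {i. i < l} = {..<l}" using assms(2) by auto
  finally show ?thesis by simp
qed

lemma less_countD:
  assumes "\<And>i. P (Suc i) \<Longrightarrow> P i" "i < count n P"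
  shows "P i"
proof (rule ccontr)
  assume n: "\<not> P i"
  have "\<not> P j" if "i \<le> j" for j using that n assms(1) by (induction j rule: dec_induct) auto
  then have "{..<n} \<inter> {j. P j} \<subseteq> {..<i}" by (auto simp: not_le[symmetric])
  then have "card ({..<n} \<inter> {j. P j}) \<le> i" using card_mono[of "{..<i}"] by fastforce
  then show False using assms(2) by (simp add: count_def sum_of_bool_eq)
qed

lemma count_le: "count n P \<le> n"
  unfolding count_def by (rule order_trans[OF sum_bounded_above[of _ _ 1]]) auto

text \<open>Symbols 1, 2 and 3 are the bits \<open>False\<close> and \<open>True\<close> and the
  separator. The inner quantifier stops the count at the first place where a digit would have to be
  announced by \<open>True\<close> but is not.\<close>

definition num_len :: "nat list \<Rightarrow> nat \<Rightarrow> nat" where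
  "num_len x p = count (length x) (\<lambda>i. \<forall>j<Suc i. letter x (p + 2 * j) = 2)"

definition after :: "nat list \<Rightarrow> nat \<Rightarrow> nat" where "after x p = p + 2 * num_len x p + 1"

text \<open>Digits come least significant first, so the last condition excludes leading zeros: only
  then is the word the encoding of a number.\<close>

definition num_ok :: "nat list \<Rightarrow> nat \<Rightarrow> bool" where
  "num_ok x p \<longleftrightarrow> letter x (p + 2 * num_len x p) = 1 \<and>
     (\<forall>i<num_len x p. letter x (p + 2 * i + 1) = 1 \<or> letter x (p + 2 * i + 1) = 2) \<and>
     (num_len x p = 0 \<or> letter x (p + 2 * num_len x p - 1) = 2)"

text \<open>A vertex name can be exponential in the length of the word and would not fit into a
  unary register, so names are compared as words.\<close>

definition same_num :: "nat list \<Rightarrow> nat \<Rightarrow> nat \<Rightarrow> bool" where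
  "same_num x p p' \<longleftrightarrow> num_len x p = num_len x p' \<and>
     (\<forall>i<num_len x p. letter x (p + 2 * i + 1) = letter x (p' + 2 * i + 1))"

lemma letter_pos: "letter x i \<noteq> 0 \<Longrightarrow> i < length x \<and> letter x i = x ! i"
  by (auto simp: letter_def split: if_splits)

lemma num_len_less:
  assumes "j < num_len x p"
  shows "letter x (p + 2 * j) = 2"
proof -
  have "\<forall>k<Suc j. letter x (p + 2 * k) = 2"
    by (rule less_countD[where P = "\<lambda>i. \<forall>k<Suc i. letter x (p + 2 * k) = 2", OF _ assms[unfolded num_len_def]]) auto
  then show ?thesis by blast
qed

lemma num_len_eq:
  assumes "\<And>j. j < l \<Longrightarrow> letter x (p + 2 * j) = 2" "letter x (p + 2 * l) \<noteq> 2"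
  shows "num_len x p = l"
  unfolding num_len_def
proof (rule count_eq)
  show "l \<le> length x"
  proof (cases l)
    case (Suc j)
    then show ?thesis using assms(1)[of j] letter_pos[of x "p + 2 * j"] by auto
  qed simp
  show "(\<forall>j<Suc i. letter x (p + 2 * j) = 2) \<longleftrightarrow> i < l" for i
    using assms by (metis less_Suc_eq_le not_le order_less_le_trans)
qed

definition holds_at :: "nat list \<Rightarrow> nat \<Rightarrow> bool list \<Rightarrow> bool" where
  "holds_at x p bs \<longleftrightarrow> p + length bs \<le> length x \<and> (\<forall>i<length bs. x ! (p + i) = bit_symbol (bs ! i))"

lemma holds_at_Nil [simp]: "holds_at x p [] \<longleftrightarrow> p \<le> length x"
  by (simp add: holds_at_def)

lemma holds_at_append: "holds_at x p (bs @ cs) \<longleftrightarrow> holds_at x p bs \<and> holds_at x (p + length bs) cs"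
proof
  assume "holds_at x p (bs @ cs)"
  then have a: "p + (length bs + length cs) \<le> length x"
    "\<And>i. i < length bs + length cs \<Longrightarrow> x ! (p + i) = bit_symbol ((bs @ cs) ! i)" by (auto simp: holds_at_def)
  show "holds_at x p bs \<and> holds_at x (p + length bs) cs"
    unfolding holds_at_def
  proof (intro conjI allI impI)
    show "x ! (p + i) = bit_symbol (bs ! i)" if "i < length bs" for i
      using a(2)[of i] that by (simp add: nth_append)
    show "x ! (p + length bs + i) = bit_symbol (cs ! i)" if "i < length cs" for i
      using a(2)[of "length bs + i"] that by (simp add: nth_append add.assoc)
  qed (use a(1) in auto)
next
  assume a: "holds_at x p bs \<and> holds_at x (p + length bs) cs"
  show "holds_at x p (bs @ cs)"
    unfolding holds_at_def
  proof (intro conjI allI impI)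
    show "x ! (p + i) = bit_symbol ((bs @ cs) ! i)" if "i < length (bs @ cs)" for i
    proof (cases "i < length bs")
      case True
      then show ?thesis using a by (simp add: holds_at_def nth_append)
    next
      case False
      then obtain j where "i = length bs + j" by (metis le_Suc_ex not_less)
      then show ?thesis using a that by (simp add: holds_at_def nth_append add.assoc)
    qed
  qed (use a in \<open>auto simp: holds_at_def\<close>)
qed

lemma bit_symbol_less: "bit_symbol b < 4" "bit_symbol b \<noteq> 0"
  by (auto simp: bit_symbol_def)

lemma holds_at_Cons: "holds_at x p (b # bs) \<longleftrightarrow> letter x p = bit_symbol b \<and> holds_at x (Suc p) bs"
proof -
  have "holds_at x p [b] \<longleftrightarrow> letter x p = bit_symbol b"
    using bit_symbol_less[of b] by (auto simp: holds_at_def letter_def)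
  then show ?thesis using holds_at_append[of x p "[b]" bs] by simp
qed

lemma holds_at_length: "holds_at x p bs \<Longrightarrow> p + length bs \<le> length x"
  by (simp add: holds_at_def)

lemma encode_nat_conv: "encode_nat n = concat (map (\<lambda>b. [True, b]) (binary n)) @ [False]"
  by (simp add: encode_nat_def encode_list_def)

lemma holds_at_pairs:
  "holds_at x p (concat (map (\<lambda>b. [True, b]) bs)) \<longleftrightarrow> p + 2 * length bs \<le> length x \<and>
     (\<forall>i<length bs. letter x (p + 2 * i) = 2 \<and> letter x (p + 2 * i + 1) = bit_symbol (bs ! i))"
proof (induction bs arbitrary: p)
  case (Cons b bs)
  have "(\<forall>i<length (b # bs). letter x (p + 2 * i) = 2 \<and> letter x (p + 2 * i + 1) = bit_symbol ((b # bs) ! i)) \<longleftrightarrow>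
     (letter x p = 2 \<and> letter x (p + 1) = bit_symbol b) \<and>
     (\<forall>i<length bs. letter x (Suc (Suc p) + 2 * i) = 2 \<and> letter x (Suc (Suc p) + 2 * i + 1) = bit_symbol (bs ! i))"
    by (auto simp: less_Suc_eq_0_disj)
  moreover have "holds_at x p (concat (map (\<lambda>b. [True, b]) (b # bs))) \<longleftrightarrow>
      letter x p = 2 \<and> letter x (p + 1) = bit_symbol b \<and> holds_at x (Suc (Suc p)) (concat (map (\<lambda>b. [True, b]) bs))"
    by (simp add: holds_at_Cons bit_symbol_def)
  moreover have "Suc (Suc p) + 2 * length bs \<le> length x \<longleftrightarrow> p + 2 * length (b # bs) \<le> length x" by simp
  ultimately show ?case using Cons[of "Suc (Suc p)"] by blast
qed simp

lemma length_encode_nat: "length (encode_nat n) = 2 * length (binary n) + 1"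
proof -
  have "length (concat (map (\<lambda>b. [True, b]) bs)) = 2 * length bs" for bs by (induction bs) auto
  then show ?thesis by (simp add: encode_nat_conv)
qed

lemma binary_eq_Nil: "binary n = [] \<longleftrightarrow> n = 0"
  by (simp add: binary.simps[of n])

lemma binary_last: "binary n \<noteq> [] \<Longrightarrow> last (binary n)"
proof (induction n rule: less_induct)
  case (less n)
  have n: "n \<noteq> 0" using less.prems by (simp add: binary_eq_Nil)
  show ?case
  proof (cases "n = 1")
    case True
    then show ?thesis by (simp add: binary.simps)
  next
    case False
    then have "n div 2 < n" "binary (n div 2) \<noteq> []" using n by (auto simp: binary_eq_Nil)
    then show ?thesis using less.IH n by (simp add: binary.simps[of n])
  qed
qed

lemma binary_surj: "bs = [] \<or> last bs \<Longrightarrow> \<exists>n. binary n = bs"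
proof (induction bs)
  case Nil
  have "binary 0 = []" by (simp add: binary.simps)
  then show ?case by blast
next
  case (Cons b bs)
  show ?case
  proof (cases "bs = []")
    case True
    then have "binary 1 = b # bs" using Cons.prems by (simp add: binary.simps)
    then show ?thesis by blast
  next
    case False
    then obtain n where n: "binary n = bs" using Cons by auto
    then have "n \<noteq> 0" using False by (auto simp: binary_eq_Nil)
    then have "binary (2 * n + of_bool b) = b # bs" using n by (simp add: binary.simps[of "2 * n + of_bool b"])
    then show ?thesis by blast
  qed
qed

lemma holds_encode_nat:
  assumes "holds_at x p (encode_nat n)"
  shows "num_len x p = length (binary n)" "after x p = p + length (encode_nat n)" "num_ok x p"
    "\<And>i. i < length (binary n) \<Longrightarrow> letter x (p + 2 * i + 1) = bit_symbol (binary n ! i)"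
proof -
  let ?l = "length (binary n)"
  have len: "length (concat (map (\<lambda>b. [True, b]) (binary n))) = 2 * ?l"
    using length_encode_nat[of n] by (simp add: encode_nat_conv)
  have b: "\<And>i. i < ?l \<Longrightarrow> letter x (p + 2 * i) = 2 \<and> letter x (p + 2 * i + 1) = bit_symbol (binary n ! i)"
    and e: "letter x (p + 2 * ?l) = 1"
    using assms unfolding encode_nat_conv holds_at_append holds_at_pairs len holds_at_Cons
    by (auto simp: bit_symbol_def)
  show l: "num_len x p = ?l" by (rule num_len_eq) (use b e in auto)
  show "after x p = p + length (encode_nat n)" by (simp add: after_def l length_encode_nat)
  show "letter x (p + 2 * i + 1) = bit_symbol (binary n ! i)" if "i < ?l" for i using b that by blast
  have "letter x (p + 2 * ?l - 1) = 2" if l0: "?l \<noteq> 0"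
  proof -
    obtain j where j: "?l = Suc j" using l0 by (metis not0_implies_Suc)
    have "binary n \<noteq> []" using l0 by auto
    then have "binary n ! j" using binary_last[of n] j by (simp add: last_conv_nth)
    then have "letter x (p + 2 * j + 1) = 2" using b[of j] j by (simp add: bit_symbol_def)
    then show ?thesis by (simp add: j)
  qed
  then show "num_ok x p" unfolding num_ok_def l using b e by (auto simp: bit_symbol_def)
qed

lemma num_ok_holds:
  assumes "num_ok x p"
  shows "\<exists>n. holds_at x p (encode_nat n)"
proof -
  let ?l = "num_len x p"
  define bs where "bs = map (\<lambda>i. letter x (p + 2 * i + 1) = 2) [0..<?l]"
  have "bs = [] \<or> last bs"
  proof (cases ?l)
    case (Suc j)
    then have "letter x (p + 2 * j + 1) = 2" using assms by (auto simp: num_ok_def)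
    then show ?thesis by (simp add: bs_def Suc)
  qed (simp add: bs_def)
  then obtain n where n: "binary n = bs" using binary_surj by blast
  have e: "letter x (p + 2 * ?l) = 1" using assms by (simp add: num_ok_def)
  have le: "Suc (p + 2 * ?l) \<le> length x" using e letter_pos[of x "p + 2 * ?l"] by simp
  have lb: "length bs = ?l" by (simp add: bs_def)
  have "letter x (p + 2 * i + 1) = bit_symbol (bs ! i)" if "i < ?l" for i
    using assms that by (auto simp: num_ok_def bs_def bit_symbol_def)
  then have "holds_at x p (concat (map (\<lambda>b. [True, b]) bs))"
    unfolding holds_at_pairs lb using num_len_less[of _ x p] le by simp
  moreover have "length (concat (map (\<lambda>b. [True, b]) bs)) = 2 * ?l"
    using length_encode_nat[of n] by (simp add: encode_nat_conv n lb)
  ultimately have "holds_at x p (encode_nat n)"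
    unfolding encode_nat_conv n holds_at_append using e le by (simp add: holds_at_Cons bit_symbol_def)
  then show ?thesis by blast
qed

lemma same_num_iff:
  assumes "holds_at x p (encode_nat m)" "holds_at x p' (encode_nat n)"
  shows "same_num x p p' \<longleftrightarrow> m = n"
proof
  note a = holds_encode_nat[OF assms(1)] and b = holds_encode_nat[OF assms(2)]
  assume s: "same_num x p p'"
  have "binary m = binary n"
  proof (rule nth_equalityI)
    show l: "length (binary m) = length (binary n)" using s a(1) b(1) by (simp add: same_num_def)
    fix i assume i: "i < length (binary m)"
    then have "bit_symbol (binary m ! i) = bit_symbol (binary n ! i)"
      using s a(1) a(4)[of i] b(4)[of i] l by (simp add: same_num_def)
    then show "binary m ! i = binary n ! i" by (auto simp: bit_symbol_def split: if_splits)
  qed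
  then show "m = n" by (rule binary_inj)
next
  note a = holds_encode_nat[OF assms(1)] and b = holds_encode_nat[OF assms(2)]
  assume "m = n"
  then show "same_num x p p'" using a b by (simp add: same_num_def)
qed

text \<open>The position of the bit in front of entry \<open>i\<close>. At the end of the list the
  position stays put, so that the entries form an initial segment for \<open>list_len\<close>; the
  minimum with \<open>length x\<close> keeps the recursion bounded on ill-formed input as
  well.\<close>

definition list_pos :: "(nat list \<Rightarrow> nat \<Rightarrow> nat) \<Rightarrow> nat list \<Rightarrow> nat \<Rightarrow> nat \<Rightarrow> nat" where
  "list_pos nxt x s i =
     rec_nat s (\<lambda>_ h. min (length x) (if letter x h = 2 then nxt x (h + 1) else h)) i"

definition list_len :: "(nat list \<Rightarrow> nat \<Rightarrow> nat) \<Rightarrow> nat list \<Rightarrow> nat \<Rightarrow> nat" where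
  "list_len nxt x s = count (length x) (\<lambda>i. letter x (list_pos nxt x s i) = 2)"

definition list_end :: "(nat list \<Rightarrow> nat \<Rightarrow> nat) \<Rightarrow> nat list \<Rightarrow> nat \<Rightarrow> nat" where
  "list_end nxt x s = list_pos nxt x s (list_len nxt x s) + 1"

definition list_ok :: "(nat list \<Rightarrow> nat \<Rightarrow> bool) \<Rightarrow> (nat list \<Rightarrow> nat \<Rightarrow> nat) \<Rightarrow> nat list \<Rightarrow> nat \<Rightarrow> bool" where
  "list_ok ok nxt x s \<longleftrightarrow> (\<forall>i<list_len nxt x s. ok x (list_pos nxt x s i + 1)) \<and>
     letter x (list_pos nxt x s (list_len nxt x s)) = 1"

lemma list_pos_simps [simp]:
  "list_pos nxt x s 0 = s"
  "list_pos nxt x s (Suc i) = min (length x)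
     (if letter x (list_pos nxt x s i) = 2 then nxt x (list_pos nxt x s i + 1) else list_pos nxt x s i)"
  by (simp_all add: list_pos_def)

text \<open>Abstracts from the kind of entry, because lists of vertices and lists of edges are read
  alike.\<close>

locale parser =
  fixes f :: "'a \<Rightarrow> bool list" and nxt :: "nat list \<Rightarrow> nat \<Rightarrow> nat" and ok :: "nat list \<Rightarrow> nat \<Rightarrow> bool"
  assumes holds: "\<And>x p a. holds_at x p (f a) \<Longrightarrow> nxt x p = p + length (f a) \<and> ok x p"
    and ok: "\<And>x p. ok x p \<Longrightarrow> \<exists>a. holds_at x p (f a)"
begin

lemma encode_list_simps:
  "encode_list f [] = [False]" "encode_list f (a # as) = True # f a @ encode_list f as"
  by (simp_all add: encode_list_def)

lemma encode_list_drop: "i < length as \<Longrightarrow> encode_list f (drop i as) = True # f (as ! i) @ encode_list f (drop (Suc i) as)"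
  by (subst Cons_nth_drop_Suc[symmetric]) (simp_all add: encode_list_simps)

lemma length_le_encode_list: "length as < length (encode_list f as)"
  by (induction as) (auto simp: encode_list_simps)

lemma holds_encode_list:
  assumes h: "holds_at x s (encode_list f as)"
  shows "list_len nxt x s = length as" "list_end nxt x s = s + length (encode_list f as)"
    "list_ok ok nxt x s" "\<And>i. i < length as \<Longrightarrow> holds_at x (list_pos nxt x s i + 1) (f (as ! i))"
proof -
  let ?p = "list_pos nxt x s"
  have p: "holds_at x (?p i) (encode_list f (drop i as)) \<and>
      ?p i + length (encode_list f (drop i as)) = s + length (encode_list f as)" if "i \<le> length as" for i
    using that
  proof (induction i)
    case 0
    then show ?case using h by simp
  next
    case (Suc i)
    then have IH: "holds_at x (?p i) (encode_list f (drop i as))"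
      "?p i + length (encode_list f (drop i as)) = s + length (encode_list f as)" by auto
    have d: "encode_list f (drop i as) = True # f (as ! i) @ encode_list f (drop (Suc i) as)"
      using Suc.prems by (intro encode_list_drop) simp
    have a: "letter x (?p i) = 2" "holds_at x (?p i + 1) (f (as ! i))"
      "holds_at x (?p i + 1 + length (f (as ! i))) (encode_list f (drop (Suc i) as))"
      using IH(1) unfolding d holds_at_Cons holds_at_append by (auto simp: bit_symbol_def)
    have "?p (Suc i) = ?p i + 1 + length (f (as ! i))"
      using a(1) holds[OF a(2)] holds_at_length[OF a(2)] by simp
    then show ?case using a(3) IH(2) unfolding d by simp
  qed
  have el: "letter x (?p i) = 2" "holds_at x (?p i + 1) (f (as ! i))" if "i < length as" for i
    using p[of i] that unfolding encode_list_drop[OF that] holds_at_Cons holds_at_append by (auto simp: bit_symbol_def)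
  have last: "letter x (?p (length as)) = 1"
    using p[of "length as"] by (simp add: encode_list_simps holds_at_Cons bit_symbol_def)
  have stay: "?p i = ?p (length as)" if "length as \<le> i" for i
    using that
  proof (induction i rule: dec_induct)
    case (step i)
    then show ?case using last letter_pos[of x "?p (length as)"] by simp
  qed simp
  show len: "list_len nxt x s = length as"
    unfolding list_len_def
  proof (rule count_eq)
    show "length as \<le> length x"
      using length_le_encode_list[of as] holds_at_length[OF h] by simp
    show "letter x (?p i) = 2 \<longleftrightarrow> i < length as" for i
      using el(1)[of i] last stay[of i] by (cases "i < length as") auto
  qed
  show "list_end nxt x s = s + length (encode_list f as)"
    unfolding list_end_def len using p[of "length as"] by (simp add: encode_list_simps)
  show "list_ok ok nxt x s" unfolding list_ok_def len using el holds last by blast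
  show "holds_at x (?p i + 1) (f (as ! i))" if "i < length as" for i using el(2) that .
qed

lemma list_ok_holds:
  assumes ok': "list_ok ok nxt x s" and s: "s \<le> length x"
  shows "\<exists>as. holds_at x s (encode_list f as)"
proof -
  let ?p = "list_pos nxt x s" and ?n = "list_len nxt x s"
  have le: "?p i \<le> length x" for i using s by (cases i) auto
  have two: "letter x (?p i) = 2" if "i < ?n" for i
  proof (rule less_countD[where P = "\<lambda>i. letter x (?p i) = 2"])
    show "i < count (length x) (\<lambda>i. letter x (?p i) = 2)" using that by (simp add: list_len_def)
    show "letter x (?p j) = 2" if "letter x (?p (Suc j)) = 2" for j
    proof (rule ccontr)
      assume "letter x (?p j) \<noteq> 2"
      then have "?p (Suc j) = ?p j" using le[of j] by (simp add: min_absorb2)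
      then show False using that \<open>letter x (?p j) \<noteq> 2\<close> by simp
    qed
  qed
  \<comment> \<open>The list is rebuilt backwards, from its end, where only the closing bit is left,
    to entry 0.\<close>
  have "\<exists>as. holds_at x (?p i) (encode_list f as)" if "i \<le> ?n" for i
    using that
  proof (induction i rule: inc_induct)
    case base
    have "letter x (?p ?n) = 1" using ok' by (simp add: list_ok_def)
    then have "holds_at x (?p ?n) (encode_list f [])"
      using letter_pos[of x "?p ?n"] by (auto simp: encode_list_simps holds_at_Cons bit_symbol_def)
    then show ?case by blast
  next
    case (step i)
    then obtain as where as: "holds_at x (?p (Suc i)) (encode_list f as)" by blast
    have "ok x (?p i + 1)" using ok' step by (simp add: list_ok_def)
    then obtain a where a: "holds_at x (?p i + 1) (f a)" using ok by blast
    have "?p (Suc i) = ?p i + 1 + length (f a)"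
      using two[OF step(2)] holds[OF a] holds_at_length[OF a] by simp
    then have "holds_at x (?p i) (encode_list f (a # as))"
      using two[OF step(2)] a as by (simp add: encode_list_simps holds_at_Cons holds_at_append bit_symbol_def)
    then show ?case by blast
  qed
  from this[of 0] show ?thesis by simp
qed

end

interpretation vertex_parser: parser encode_nat after num_ok
proof
  show "after x p = p + length (encode_nat n) \<and> num_ok x p" if "holds_at x p (encode_nat n)" for x p n
    using holds_encode_nat(2,3)[OF that] by blast
  show "\<exists>n. holds_at x p (encode_nat n)" if "num_ok x p" for x p
    using that by (rule num_ok_holds)
qed

definition edge_ok :: "nat list \<Rightarrow> nat \<Rightarrow> bool" where "edge_ok x p \<longleftrightarrow> num_ok x p \<and> num_ok x (after x p)"
definition after_edge :: "nat list \<Rightarrow> nat \<Rightarrow> nat" where "after_edge x p = after x (after x p)"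

interpretation edge_parser: parser encode_edge after_edge edge_ok
proof
  fix x p and a :: "nat \<times> nat"
  assume h: "holds_at x p (encode_edge a)"
  obtain m n where a: "a = (m, n)" by fastforce
  have m: "holds_at x p (encode_nat m)" "holds_at x (p + length (encode_nat m)) (encode_nat n)"
    using h by (auto simp: a holds_at_append)
  then show "after_edge x p = p + length (encode_edge a) \<and> edge_ok x p"
    using holds_encode_nat[OF m(1)] holds_encode_nat[OF m(2)] by (simp add: a after_edge_def edge_ok_def)
next
  fix x p assume "edge_ok x p"
  then obtain m n where "holds_at x p (encode_nat m)" "holds_at x (after x p) (encode_nat n)"
    using num_ok_holds unfolding edge_ok_def by blast
  then have "holds_at x p (encode_edge (m, n))" using holds_encode_nat(2) by (simp add: holds_at_append)
  then show "\<exists>a. holds_at x p (encode_edge a)" by blast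
qed

definition y_start :: "nat list \<Rightarrow> nat" where "y_start x = list_end after x 0"
definition e_start :: "nat list \<Rightarrow> nat" where "e_start x = list_end after x (y_start x)"
definition k_start :: "nat list \<Rightarrow> nat" where "k_start x = list_end after_edge x (e_start x)"
definition word_end :: "nat list \<Rightarrow> nat" where "word_end x = after x (k_start x)"

definition format_ok :: "nat list \<Rightarrow> bool" where
  "format_ok x \<longleftrightarrow> list_ok num_ok after x 0 \<and> list_ok num_ok after x (y_start x) \<and>
     list_ok edge_ok after_edge x (e_start x) \<and> num_ok x (k_start x) \<and> letter x (word_end x) = 3"

lemma holds_with_certificate: "holds_at (with_certificate w u) 0 w"
  by (auto simp: holds_at_def nth_with_certificate)

lemma encode_lists_positions:
  fixes w u :: "bool list"
  assumes "w = encode_lists xs ys es k"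
  defines "x \<equiv> with_certificate w u"
  shows "holds_at x 0 (encode_list encode_nat xs)" "holds_at x (y_start x) (encode_list encode_nat ys)"
    "holds_at x (e_start x) (encode_list encode_edge es)" "holds_at x (k_start x) (encode_nat k)"
    "word_end x = length w"
proof -
  have h: "holds_at x 0 (encode_lists xs ys es k)" unfolding x_def assms(1)[symmetric] by (rule holds_with_certificate)
  show 1: "holds_at x 0 (encode_list encode_nat xs)" using h by (simp add: encode_lists_def holds_at_append)
  have y: "y_start x = length (encode_list encode_nat xs)"
    using vertex_parser.holds_encode_list(2)[OF 1] by (simp add: y_start_def)
  show 2: "holds_at x (y_start x) (encode_list encode_nat ys)"
    using h by (simp add: encode_lists_def holds_at_append y)
  have e: "e_start x = y_start x + length (encode_list encode_nat ys)"
    using vertex_parser.holds_encode_list(2)[OF 2] by (simp add: e_start_def)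
  show 3: "holds_at x (e_start x) (encode_list encode_edge es)"
    using h by (simp add: encode_lists_def holds_at_append y e)
  have k: "k_start x = e_start x + length (encode_list encode_edge es)"
    using edge_parser.holds_encode_list(2)[OF 3] by (simp add: k_start_def)
  show 4: "holds_at x (k_start x) (encode_nat k)"
    using h by (simp add: encode_lists_def holds_at_append y e k add.assoc)
  show "word_end x = length w"
    using holds_encode_nat(2)[OF 4] by (simp add: word_end_def y e k assms(1) encode_lists_def)
qed

text \<open>The separator is not a bit. So a parsed word that is followed by a separator cannot end
  before the end of \<open>w\<close>, where a bit would follow, nor after it, where it would contain
  the separator.\<close>

lemma format_ok_iff: "format_ok (with_certificate w u) \<longleftrightarrow> (\<exists>xs ys es k. w = encode_lists xs ys es k)"
proof
  let ?x = "with_certificate w u"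
  assume f: "format_ok ?x"
  obtain xs where 1: "holds_at ?x 0 (encode_list encode_nat xs)"
    using vertex_parser.list_ok_holds[of ?x 0] f by (auto simp: format_ok_def)
  have y: "y_start ?x = length (encode_list encode_nat xs)"
    using vertex_parser.holds_encode_list(2)[OF 1] by (simp add: y_start_def)
  obtain ys where 2: "holds_at ?x (y_start ?x) (encode_list encode_nat ys)"
    using vertex_parser.list_ok_holds[of ?x "y_start ?x"] f holds_at_length[OF 1] y by (auto simp: format_ok_def)
  have e: "e_start ?x = y_start ?x + length (encode_list encode_nat ys)"
    using vertex_parser.holds_encode_list(2)[OF 2] by (simp add: e_start_def)
  obtain es where 3: "holds_at ?x (e_start ?x) (encode_list encode_edge es)"
    using edge_parser.list_ok_holds[of ?x "e_start ?x"] f holds_at_length[OF 2] e by (auto simp: format_ok_def)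
  have k: "k_start ?x = e_start ?x + length (encode_list encode_edge es)"
    using edge_parser.holds_encode_list(2)[OF 3] by (simp add: k_start_def)
  obtain k where 4: "holds_at ?x (k_start ?x) (encode_nat k)"
    using num_ok_holds f by (auto simp: format_ok_def)
  let ?v = "encode_lists xs ys es k"
  have v: "holds_at ?x 0 ?v" using 1 2 3 4 by (simp add: encode_lists_def holds_at_append y e k add.assoc)
  have end_eq: "word_end ?x = length ?v"
    using holds_encode_nat(2)[OF 4] by (simp add: word_end_def y e k encode_lists_def)
  have sep: "?x ! length ?v = 3" "length ?v < length ?x"
    using f letter_pos[of ?x "word_end ?x"] by (auto simp: format_ok_def end_eq)
  have len: "length ?v = length w"
  proof (rule linorder_cases[of "length ?v" "length w"])
    assume "length ?v < length w"
    then show ?thesis using sep(1) by (simp add: nth_with_certificate bit_symbol_def split: if_splits)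
  next
    assume "length w < length ?v"
    then have "?x ! length w = bit_symbol (?v ! length w)" using v by (auto simp: holds_at_def)
    then show ?thesis by (simp add: nth_with_certificate bit_symbol_def separator_def split: if_splits)
  qed
  have "w = ?v"
  proof (rule nth_equalityI)
    fix i assume i: "i < length w"
    then have "?x ! i = bit_symbol (?v ! i)" using v len by (auto simp: holds_at_def)
    then have "bit_symbol (w ! i) = bit_symbol (?v ! i)" using i by (simp add: nth_with_certificate)
    then show "w ! i = ?v ! i" by (auto simp: bit_symbol_def split: if_splits)
  qed (simp add: len)
  then show "\<exists>xs ys es k. w = encode_lists xs ys es k" by blast
next
  assume "\<exists>xs ys es k. w = encode_lists xs ys es k"
  then obtain xs ys es k where w: "w = encode_lists xs ys es k" by blast
  note p = encode_lists_positions[OF w, of u]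
  have "letter (with_certificate w u) (length w) = 3"
    by (simp add: letter_def nth_with_certificate separator_def)
  then show "format_ok (with_certificate w u)"
    using vertex_parser.holds_encode_list(3)[OF p(1)] vertex_parser.holds_encode_list(3)[OF p(2)]
      edge_parser.holds_encode_list(3)[OF p(3)] holds_encode_nat(3)[OF p(4)] p(5)
    by (simp add: format_ok_def)
qed

subsection \<open>Instances given by lists\<close>

definition list_crosses :: "nat list \<Rightarrow> nat list \<Rightarrow> (nat \<times> nat) list \<Rightarrow> (nat \<Rightarrow> nat \<Rightarrow> bool) \<Rightarrow> nat \<Rightarrow> nat \<Rightarrow> bool" where
  "list_crosses xs ys es le i i' \<longleftrightarrow>
    (\<exists>j<length xs. \<exists>j'<length xs. \<exists>a<length ys. \<exists>a'<length ys.
       fst (es ! i) = xs ! j \<and> fst (es ! i') = xs ! j' \<and> snd (es ! i) = ys ! a \<and> snd (es ! i') = ys ! a' \<and>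
       a \<noteq> a' \<and> (j < j' \<and> le a' a \<or> j' < j \<and> le a a'))"

text \<open>The question in terms of list positions and bounded quantifiers, with \<open>le\<close>
  as an order of the positions in \<open>ys\<close>. Each conjunct has its counterpart in
  \<open>check\<close>, where entries are compared through \<open>same_num\<close>.\<close>

definition solution :: "nat list \<Rightarrow> nat list \<Rightarrow> (nat \<times> nat) list \<Rightarrow> nat \<Rightarrow> (nat \<Rightarrow> nat \<Rightarrow> bool) \<Rightarrow> bool" where
  "solution xs ys es k le \<longleftrightarrow>
    (\<forall>i<length xs. \<forall>j<i. xs ! i \<noteq> xs ! j) \<and> (\<forall>i<length ys. \<forall>j<i. ys ! i \<noteq> ys ! j) \<and>
    (\<forall>i<length es. \<forall>j<i. \<not> (fst (es ! i) = fst (es ! j) \<and> snd (es ! i) = snd (es ! j))) \<and>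
    (\<forall>i<length xs. \<forall>j<length ys. xs ! i \<noteq> ys ! j) \<and>
    (\<forall>i<length es. (\<exists>j<length xs. fst (es ! i) = xs ! j) \<and> (\<exists>a<length ys. snd (es ! i) = ys ! a)) \<and>
    (\<forall>a<length ys. le a a) \<and>
    (\<forall>a<length ys. \<forall>b<length ys. a \<noteq> b \<longrightarrow> (le a b \<or> le b a) \<and> \<not> (le a b \<and> le b a)) \<and>
    (\<forall>a<length ys. \<forall>b<length ys. \<forall>c<length ys. le a b \<and> le b c \<longrightarrow> le a c) \<and>
    (\<forall>i<length es. (\<Sum>i'<length es. of_bool (list_crosses xs ys es le i i')) \<le> k)"

lemma distinct_iff_nth: "distinct xs \<longleftrightarrow> (\<forall>i<length xs. \<forall>j<i. xs ! i \<noteq> xs ! j)"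
proof
  assume "distinct xs"
  then show "\<forall>i<length xs. \<forall>j<i. xs ! i \<noteq> xs ! j" by (auto simp: nth_eq_iff_index_eq)
next
  assume a: "\<forall>i<length xs. \<forall>j<i. xs ! i \<noteq> xs ! j"
  show "distinct xs"
    unfolding distinct_conv_nth
  proof (intro allI impI)
    fix i j assume "i < length xs" "j < length xs" "i \<noteq> j"
    then show "xs ! i \<noteq> xs ! j" using a[rule_format, of i j] a[rule_format, of j i] by (cases "i < j") auto
  qed
qed

lemma linear_order_of_list:
  assumes "distinct xs"
  defines "r \<equiv> {(xs ! i, xs ! j) | i j. i \<le> j \<and> j < length xs}"
  shows "linear_order_on (set xs) r" "sorted_wrt (strictly_below r) xs"
    "\<And>j j'. j < length xs \<Longrightarrow> j' < length xs \<Longrightarrow> strictly_below r (xs ! j) (xs ! j') \<longleftrightarrow> j < j'"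
proof -
  have iff: "(xs ! j, xs ! j') \<in> r \<longleftrightarrow> j \<le> j'" if "j < length xs" "j' < length xs" for j j'
    using assms that by (auto simp: nth_eq_iff_index_eq)
  show sb: "strictly_below r (xs ! j) (xs ! j') \<longleftrightarrow> j < j'" if "j < length xs" "j' < length xs" for j j'
    using iff[OF that] assms(1) that by (auto simp: strictly_below_def nth_eq_iff_index_eq)
  show "sorted_wrt (strictly_below r) xs" unfolding sorted_wrt_iff_nth_less using sb by auto
  have sub: "r \<subseteq> set xs \<times> set xs" by (auto simp: r_def)
  show "linear_order_on (set xs) r"
    unfolding order_on_defs
  proof (intro conjI)
    show "r \<subseteq> set xs \<times> set xs" by (rule sub)
    show "refl_on (set xs) r" using sub iff by (auto simp: refl_on_def in_set_conv_nth)
    show "trans r"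
    proof (rule transI)
      fix a b c assume ab: "(a, b) \<in> r" and bc: "(b, c) \<in> r"
      obtain i j where i: "a = xs ! i" "b = xs ! j" "i < length xs" "j < length xs" "i \<le> j" using ab by (auto simp: r_def)
      have "c \<in> set xs" using bc sub by blast
      then obtain k where k: "c = xs ! k" "k < length xs" by (auto simp: in_set_conv_nth)
      show "(a, c) \<in> r" using bc iff i k by auto
    qed
    show "antisym r"
    proof (rule antisymI)
      fix a b assume ab: "(a, b) \<in> r" and ba: "(b, a) \<in> r"
      obtain i j where i: "a = xs ! i" "b = xs ! j" "i < length xs" "j < length xs" "i \<le> j" using ab by (auto simp: r_def)
      then show "a = b" using ba iff by auto
    qed
    show "total_on (set xs) r"
    proof (rule total_onI)
      fix a b assume "a \<in> set xs" "b \<in> set xs"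
      then obtain i j where i: "a = xs ! i" "b = xs ! j" "i < length xs" "j < length xs" by (auto simp: in_set_conv_nth)
      then show "(a, b) \<in> r \<or> (b, a) \<in> r" using iff[of i j] iff[of j i] by auto
    qed
  qed
qed

lemma list_crosses_iff:
  assumes d: "distinct xs" "distinct ys" and es: "set es \<subseteq> set xs \<times> set ys" and i: "i < length es" "i' < length es"
    and rX: "\<And>j j'. j < length xs \<Longrightarrow> j' < length xs \<Longrightarrow> strictly_below rX (xs ! j) (xs ! j') \<longleftrightarrow> j < j'"
    and rY: "\<And>a b. a < length ys \<Longrightarrow> b < length ys \<Longrightarrow> (ys ! a, ys ! b) \<in> rY \<longleftrightarrow> le a b"
  shows "edges_cross rX rY (es ! i) (es ! i') \<longleftrightarrow> list_crosses xs ys es le i i'"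
proof -
  have "es ! i \<in> set xs \<times> set ys" "es ! i' \<in> set xs \<times> set ys" using es i nth_mem by blast+
  then obtain j a j' a' where e: "es ! i = (xs ! j, ys ! a)" "es ! i' = (xs ! j', ys ! a')"
    and l: "j < length xs" "a < length ys" "j' < length xs" "a' < length ys"
    by (auto simp: in_set_conv_nth)
  have "edges_cross rX rY (es ! i) (es ! i') \<longleftrightarrow> a \<noteq> a' \<and> (j < j' \<and> le a' a \<or> j' < j \<and> le a a')"
    using rX[OF l(1,3)] rX[OF l(3,1)] rY[OF l(2,4)] rY[OF l(4,2)] d l
    by (auto simp: e strictly_below_def nth_eq_iff_index_eq)
  also have "\<dots> \<longleftrightarrow> list_crosses xs ys es le i i'"
  proof
    assume "a \<noteq> a' \<and> (j < j' \<and> le a' a \<or> j' < j \<and> le a a')"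
    then show "list_crosses xs ys es le i i'" unfolding list_crosses_def e fst_conv snd_conv using l by blast
  next
    assume "list_crosses xs ys es le i i'"
    then obtain m n b c where m: "m < length xs" "n < length xs" "b < length ys" "c < length ys"
      "xs ! j = xs ! m" "xs ! j' = xs ! n" "ys ! a = ys ! b" "ys ! a' = ys ! c"
      "b \<noteq> c \<and> (m < n \<and> le c b \<or> n < m \<and> le b c)"
      unfolding list_crosses_def e fst_conv snd_conv by blast
    have "m = j" "n = j'" "b = a" "c = a'" using m(1-8) l d by (simp_all add: nth_eq_iff_index_eq)
    then show "a \<noteq> a' \<and> (j < j' \<and> le a' a \<or> j' < j \<and> le a a')" using m(9) by blast
  qed
  finally show ?thesis .
qed

lemma k_planar_list_iff:
  assumes d: "distinct xs" "distinct ys" "distinct es" and es: "set es \<subseteq> set xs \<times> set ys"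
    and rX: "\<And>j j'. j < length xs \<Longrightarrow> j' < length xs \<Longrightarrow> strictly_below rX (xs ! j) (xs ! j') \<longleftrightarrow> j < j'"
    and rY: "\<And>a b. a < length ys \<Longrightarrow> b < length ys \<Longrightarrow> (ys ! a, ys ! b) \<in> rY \<longleftrightarrow> le a b"
  shows "k_planar k (set es) rX rY \<longleftrightarrow>
    (\<forall>i<length es. (\<Sum>i'<length es. of_bool (list_crosses xs ys es le i i')) \<le> k)"
proof -
  note c = list_crosses_iff[OF d(1,2) es _ _ rX rY]
  have "card {e' \<in> set es. edges_cross rX rY (es ! i) e'} =
      (\<Sum>i'<length es. of_bool (list_crosses xs ys es le i i'))" if i: "i < length es" for i
  proof -
    have "{e' \<in> set es. edges_cross rX rY (es ! i) e'} = (!) es ` ({..<length es} \<inter> {i'. list_crosses xs ys es le i i'})"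
    proof (intro set_eqI iffI)
      fix e assume e: "e \<in> {e' \<in> set es. edges_cross rX rY (es ! i) e'}"
      then obtain i' where i': "i' < length es" "e = es ! i'" by (auto simp: in_set_conv_nth)
      then have "list_crosses xs ys es le i i'" using c[OF i i'(1)] e by simp
      then show "e \<in> (!) es ` ({..<length es} \<inter> {i'. list_crosses xs ys es le i i'})" using i' by blast
    next
      fix e assume "e \<in> (!) es ` ({..<length es} \<inter> {i'. list_crosses xs ys es le i i'})"
      then obtain i' where "i' < length es" "e = es ! i'" "list_crosses xs ys es le i i'" by blast
      then show "e \<in> {e' \<in> set es. edges_cross rX rY (es ! i) e'}" using c[OF i, of i'] by simp
    qed
    moreover have "inj_on ((!) es) ({..<length es} \<inter> {i'. list_crosses xs ys es le i i'})"
      using d(3) by (auto simp: inj_on_def nth_eq_iff_index_eq)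
    ultimately show ?thesis by (simp add: card_image sum_of_bool_eq)
  qed
  then show ?thesis unfolding k_planar_def all_set_conv_all_nth by simp
qed

lemma solution_iff:
  "(\<exists>le. solution xs ys es k le) \<longleftrightarrow> encode_lists xs ys es k \<in> One_Sided_k_Planarity"
proof
  assume "\<exists>le. solution xs ys es k le"
  then obtain le where s: "solution xs ys es k le" by blast
  note s1 = s[unfolded solution_def, THEN conjunct1]
  note s2 = s[unfolded solution_def, THEN conjunct2, THEN conjunct1]
  note s3 = s[unfolded solution_def, THEN conjunct2, THEN conjunct2, THEN conjunct1]
  note s4 = s[unfolded solution_def, THEN conjunct2, THEN conjunct2, THEN conjunct2, THEN conjunct1]
  note s5 = s[unfolded solution_def, THEN conjunct2, THEN conjunct2, THEN conjunct2, THEN conjunct2, THEN conjunct1]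
  note s6 = s[unfolded solution_def, THEN conjunct2, THEN conjunct2, THEN conjunct2, THEN conjunct2, THEN conjunct2, THEN conjunct1]
  note s7 = s[unfolded solution_def, THEN conjunct2, THEN conjunct2, THEN conjunct2, THEN conjunct2, THEN conjunct2, THEN conjunct2, THEN conjunct1]
  note s8 = s[unfolded solution_def, THEN conjunct2, THEN conjunct2, THEN conjunct2, THEN conjunct2, THEN conjunct2, THEN conjunct2, THEN conjunct2, THEN conjunct1]
  note s9 = s[unfolded solution_def, THEN conjunct2, THEN conjunct2, THEN conjunct2, THEN conjunct2, THEN conjunct2, THEN conjunct2, THEN conjunct2, THEN conjunct2]
  have d: "distinct xs" "distinct ys" using s1 s2 unfolding distinct_iff_nth by blast+
  have de: "distinct es" using s3 unfolding distinct_iff_nth prod_eq_iff by blast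
  have disj: "set xs \<inter> set ys = {}" using s4 by (metis disjoint_iff in_set_conv_nth)
  have es: "set es \<subseteq> set xs \<times> set ys"
  proof
    fix e assume "e \<in> set es"
    then obtain i where "i < length es" "e = es ! i" by (auto simp: in_set_conv_nth)
    then obtain j a where "j < length xs" "fst e = xs ! j" "a < length ys" "snd e = ys ! a"
      using s5 by blast
    then show "e \<in> set xs \<times> set ys" by (cases e) auto
  qed
  let ?rX = "{(xs ! i, xs ! j) | i j. i \<le> j \<and> j < length xs}"
  define rY where "rY = {(ys ! a, ys ! b) | a b. a < length ys \<and> b < length ys \<and> le a b}"
  have rY: "(ys ! a, ys ! b) \<in> rY \<longleftrightarrow> le a b" if "a < length ys" "b < length ys" for a b
    using d(2) that by (auto simp: rY_def nth_eq_iff_index_eq)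
  note X = linear_order_of_list[OF d(1)]
  have o: "\<And>a. a < length ys \<Longrightarrow> le a a"
    "\<And>a b. a < length ys \<Longrightarrow> b < length ys \<Longrightarrow> a \<noteq> b \<Longrightarrow> (le a b \<or> le b a) \<and> \<not> (le a b \<and> le b a)"
    "\<And>a b c. a < length ys \<Longrightarrow> b < length ys \<Longrightarrow> c < length ys \<Longrightarrow> le a b \<Longrightarrow> le b c \<Longrightarrow> le a c"
    using s6 s7 s8 by blast+
  have sub: "rY \<subseteq> set ys \<times> set ys" by (auto simp: rY_def)
  have linY: "linear_order_on (set ys) rY"
    unfolding order_on_defs
  proof (intro conjI)
    show "rY \<subseteq> set ys \<times> set ys" by (rule sub)
    show "refl_on (set ys) rY" using sub rY o(1) by (auto simp: refl_on_def in_set_conv_nth)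
    show "trans rY"
    proof (rule transI)
      fix u v w assume uv: "(u, v) \<in> rY" and vw: "(v, w) \<in> rY"
      obtain a b where a: "u = ys ! a" "v = ys ! b" "a < length ys" "b < length ys" using uv by (auto simp: rY_def)
      have "w \<in> set ys" using vw sub by blast
      then obtain c where c: "w = ys ! c" "c < length ys" by (auto simp: in_set_conv_nth)
      have "le a b" "le b c" using uv vw rY[OF a(3,4)] rY[OF a(4) c(2)] unfolding a c by blast+
      then have "le a c" using o(3) a c by blast
      then show "(u, w) \<in> rY" using rY[OF a(3) c(2)] unfolding a c by blast
    qed
    show "antisym rY"
    proof (rule antisymI)
      fix u v assume uv: "(u, v) \<in> rY" and vu: "(v, u) \<in> rY"
      obtain a b where a: "u = ys ! a" "v = ys ! b" "a < length ys" "b < length ys" using uv by (auto simp: rY_def)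
      have "le a b" "le b a" using uv vu rY[OF a(3,4)] rY[OF a(4,3)] unfolding a by blast+
      then have "a = b" using o(2) a by blast
      then show "u = v" by (simp add: a)
    qed
    show "total_on (set ys) rY"
    proof (rule total_onI)
      fix u v assume uv: "u \<in> set ys" "v \<in> set ys" "u \<noteq> v"
      then obtain a b where a: "u = ys ! a" "v = ys ! b" "a < length ys" "b < length ys" by (auto simp: in_set_conv_nth)
      then have "a \<noteq> b" using uv(3) by auto
      then have "le a b \<or> le b a" using o(2) a by blast
      then show "(u, v) \<in> rY \<or> (v, u) \<in> rY" using rY[OF a(3,4)] rY[OF a(4,3)] unfolding a by blast
    qed
  qed
  have "k_planar k (set es) ?rX rY"
    using k_planar_list_iff[where rX = ?rX and rY = rY and le = le and k = k, OF d de es X(3) rY] s9 by blast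
  then have "yes_instance (set xs, set ys, set es, k, ?rX)"
    using X(1) linY by (auto simp: two_layer_drawing_def)
  moreover have "valid_instance (set xs, set ys, set es, k, ?rX)"
    using X(1) disj es by (simp add: two_layer_network_def)
  moreover have "encodes (encode_lists xs ys es k) (set xs, set ys, set es, k, ?rX)"
    using d de X(2) by auto
  ultimately show "encode_lists xs ys es k \<in> One_Sided_k_Planarity"
    unfolding One_Sided_k_Planarity_def by blast
next
  assume "encode_lists xs ys es k \<in> One_Sided_k_Planarity"
  then obtain I where I: "valid_instance I" "encodes (encode_lists xs ys es k) I" "yes_instance I"
    unfolding One_Sided_k_Planarity_def by blast
  obtain X Y E k' rX where IX: "I = (X, Y, E, k', rX)" by (metis prod_cases5)
  obtain xs' ys' es' where l: "distinct xs'" "set xs' = X" "sorted_wrt (strictly_below rX) xs'"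
    "distinct ys'" "set ys' = Y" "distinct es'" "set es' = E" "encode_lists xs ys es k = encode_lists xs' ys' es' k'"
    using I(2) unfolding IX encodes.simps by blast
  have eq: "xs' = xs" "ys' = ys" "es' = es" "k' = k" using encode_lists_inj[OF l(8)] by auto
  have v: "X \<inter> Y = {}" "E \<subseteq> X \<times> Y" "linear_order_on X rX" using I(1) by (auto simp: IX two_layer_network_def)
  obtain rY where rY: "linear_order_on Y rY" "k_planar k E rX rY"
    using I(3) by (auto simp: IX two_layer_drawing_def eq)
  define le where "le a b \<longleftrightarrow> (ys ! a, ys ! b) \<in> rY" for a b
  have d: "distinct xs" "distinct ys" "distinct es" using l eq by auto
  have es: "set es \<subseteq> set xs \<times> set ys" using v l eq by auto
  have "rX = {(xs ! i, xs ! j) | i j. i \<le> j \<and> j < length xs}"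
    using linear_order_on_list[OF v(3) l(1-3)] eq by simp
  then have sX: "\<And>j j'. j < length xs \<Longrightarrow> j' < length xs \<Longrightarrow> strictly_below rX (xs ! j) (xs ! j') \<longleftrightarrow> j < j'"
    using linear_order_of_list(3)[OF d(1)] by blast
  have pl: "\<forall>i<length es. (\<Sum>i'<length es. of_bool (list_crosses xs ys es le i i')) \<le> k"
    using k_planar_list_iff[OF d es sX, of rY le k] rY(2) l(7) eq(3) by (simp add: le_def)
  have o: "refl_on (set ys) rY" "trans rY" "antisym rY" "total_on (set ys) rY"
    using rY(1) l(5) eq(2) by (auto simp: order_on_defs)
  have "solution xs ys es k le"
    unfolding solution_def
  proof (intro conjI)
    show "\<forall>i<length es. \<forall>j<i. \<not> (fst (es ! i) = fst (es ! j) \<and> snd (es ! i) = snd (es ! j))"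
      using d(3) by (auto simp: distinct_iff_nth prod_eq_iff)
    show "\<forall>i<length xs. \<forall>j<length ys. xs ! i \<noteq> ys ! j" using v(1) l(2,5) eq by (metis disjoint_iff nth_mem)
    show "\<forall>i<length es. (\<exists>j<length xs. fst (es ! i) = xs ! j) \<and> (\<exists>a<length ys. snd (es ! i) = ys ! a)"
    proof (intro allI impI)
      fix i assume "i < length es"
      then have "es ! i \<in> set xs \<times> set ys" using es nth_mem by blast
      then have "fst (es ! i) \<in> set xs" "snd (es ! i) \<in> set ys" by auto
      then show "(\<exists>j<length xs. fst (es ! i) = xs ! j) \<and> (\<exists>a<length ys. snd (es ! i) = ys ! a)"
        by (metis in_set_conv_nth)
    qed
    show "\<forall>a<length ys. le a a" using o(1) by (simp add: le_def refl_on_def)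
    show "\<forall>a<length ys. \<forall>b<length ys. a \<noteq> b \<longrightarrow> (le a b \<or> le b a) \<and> \<not> (le a b \<and> le b a)"
    proof (intro allI impI)
      fix a b assume ab: "a < length ys" "b < length ys" "a \<noteq> b"
      then have ne: "ys ! a \<noteq> ys ! b" using d(2) by (simp add: nth_eq_iff_index_eq)
      then show "(le a b \<or> le b a) \<and> \<not> (le a b \<and> le b a)"
        using o(3,4) ab unfolding le_def total_on_def antisym_def by (meson nth_mem)
    qed
    show "\<forall>a<length ys. \<forall>b<length ys. \<forall>c<length ys. le a b \<and> le b c \<longrightarrow> le a c"
      using o(2) unfolding le_def by (meson transD)
  qed (use d pl in \<open>auto simp: distinct_iff_nth\<close>)
  then show "\<exists>le. solution xs ys es k le" by blast
qed

text \<open>A certificate reproduces a given order only on the positions of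
  \<open>ys\<close>.\<close>

lemma solution_cong:
  assumes "\<And>a b. a < length ys \<Longrightarrow> b < length ys \<Longrightarrow> le a b = le' a b"
  shows "solution xs ys es k le = solution xs ys es k le'"
proof -
  have "list_crosses xs ys es le = list_crosses xs ys es le'"
    unfolding list_crosses_def fun_eq_iff by (simp add: assms cong: conj_cong)
  then show ?thesis unfolding solution_def using assms by (simp add: assms)
qed

subsection \<open>The verifier\<close>

definition x_len :: "nat list \<Rightarrow> nat" where "x_len x = list_len after x 0"
definition y_len :: "nat list \<Rightarrow> nat" where "y_len x = list_len after x (y_start x)"
definition e_len :: "nat list \<Rightarrow> nat" where "e_len x = list_len after_edge x (e_start x)"
definition x_pos :: "nat list \<Rightarrow> nat \<Rightarrow> nat" where "x_pos x i = list_pos after x 0 i + 1"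
definition y_pos :: "nat list \<Rightarrow> nat \<Rightarrow> nat" where "y_pos x i = list_pos after x (y_start x) i + 1"
definition e_pos :: "nat list \<Rightarrow> nat \<Rightarrow> nat" where "e_pos x i = list_pos after_edge x (e_start x) i + 1"
definition e_pos' :: "nat list \<Rightarrow> nat \<Rightarrow> nat" where "e_pos' x i = after x (e_pos x i)"

text \<open>The certificate is the matrix of an order of the vertices of \<open>Y\<close>, row by row.\<close>

definition below :: "nat list \<Rightarrow> nat \<Rightarrow> nat \<Rightarrow> bool" where
  "below x a b \<longleftrightarrow> letter x (word_end x + 1 + (a * y_len x + b)) = 2"

text \<open>The number \<open>k\<close> may be exponentially large, but no edge has more than \<open>length x\<close> crossings.\<close>

definition k_value :: "nat list \<Rightarrow> nat" where
  "k_value x = rec_nat 0 (\<lambda>i v. min (length x)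
     (2 * v + (letter x (k_start x + 2 * (num_len x (k_start x) - 1 - i) + 1) - 1))) (num_len x (k_start x))"

definition crosses :: "nat list \<Rightarrow> nat \<Rightarrow> nat \<Rightarrow> bool" where
  "crosses x i i' \<longleftrightarrow>
    (\<exists>j<x_len x. \<exists>j'<x_len x. \<exists>a<y_len x. \<exists>a'<y_len x.
       same_num x (e_pos x i) (x_pos x j) \<and> same_num x (e_pos x i') (x_pos x j') \<and>
       same_num x (e_pos' x i) (y_pos x a) \<and> same_num x (e_pos' x i') (y_pos x a') \<and>
       a \<noteq> a' \<and> (j < j' \<and> below x a' a \<or> j' < j \<and> below x a a'))"

definition check :: "nat list \<Rightarrow> bool" where
  "check x \<longleftrightarrow> format_ok x \<and>
    (\<forall>i<x_len x. \<forall>j<i. \<not> same_num x (x_pos x i) (x_pos x j)) \<and>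
    (\<forall>i<y_len x. \<forall>j<i. \<not> same_num x (y_pos x i) (y_pos x j)) \<and>
    (\<forall>i<e_len x. \<forall>j<i. \<not> (same_num x (e_pos x i) (e_pos x j) \<and> same_num x (e_pos' x i) (e_pos' x j))) \<and>
    (\<forall>i<x_len x. \<forall>j<y_len x. \<not> same_num x (x_pos x i) (y_pos x j)) \<and>
    (\<forall>i<e_len x. (\<exists>j<x_len x. same_num x (e_pos x i) (x_pos x j)) \<and>
       (\<exists>a<y_len x. same_num x (e_pos' x i) (y_pos x a))) \<and>
    (\<forall>a<y_len x. below x a a) \<and>
    (\<forall>a<y_len x. \<forall>b<y_len x. a \<noteq> b \<longrightarrow> (below x a b \<or> below x b a) \<and> \<not> (below x a b \<and> below x b a)) \<and>
    (\<forall>a<y_len x. \<forall>b<y_len x. \<forall>c<y_len x. below x a b \<and> below x b c \<longrightarrow> below x a c) \<and>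
    (\<forall>i<e_len x. (\<Sum>i'<e_len x. of_bool (crosses x i i')) \<le> k_value x)"

lemma k_value_eq:
  assumes "holds_at x (k_start x) (encode_nat k)"
  shows "k_value x = min (length x) k"
proof -
  note h = holds_encode_nat[OF assms] and d = binary_digits[of k]
  let ?l = "length (binary k)"
  have "rec_nat 0 (\<lambda>i v. min (length x) (2 * v + (letter x (k_start x + 2 * (?l - 1 - i) + 1) - 1))) i =
      min (length x) (k div 2 ^ (?l - i))" if "i \<le> ?l" for i
    using that
  proof (induction i)
    case 0
    have "k div 2 ^ ?l = 0" using d(2)[of ?l] by simp
    then show ?case by simp
  next
    case (Suc i)
    let ?j = "?l - 1 - i"
    have j: "?l - i = Suc ?j" "?l - Suc i = ?j" "?j < ?l" using Suc.prems by auto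
    have "binary k ! ?j = map (\<lambda>i. odd (k div 2 ^ i)) [0..<?l] ! ?j" by (rule arg_cong[OF d(1)])
    also have "\<dots> = odd (k div 2 ^ ?j)" using j(3) by (simp only: nth_map_upt diff_zero add_0)
    finally have "binary k ! ?j = odd (k div 2 ^ ?j)" .
    then have b: "letter x (k_start x + 2 * ?j + 1) - 1 = k div 2 ^ ?j mod 2"
      using h(4)[OF j(3)] by (auto simp: bit_symbol_def odd_iff_mod_2_eq_one)
    \<comment> \<open>Capping after every doubling gives the same result as capping once at the
      end.\<close>
    have m: "min n (2 * min n a + c) = min n (2 * a + c)" for n a c :: nat by auto
    have "k div 2 ^ Suc ?j = k div 2 ^ ?j div 2" by (simp add: div_mult2_eq[symmetric] mult.commute)
    then have "2 * (k div 2 ^ Suc ?j) + k div 2 ^ ?j mod 2 = k div 2 ^ ?j" by simp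
    then show ?case using Suc by (simp only: old.nat.simps(7) b m j)
  qed
  from this[of ?l] show ?thesis unfolding k_value_def h(1) by simp
qed

lemma check_iff_solution:
  assumes w: "w = encode_lists xs ys es k"
  shows "check (with_certificate w u) \<longleftrightarrow> solution xs ys es k (below (with_certificate w u))"
proof -
  define x where "x = with_certificate w u"
  note p = encode_lists_positions[OF w, of u, folded x_def]
  note X = vertex_parser.holds_encode_list[OF p(1)] and Y = vertex_parser.holds_encode_list[OF p(2)]
    and E = edge_parser.holds_encode_list[OF p(3)]
  have len: "x_len x = length xs" "y_len x = length ys" "e_len x = length es"
    using X(1) Y(1) E(1) by (simp_all add: x_len_def y_len_def e_len_def)
  have xh: "holds_at x (x_pos x i) (encode_nat (xs ! i))" if "i < length xs" for i
    using X(4)[OF that] by (simp add: x_pos_def)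
  have yh: "holds_at x (y_pos x i) (encode_nat (ys ! i))" if "i < length ys" for i
    using Y(4)[OF that] by (simp add: y_pos_def)
  have eh: "holds_at x (e_pos x i) (encode_nat (fst (es ! i)))"
    "holds_at x (e_pos' x i) (encode_nat (snd (es ! i)))" if "i < length es" for i
  proof -
    have h: "holds_at x (e_pos x i) (encode_nat (fst (es ! i)) @ encode_nat (snd (es ! i)))"
      using E(4)[OF that] by (cases "es ! i") (simp add: e_pos_def)
    then show 1: "holds_at x (e_pos x i) (encode_nat (fst (es ! i)))" by (simp add: holds_at_append)
    show "holds_at x (e_pos' x i) (encode_nat (snd (es ! i)))"
      using h holds_encode_nat(2)[OF 1] by (simp add: e_pos'_def holds_at_append)
  qed
  have xx: "same_num x (x_pos x i) (x_pos x j) \<longleftrightarrow> xs ! i = xs ! j" if "i < length xs" "j < length xs" for i j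
    using same_num_iff xh that by blast
  have yy: "same_num x (y_pos x i) (y_pos x j) \<longleftrightarrow> ys ! i = ys ! j" if "i < length ys" "j < length ys" for i j
    using same_num_iff yh that by blast
  have xy: "same_num x (x_pos x i) (y_pos x j) \<longleftrightarrow> xs ! i = ys ! j" if "i < length xs" "j < length ys" for i j
    using same_num_iff xh yh that by blast
  have ee: "same_num x (e_pos x i) (e_pos x j) \<longleftrightarrow> fst (es ! i) = fst (es ! j)" if "i < length es" "j < length es" for i j
    using same_num_iff eh(1) that by blast
  have ee': "same_num x (e_pos' x i) (e_pos' x j) \<longleftrightarrow> snd (es ! i) = snd (es ! j)" if "i < length es" "j < length es" for i j
    using same_num_iff eh(2) that by blast
  have ex: "same_num x (e_pos x i) (x_pos x j) \<longleftrightarrow> fst (es ! i) = xs ! j" if "i < length es" "j < length xs" for i j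
    using same_num_iff eh(1) xh that by blast
  have ey: "same_num x (e_pos' x i) (y_pos x j) \<longleftrightarrow> snd (es ! i) = ys ! j" if "i < length es" "j < length ys" for i j
    using same_num_iff eh(2) yh that by blast
  have cr: "crosses x i i' \<longleftrightarrow> list_crosses xs ys es (below x) i i'" if "i < length es" "i' < length es" for i i'
    unfolding crosses_def list_crosses_def len using that by (simp add: ex ey cong: conj_cong)
  have "length es < length (encode_list encode_edge es)" by (rule edge_parser.length_le_encode_list)
  then have es: "length es \<le> length x" using holds_at_length[OF p(3)] by simp
  have sum: "(\<Sum>i'<e_len x. of_bool (crosses x i i')) \<le> k_value x \<longleftrightarrow>
      (\<Sum>i'<length es. of_bool (list_crosses xs ys es (below x) i i')) \<le> k" if "i < length es" for i
  proof -
    have "(\<Sum>i'<e_len x. of_bool (crosses x i i')) = (\<Sum>i'<length es. of_bool (list_crosses xs ys es (below x) i i') :: nat)"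
      unfolding len using cr that by (intro sum.cong) auto
    moreover have "(\<Sum>i'<length es. of_bool (list_crosses xs ys es (below x) i i') :: nat) \<le> length es"
      using count_le[of "length es" "list_crosses xs ys es (below x) i"] by (simp add: count_def)
    ultimately show ?thesis unfolding k_value_eq[OF p(4)] using es by (simp add: le_trans)
  qed
  have "format_ok x" unfolding x_def format_ok_iff using w by blast
  then show ?thesis unfolding check_def solution_def x_def[symmetric]
    using sum by (simp add: len xx yy xy ee ee' ex ey cong: conj_cong)
qed

text \<open>Any certificate that passes proves membership, since \<open>check\<close> also tests
  that its matrix is a linear order. Conversely the matrix of a suitable order is short enough,
  because \<open>ys\<close> has fewer entries than its code has bits.\<close>

lemma check_iff_language:
  "(\<exists>u. length u \<le> length w * length w \<and> check (with_certificate w u)) \<longleftrightarrow> w \<in> One_Sided_k_Planarity"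
proof
  assume "\<exists>u. length u \<le> length w * length w \<and> check (with_certificate w u)"
  then obtain u where u: "check (with_certificate w u)" by blast
  then obtain xs ys es k where w: "w = encode_lists xs ys es k" using format_ok_iff by (auto simp: check_def)
  show "w \<in> One_Sided_k_Planarity"
    using check_iff_solution[OF w] u solution_iff[of xs ys es k] w by blast
next
  assume L: "w \<in> One_Sided_k_Planarity"
  then obtain xs ys es k where w: "w = encode_lists xs ys es k"
    unfolding One_Sided_k_Planarity_def by auto
  obtain le where s: "solution xs ys es k le" using L solution_iff w by blast
  let ?n = "length ys"
  define u where "u = map (\<lambda>m. le (m div ?n) (m mod ?n)) [0..<?n * ?n]"
  let ?x = "with_certificate w u"
  note p = encode_lists_positions[OF w, of u]
  have yl: "y_len ?x = ?n" using vertex_parser.holds_encode_list(1)[OF p(2)] by (simp add: y_len_def)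
  have "below ?x a b = le a b" if ab: "a < ?n" "b < ?n" for a b
  proof -
    have "a * ?n + b < Suc a * ?n" using ab by simp
    also have "\<dots> \<le> ?n * ?n" using ab by (intro mult_right_mono) auto
    finally have m: "a * ?n + b < ?n * ?n" .
    then have "?x ! (length w + 1 + (a * ?n + b)) = bit_symbol (u ! (a * ?n + b))"
      by (intro nth_with_certificate(3)) (simp add: u_def)
    moreover have "(c * n + d) div n = c" if "d < n" for c d n :: nat using that by simp
    from this[OF ab(2)] have "u ! (a * ?n + b) = le a b" using m ab by (simp add: u_def)
    ultimately have "letter ?x (length w + 1 + (a * ?n + b)) = bit_symbol (le a b)"
      using m by (simp add: letter_def u_def bit_symbol_def)
    then show ?thesis by (simp add: below_def yl p(5) bit_symbol_def)
  qed
  then have "solution xs ys es k (below ?x)" using s solution_cong[of ys "below ?x" le] by blast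
  then have "check ?x" using check_iff_solution[OF w] by blast
  moreover have "length u \<le> length w * length w"
  proof -
    have "?n < length (encode_list encode_nat ys)" by (rule vertex_parser.length_le_encode_list)
    also have "\<dots> \<le> length w" by (simp add: w encode_lists_def)
    finally show ?thesis by (simp add: u_def mult_le_mono)
  qed
  ultimately show "\<exists>u. length u \<le> length w * length w \<and> check (with_certificate w u)" by blast
qed

section \<open>Running time of the verifier\<close>

lemma polytime_num_len [polytime_intros]:
  assumes "polytime f"
  shows "polytime (\<lambda>x e. num_len x (f x e))"
proof (rule polytime_subst1[OF _ assms])
  show "polytime (\<lambda>x e. num_len x (e 0))" unfolding num_len_def count_def by (intro polytime_intros)
qed

lemma polytime_after [polytime_intros]: "polytime f \<Longrightarrow> polytime (\<lambda>x e. after x (f x e))"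
  unfolding after_def by (intro polytime_intros)

lemma polytime_after_edge [polytime_intros]: "polytime f \<Longrightarrow> polytime (\<lambda>x e. after_edge x (f x e))"
  unfolding after_edge_def by (intro polytime_intros)

lemma polytime_num_ok [polytime_intros]:
  assumes "polytime f"
  shows "polytime (\<lambda>x e. of_bool (num_ok x (f x e)))"
proof (rule polytime_subst1[OF _ assms])
  show "polytime (\<lambda>x e. of_bool (num_ok x (e 0)))" unfolding num_ok_def by (intro polytime_intros)
qed

lemma polytime_edge_ok [polytime_intros]: "polytime f \<Longrightarrow> polytime (\<lambda>x e. of_bool (edge_ok x (f x e)))"
  unfolding edge_ok_def by (intro polytime_intros)

lemma polytime_same_num [polytime_intros]:
  assumes "polytime f" "polytime g"
  shows "polytime (\<lambda>x e. of_bool (same_num x (f x e) (g x e)))"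
proof (rule polytime_subst2[OF _ assms])
  show "polytime (\<lambda>x e. of_bool (same_num x (e 0) (e (Suc 0))))"
    unfolding same_num_def by (intro polytime_intros)
qed

lemma polytime_list_pos:
  assumes nxt: "polytime (\<lambda>x e. nxt x (e 0))" and "polytime f" "polytime g"
  shows "polytime (\<lambda>x e. list_pos nxt x (f x e) (g x e))"
proof (rule polytime_subst2[OF _ assms(2,3)])
  show "polytime (\<lambda>x e. list_pos nxt x (e 0) (e (Suc 0)))"
    unfolding list_pos_def
  proof (rule polytime_rec[where q = "[:0, 1:]"])
    show "polytime (\<lambda>x e. min (length x) (if letter x (e 1) = 2 then nxt x (e 1 + 1) else e 1))"
      by (intro polytime_intros polytime_subst1[OF nxt])
    fix x :: "nat list" and e :: "nat \<Rightarrow> nat" and B i :: nat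
    assume "\<And>j. e j \<le> B"
    then have "e 0 \<le> B" by blast
    then show "rec_nat (e 0) (\<lambda>_ h. min (length x) (if letter x h = 2 then nxt x (h + 1) else h)) i
        \<le> poly [:0, 1:] (length x + B)"
      by (cases i) auto
  qed (intro polytime_intros)+
qed

lemma polytime_list_len:
  assumes nxt: "polytime (\<lambda>x e. nxt x (e 0))" and "polytime f"
  shows "polytime (\<lambda>x e. list_len nxt x (f x e))"
proof (rule polytime_subst1[OF _ assms(2)])
  show "polytime (\<lambda>x e. list_len nxt x (e 0))"
    unfolding list_len_def count_def by (intro polytime_intros polytime_list_pos[OF nxt])
qed

lemma polytime_list_end:
  assumes nxt: "polytime (\<lambda>x e. nxt x (e 0))" and "polytime f"
  shows "polytime (\<lambda>x e. list_end nxt x (f x e))"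
  unfolding list_end_def
  by (intro polytime_intros polytime_list_pos[OF nxt] polytime_list_len[OF nxt] assms(2))

lemma polytime_list_ok:
  assumes nxt: "polytime (\<lambda>x e. nxt x (e 0))" and ok: "polytime (\<lambda>x e. of_bool (ok x (e 0)))" and "polytime f"
  shows "polytime (\<lambda>x e. of_bool (list_ok ok nxt x (f x e)))"
proof (rule polytime_subst1[OF _ assms(3)])
  show "polytime (\<lambda>x e. of_bool (list_ok ok nxt x (e 0)))"
    unfolding list_ok_def
    by (intro polytime_intros polytime_list_pos[OF nxt] polytime_list_len[OF nxt] polytime_subst1[OF ok])
qed

lemma polytime_next: "polytime (\<lambda>x e. after x (e 0))" "polytime (\<lambda>x e. after_edge x (e 0))"
  by (intro polytime_intros)+

lemma polytime_starts [polytime_intros]: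
  "polytime (\<lambda>x e. y_start x)" "polytime (\<lambda>x e. e_start x)" "polytime (\<lambda>x e. k_start x)"
  "polytime (\<lambda>x e. word_end x)"
  unfolding word_end_def k_start_def e_start_def y_start_def
  by (intro polytime_intros polytime_list_end[OF polytime_next(1)] polytime_list_end[OF polytime_next(2)])+

lemma polytime_lens [polytime_intros]:
  "polytime (\<lambda>x e. x_len x)" "polytime (\<lambda>x e. y_len x)" "polytime (\<lambda>x e. e_len x)"
  unfolding x_len_def y_len_def e_len_def
  by (intro polytime_intros polytime_list_len[OF polytime_next(1)] polytime_list_len[OF polytime_next(2)])+

lemma polytime_positions [polytime_intros]:
  assumes "polytime f"
  shows "polytime (\<lambda>x e. x_pos x (f x e))" "polytime (\<lambda>x e. y_pos x (f x e))"
    "polytime (\<lambda>x e. e_pos x (f x e))" "polytime (\<lambda>x e. e_pos' x (f x e))"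
  unfolding e_pos'_def x_pos_def y_pos_def e_pos_def
  by (intro polytime_intros polytime_list_pos[OF polytime_next(1)] polytime_list_pos[OF polytime_next(2)] assms)+

lemma polytime_below [polytime_intros]:
  "polytime f \<Longrightarrow> polytime g \<Longrightarrow> polytime (\<lambda>x e. of_bool (below x (f x e) (g x e)))"
  unfolding below_def by (intro polytime_intros)

lemma polytime_format_ok [polytime_intros]: "polytime (\<lambda>x e. of_bool (format_ok x))"
  unfolding format_ok_def
  by (intro polytime_intros polytime_list_ok[OF polytime_next(1)] polytime_list_ok[OF polytime_next(2)])

lemma polytime_k_value [polytime_intros]: "polytime (\<lambda>x e. k_value x)"
  unfolding k_value_def
proof (rule polytime_rec[where q = "[:0, 1:]"])
  fix x :: "nat list" and e :: "nat \<Rightarrow> nat" and B i :: nat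
  show "rec_nat 0 (\<lambda>i v. min (length x)
     (2 * v + (letter x (k_start x + 2 * (num_len x (k_start x) - 1 - i) + 1) - 1))) i \<le> poly [:0, 1:] (length x + B)"
    by (cases i) auto
qed (intro polytime_intros)+

lemma polytime_crosses:
  assumes "polytime f" "polytime g"
  shows "polytime (\<lambda>x e. of_bool (crosses x (f x e) (g x e)))"
proof (rule polytime_subst2[OF _ assms])
  show "polytime (\<lambda>x e. of_bool (crosses x (e 0) (e (Suc 0))))"
    unfolding crosses_def by (intro polytime_intros)
qed

lemma polytime_check: "polytime (\<lambda>x e. of_bool (check x))"
  unfolding check_def by (intro polytime_intros polytime_crosses)

theorem One_Sided_k_Planarity_in_NP: "One_Sided_k_Planarity \<in> NP"
proof -
  obtain M and p :: "nat poly" where M: "wf_tm M" "\<And>x. \<forall>a\<in>set x. a \<noteq> blank \<and> a < 4 \<Longrightarrow>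
      \<exists>t\<le>poly p (length x).
        fst (config_after M x t) = (if of_bool (check x) = (0 :: nat) then reject_state M else accept_state M)"
    using polytime_decidable[OF polytime_check] by blast
  have c: "\<forall>a\<in>set (with_certificate w u). a \<noteq> blank \<and> a < 4" for w u
    by (auto simp: with_certificate_def bit_symbol_def blank_def separator_def)
  have halts: "halts_within M (with_certificate w u) (poly p (length (with_certificate w u)))" for w u
    using M(2)[OF c[of w u]] unfolding halts_within_def halting_state_def by (auto split: if_splits)
  have ne: "accept_state M \<noteq> reject_state M" using M(1) unfolding wf_tm_def by (elim conjE)
  have "accepts M (with_certificate w u) \<longleftrightarrow> check (with_certificate w u)" for w u
  proof -
    let ?x = "with_certificate w u"
    obtain t where t: "t \<le> poly p (length ?x)"
      "fst (config_after M ?x t) = (if of_bool (check ?x) = (0 :: nat) then reject_state M else accept_state M)"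
      using M(2)[OF c[of w u]] by blast
    have "halts_within M ?x t" using t(2) unfolding halts_within_def halting_state_def by (auto split: if_splits)
    from accepts_iff_at[OF this order_refl] show ?thesis using t(2) ne by auto
  qed
  then have "w \<in> One_Sided_k_Planarity \<longleftrightarrow>
      (\<exists>u. length u \<le> poly [:0, 0, 1:] (length w) \<and> accepts M (with_certificate w u))" for w
    using check_iff_language[of w] by simp
  then show ?thesis unfolding NP_def using M(1) halts by blast
qed

theorem theorem1:
  shows "NP_complete One_Sided_k_Planarity"
  unfolding NP_complete_def
  using One_Sided_k_Planarity_in_NP One_Sided_k_Planarity_NP_hard by blast

end
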